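(* Let $p_1,p_2$ and $q_1,q_2$ be pairs of distinct nonisotropic nonorthogonal points of $\mathbb PV$, let $\alpha_i,\beta_i\in\mathbb S^1\setminus\Omega$ be parameters, $i=1,2$, and let $\delta\in\Omega$. Assume that the complex lines $\mathrm L(p_1,p_2)$ and $\mathrm L(q_1,q_2)$ are noneuclidean. Then any length $4$ relation $R_{\alpha_2}^{p_2}R_{\alpha_1}^{p_1}=\delta R_{\beta_2}^{q_2}R_{\beta_1}^{q_1}$ follows from bending relations, $f$-bending relations, changes of orientation, changes of components, simultaneous changes of signs, single changes of sign, and length $4$ orthogonal relations. (That is, since $\delta R_{\beta_2}^{q_2}=R_{\delta\beta_2}^{q_2}$: there is a finite sequence of quadruples starting at $(p_1,p_2;\alpha_1,\alpha_2)$ and ending at $(q_1,q_2;\beta_1,\delta\beta_2)$ in which the equality between the products given by any two consecutive quadruples is a relation of one of the seven types listed, read in either direction.)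
   Context: Let $V$ be a 3-dimensional complex vector space with a Hermitian form $\langle-,-\rangle$ (linear in the first argument) of signature $++-$. The same letter denotes a point of $\mathbb PV$ and a representative in $V$. A point $p$ has signature $\sigma p\in\{-1,0,1\}$, the sign of $\langle p,p\rangle$, and is negative, isotropic, positive accordingly. $\mathrm{SU}(2,1)$ is the group of determinant $1$ linear automorphisms of $V$ preserving the form; its elements are called isometries and their fixed points are the points of $\mathbb PV$ given by eigenvectors. Let $\mathbb S^1\subset\mathbb C$ be the unit circle, $\omega=e^{2\pi i/3}$, $\Omega=\{1,\omega,\omega^2\}$; a parameter is an element of $\mathbb S^1\setminus\Omega$. For nonisotropic $p$ and $\alpha\in\mathbb S^1$, $R_\alpha^p\in\mathrm{SU}(2,1)$ is $R_\alpha^p:x\mapsto(\alpha^{-2}-\alpha)\frac{\langle x,p\rangle}{\langle p,p\rangle}p+\alpha x$. $\mathrm L(p_1,p_2)$ is the complex projective line through distinct $p_1,p_2$; a line $\mathbb PW$ is hyperbolic, spherical, Euclidean when the form on $W$ has signature $+-$, $++$, $+0$. For nonisotropic points, the tance is $\mathrm{ta}(p_1,p_2)=\frac{\langle p_1,p_2\rangle\langle p_2,p_1\rangle}{\langle p_1,p_1\rangle\langle p_2,p_2\rangle}$. An isometry is regular elliptic if it has a negative fixed point and three distinct eigenvalues. Geodesics. Let $L$ be a noneuclidean complex line. A geodesic in $L$ is the image in $\mathbb PV$ of $U\setminus\{0\}$, where $U$ is a real $2$-dimensional subspace on which the form is real and not identically zero, when this image lies in $L$. Through distinct nonorthogonal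 $p,q\in L$ there is a unique geodesic (given by $U=\mathbb Rp+\mathbb R\langle p,q\rangle q$). For nonorthogonal nonisotropic $p,q\in L$ of the same signature, $\mathrm G[p,q]$ is the arc of the geodesic through $p,q$ that joins $p$ and $q$ and does not contain the point $\tilde p\in L$ orthogonal to $p$ ($\mathrm G[p,p]=\{p\}$). For geodesics $G_1,G_2\subset L$ meeting at a nonisotropic $p$, $\angle_pG_1G_2\in[0,\pi)$ is the counterclockwise oriented angle from $G_1$ to $G_2$ at $p$ (orientation of $L$ given by its complex structure). $\mathrm{Arg}$ takes values in $[0,2\pi)$. Primitives and components. $J=\{e^{i\theta}:0<\theta<\pi/3\}$. The primitive of a parameter $\alpha$ is the unique $a\in J$ with $a^6=\alpha^3$. Put $I_0=\{e^{i\theta}:0<\theta<2\pi/3\}$, $I_1=\omega I_0$, $I_2=\omega^2I_0$; $\alpha\sim\beta$ ("same component") means that $\alpha,\beta$ lie in the same arc $I_j$. Associated geodesics. For distinct nonisotropic nonorthogonal $p_1,p_2$ with $L=\mathrm L(p_1,p_2)$ noneuclidean and parameters $\alpha_1,\alpha_2$ with primitives $a_1,a_2$, the geodesics associated to $R_{\alpha_2}^{p_2}R_{\alpha_1}^{p_1}$ are $G,G_1,G_2\subset L$, where $G$ passes through $p_1,p_2$, $G_i$ passes through $p_i$, $\angle_{p_1}G_1G=\mathrm{Arg}(a_1^3)$, and $\angle_{p_2}GG_2=\mathrm{Arg}(a_2^3)$. The seven types of relations. In all of them, quadruples $(p_1,p_2;\alpha_1,\alpha_2)$ consist of two distinct nonisotropic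 nonorthogonal points with $\mathrm L(p_1,p_2)$ noneuclidean and two parameters, and represent the product $R_{\alpha_2}^{p_2}R_{\alpha_1}^{p_1}$. (1) Bending relation: $R_{\alpha_2}^{p_2}R_{\alpha_1}^{p_1}=R_{\alpha_2}^{Cp_2}R_{\alpha_1}^{Cp_1}$ with $C\in\mathrm{SU}(2,1)$ commuting with $R_{\alpha_2}^{p_2}R_{\alpha_1}^{p_1}$. (2) $f$-bending: $R_{\alpha_2}^{p_2}R_{\alpha_1}^{p_1}=R_{\beta_2}^{q_2}R_{\beta_1}^{q_1}$ such that, with $G,G_1,G_2$ the geodesics associated to $R:=R_{\alpha_2}^{p_2}R_{\alpha_1}^{p_1}$: $q_i\in G_i$, $\sigma q_i=\sigma p_i$, $\langle p_i,q_i\rangle\neq0$, $\alpha_i\sim\beta_i$ ($i=1,2$), $\alpha_1\alpha_2=\beta_1\beta_2$, and neither $\mathrm G[p_1,q_1]$ nor $\mathrm G[p_2,q_2]$ contains a fixed point of $R$. (3) Change of orientation: $R_{\alpha_2}^{p_2}R_{\alpha_1}^{p_1}=R_{\alpha_1}^{R_{\alpha_2}^{p_2}p_1}R_{\alpha_2}^{p_2}$. (4) Change of components: $R_{\alpha_2}^{p_2}R_{\alpha_1}^{p_1}=R_{\omega\alpha_2}^{p_2}R_{\omega^{-1}\alpha_1}^{p_1}=R_{\omega^{-1}\alpha_2}^{p_2}R_{\omega\alpha_1}^{p_1}$. (5) Simultaneous change of signs: $R_{\alpha_2}^{p_2}R_{\alpha_1}^{p_1}=R_{\alpha_2}^{q_2}R_{\alpha_1}^{q_1}$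 with $\sigma p_i=-\sigma q_i$ ($i=1,2$), $\mathrm{ta}(p_1,p_2)=\mathrm{ta}(q_1,q_2)$, and $R_{\alpha_2}^{p_2}R_{\alpha_1}^{p_1}$ not regular elliptic. (6) Single change of sign: $R_{\alpha_2}^{p_2}R_{\alpha_1}^{p_1}=R_{\beta_2}^{q_2}R_{\beta_1}^{q_1}$ with $\alpha_1\alpha_2=\beta_1\beta_2$, such that no $\zeta\in\Omega$ satisfies both $\zeta\alpha_1\sim\beta_1$ and $\zeta^{-1}\alpha_2\sim\beta_2$, with $\mathrm{ta}(p_1,p_2)>1$, $\mathrm{ta}(q_1,q_2)<0$, and with the common trace $\tau$ not in the interior of Goldman's deltoid, i.e. $f(\tau)\geq0$, where $f(z)=|z|^4-8\,\mathrm{Re}(z^3)+18|z|^2-27$. (7) Length $4$ orthogonal relation: $R_{\alpha_2}^{p_2}R_{\alpha_1}^{p_1}=R_{\beta_2}^{q_2}R_{\beta_1}^{q_1}$ with $\alpha_1\alpha_2\neq\beta_1\beta_2$ (in this case the lines $\mathrm L(p_1,p_2)$ and $\mathrm L(q_1,q_2)$ are orthogonal, i.e. the polar point of one, meaning $\mathbb PW^\perp$ for the line $\mathbb PW$, lies on the other). *)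

theory Defs
  imports "HOL-Analysis.Analysis"
begin

text \<open>
  The vector space \<open>V\<close> is \<open>complex ^ 3\<close>, and the Hermitian form \<open>h\<close> on it is an arbitrary one of
  signature \<open>++-\<close>; it is an explicit parameter of everything that depends on it.
  Complex linear algebra uses \<open>*s\<close>, \<open>vec.span\<close>, \<open>vec.independent\<close>; the real
  structure of \<open>V\<close>, used for geodesics, is the one underlying \<open>*\<^sub>R\<close>, \<open>subspace\<close>, \<open>span\<close>, \<open>dim\<close>.
\<close>

type_synonym form = "complex ^ 3 \<Rightarrow> complex ^ 3 \<Rightarrow> complex"

definition hermitian_form :: "form \<Rightarrow> bool" where
  "hermitian_form h \<longleftrightarrow>
     (\<forall>x x' y. h (x + x') y = h x y + h x' y) \<and>
     (\<forall>c x y. h (c *s x) y = c * h x y) \<and>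
     (\<forall>x y. h y x = cnj (h x y))"

text \<open>
  \<open>has_signature h W ss\<close>: the restriction of \<open>h\<close> to the complex subspace \<open>W\<close> is
  diagonalised by some basis of \<open>W\<close> with diagonal entries \<open>ss\<close>, a list of numbers \<open>1, 0, -1\<close>.
\<close>

definition has_signature :: "form \<Rightarrow> (complex ^ 3) set \<Rightarrow> complex list \<Rightarrow> bool" where
  "has_signature h W ss \<longleftrightarrow>
     (\<exists>bs. length bs = length ss \<and> distinct bs \<and> vec.independent (set bs) \<and> vec.span (set bs) = W \<and>
        (\<forall>i<length ss. \<forall>j<length ss. h (bs ! i) (bs ! j) = (if i = j then ss ! i else 0)))"


subsection \<open>The projective plane\<close>

definition proportional :: "complex ^ 3 \<Rightarrow> complex ^ 3 \<Rightarrow> bool" where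
  "proportional x y \<longleftrightarrow> x \<noteq> 0 \<and> y \<noteq> 0 \<and> (\<exists>c. y = c *s x)"

lemma proportional_refl: "x \<noteq> 0 \<Longrightarrow> proportional x x"
  unfolding proportional_def by (metis vector_smult_lid)

lemma proportional_part_equivp: "part_equivp proportional"
proof (rule part_equivpI)
  show "\<exists>x. proportional x x"
    using proportional_refl[of 1] by auto
  show "symp proportional"
  proof (rule sympI)
    fix x y assume "proportional x y"
    then obtain c where c: "x \<noteq> 0" "y \<noteq> 0" "y = c *s x" unfolding proportional_def by blast
    then have "c \<noteq> 0" by auto
    with c(3) have "x = inverse c *s y" by (simp add: vector_smult_assoc)
    with c(1,2) show "proportional y x" unfolding proportional_def by blast
  qed
  show "transp proportional"
  proof (rule transpI)
    fix x y z assume "proportional x y" "proportional y z"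
    then obtain c d where c: "x \<noteq> 0" "y = c *s x" "z \<noteq> 0" "z = d *s y"
      unfolding proportional_def by blast
    then have "z = (d * c) *s x" by (simp add: vector_smult_assoc)
    with c(1,3) show "proportional x z" unfolding proportional_def by blast
  qed
qed

text \<open>
  Points of the projective plane of \<open>V\<close>. The point given by a vector \<open>v \<noteq> 0\<close> is \<open>abs_pv v\<close>
  (meaningless for \<open>v = 0\<close>), and \<open>rep_pv p\<close> is some representative of \<open>p\<close>. Each notion below that
  is defined through \<open>rep_pv\<close> does not depend on the choice of representatives.
\<close>

quotient_type pv = "complex ^ 3" / partial: proportional
  by (rule proportional_part_equivp)

definition PP :: "(complex ^ 3) set \<Rightarrow> pv set" where
  "PP W = {p. rep_pv p \<in> W}"

definition sig :: "form \<Rightarrow> pv \<Rightarrow> real" where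
  "sig h p = sgn (Re (h (rep_pv p) (rep_pv p)))"

definition orthogonal_pts :: "form \<Rightarrow> pv \<Rightarrow> pv \<Rightarrow> bool" where
  "orthogonal_pts h p q \<longleftrightarrow> h (rep_pv p) (rep_pv q) = 0"

definition tance :: "form \<Rightarrow> pv \<Rightarrow> pv \<Rightarrow> real" where
  "tance h p q =
     Re ((h (rep_pv p) (rep_pv q) * h (rep_pv q) (rep_pv p)) /
         (h (rep_pv p) (rep_pv p) * h (rep_pv q) (rep_pv q)))"

text \<open>
  A complex line is given by its underlying two-dimensional subspace \<open>W\<close> of \<open>V\<close>;
  its set of points is \<open>PP W\<close>.
\<close>

definition line_through :: "pv \<Rightarrow> pv \<Rightarrow> (complex ^ 3) set" where
  "line_through p q = vec.span {rep_pv p, rep_pv q}"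

definition euclidean_line :: "form \<Rightarrow> (complex ^ 3) set \<Rightarrow> bool" where
  "euclidean_line h W \<longleftrightarrow> has_signature h W [1, 0]"


subsection \<open>Isometries\<close>

definition SU21 :: "form \<Rightarrow> (complex ^ 3 \<Rightarrow> complex ^ 3) set" where
  "SU21 h = {f. Vector_Spaces.linear (*s) (*s) f \<and> det (matrix f) = 1 \<and>
                (\<forall>x y. h (f x) (f y) = h x y)}"

definition act :: "(complex ^ 3 \<Rightarrow> complex ^ 3) \<Rightarrow> pv \<Rightarrow> pv" where
  "act f p = abs_pv (f (rep_pv p))"

definition fixed_point :: "(complex ^ 3 \<Rightarrow> complex ^ 3) \<Rightarrow> pv \<Rightarrow> bool" where
  "fixed_point f p \<longleftrightarrow> (\<exists>c. f (rep_pv p) = c *s rep_pv p)"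

definition regular_elliptic :: "form \<Rightarrow> (complex ^ 3 \<Rightarrow> complex ^ 3) \<Rightarrow> bool" where
  "regular_elliptic h f \<longleftrightarrow>
     (\<exists>p. fixed_point f p \<and> sig h p = -1) \<and> card {c. \<exists>v. v \<noteq> 0 \<and> f v = c *s v} = 3"

definition refl_iso :: "form \<Rightarrow> complex \<Rightarrow> pv \<Rightarrow> complex ^ 3 \<Rightarrow> complex ^ 3" where
  "refl_iso h \<alpha> p x =
     ((inverse (\<alpha>\<^sup>2) - \<alpha>) * (h x (rep_pv p) / h (rep_pv p) (rep_pv p))) *s rep_pv p + \<alpha> *s x"

definition goldman :: "complex \<Rightarrow> real" where
  "goldman z = cmod z ^ 4 - 8 * Re (z ^ 3) + 18 * (cmod z)\<^sup>2 - 27"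


subsection \<open>Parameters\<close>

definition omega :: complex where
  "omega = cis (2 * pi / 3)"

definition Omega :: "complex set" where
  "Omega = {1, omega, omega\<^sup>2}"

definition parameter :: "complex \<Rightarrow> bool" where
  "parameter \<alpha> \<longleftrightarrow> cmod \<alpha> = 1 \<and> \<alpha> \<notin> Omega"

definition arc_J :: "complex set" where
  "arc_J = {cis \<theta> | \<theta>. 0 < \<theta> \<and> \<theta> < pi / 3}"

definition primitive :: "complex \<Rightarrow> complex" where
  "primitive \<alpha> = (THE a. a \<in> arc_J \<and> a ^ 6 = \<alpha> ^ 3)"

definition arc_I :: "nat \<Rightarrow> complex set" where
  "arc_I j = {omega ^ j * cis \<theta> | \<theta>. 0 < \<theta> \<and> \<theta> < 2 * pi / 3}"

definition same_component :: "complex \<Rightarrow> complex \<Rightarrow> bool" where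
  "same_component \<alpha> \<beta> \<longleftrightarrow> (\<exists>j\<in>{0, 1, 2}. \<alpha> \<in> arc_I j \<and> \<beta> \<in> arc_I j)"


subsection \<open>Geodesics\<close>

definition geodesic :: "form \<Rightarrow> (complex ^ 3) set \<Rightarrow> pv set \<Rightarrow> bool" where
  "geodesic h W G \<longleftrightarrow>
     (\<exists>U. subspace U \<and> dim U = 2 \<and>
          (\<forall>u\<in>U. \<forall>v\<in>U. h u v \<in> \<real>) \<and> (\<exists>u\<in>U. \<exists>v\<in>U. h u v \<noteq> 0) \<and>
          G = abs_pv ` (U - {0}) \<and> G \<subseteq> PP W)"

text \<open>
  Let \<open>p, q\<close> be distinct, nonorthogonal and nonisotropic. Their geodesic, a circle, is given by
  \<open>U = \<real>p + \<real>\<langle>p,q\<rangle>q\<close>. The points \<open>p\<close> and \<open>q\<close> divide it into the two closed arcs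
  \<open>geodesic_side h p q 1\<close> and \<open>geodesic_side h p q (-1)\<close>; the arc \<open>G[p,q]\<close> is the one without a
  point orthogonal to \<open>p\<close>.
\<close>

definition geodesic_side :: "form \<Rightarrow> pv \<Rightarrow> pv \<Rightarrow> real \<Rightarrow> pv set" where
  "geodesic_side h p q \<epsilon> =
     abs_pv ` ({s *\<^sub>R rep_pv p + (\<epsilon> * t) *\<^sub>R (h (rep_pv p) (rep_pv q) *s rep_pv q) | s t.
                  0 \<le> s \<and> 0 \<le> t} - {0})"

definition geodesic_arc :: "form \<Rightarrow> pv \<Rightarrow> pv \<Rightarrow> pv set" where
  "geodesic_arc h p q =
     (if p = q then {p}
      else (THE A. A \<in> {geodesic_side h p q 1, geodesic_side h p q (-1)} \<and>
                   (\<forall>x\<in>A. \<not> orthogonal_pts h x p)))"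

text \<open>
  The tangent space of the line \<open>L\<close> of \<open>W\<close> at \<open>p \<in> L\<close> is \<open>Hom(\<complex>p, W/\<complex>p)\<close>; the choice of the
  representative \<open>p\<^sub>0 = rep_pv p\<close> identifies it complex-linearly with \<open>W/\<complex>p\<^sub>0\<close>, the class of \<open>u\<close> being
  the velocity at \<open>t = 0\<close> of the curve of points given by \<open>p\<^sub>0 + tu\<close>. If \<open>G\<close> is a geodesic of \<open>L\<close>
  through \<open>p\<close>, there is exactly one real plane \<open>U \<ni> p\<^sub>0\<close> whose image is \<open>G\<close>, and
  \<open>tangent_vectors p G\<close> is \<open>U - \<real>p\<^sub>0\<close>, whose classes are the nonzero tangent vectors of \<open>G\<close> at \<open>p\<close>.
  The counterclockwise angle from \<open>G\<^sub>1\<close> to \<open>G\<^sub>2\<close> is the \<open>\<theta> \<in> [0,\<pi>)\<close> for which multiplication by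
  \<open>e\<^sup>i\<^sup>\<theta>\<close> takes the tangent real line of \<open>G\<^sub>1\<close> to that of \<open>G\<^sub>2\<close>.
\<close>

definition tangent_vectors :: "pv \<Rightarrow> pv set \<Rightarrow> (complex ^ 3) set" where
  "tangent_vectors p G = {u. abs_pv ` (span {rep_pv p, u} - {0}) = G}"

definition oriented_angle :: "pv \<Rightarrow> pv set \<Rightarrow> pv set \<Rightarrow> real" where
  "oriented_angle p G1 G2 =
     (THE \<theta>. 0 \<le> \<theta> \<and> \<theta> < pi \<and>
        (\<exists>u1\<in>tangent_vectors p G1. \<exists>u2\<in>tangent_vectors p G2. \<exists>c.
            u2 = cis \<theta> *s u1 + c *s rep_pv p))"


subsection \<open>Products of two isometries and relations between them\<close>

definition admissible_pair :: "form \<Rightarrow> pv \<Rightarrow> pv \<Rightarrow> bool" where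
  "admissible_pair h p1 p2 \<longleftrightarrow>
     p1 \<noteq> p2 \<and> sig h p1 \<noteq> 0 \<and> sig h p2 \<noteq> 0 \<and> \<not> orthogonal_pts h p1 p2 \<and>
     \<not> euclidean_line h (line_through p1 p2)"

text \<open>The quadruple \<open>(p\<^sub>1, p\<^sub>2; \<alpha>\<^sub>1, \<alpha>\<^sub>2)\<close> is the tuple \<open>(p1, p2, \<alpha>1, \<alpha>2)\<close>.\<close>

type_synonym quadruple = "pv \<times> pv \<times> complex \<times> complex"

definition is_quadruple :: "form \<Rightarrow> quadruple \<Rightarrow> bool" where
  "is_quadruple h = (\<lambda>(p1, p2, \<alpha>1, \<alpha>2).
     admissible_pair h p1 p2 \<and> parameter \<alpha>1 \<and> parameter \<alpha>2)"

definition product :: "form \<Rightarrow> quadruple \<Rightarrow> complex ^ 3 \<Rightarrow> complex ^ 3" where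
  "product h = (\<lambda>(p1, p2, \<alpha>1, \<alpha>2).
     refl_iso h \<alpha>2 p2 \<circ> refl_iso h \<alpha>1 p1)"

definition associated_geodesics :: "form \<Rightarrow> quadruple \<Rightarrow> pv set \<Rightarrow> pv set \<Rightarrow> pv set \<Rightarrow> bool" where
  "associated_geodesics h = (\<lambda>(p1, p2, \<alpha>1, \<alpha>2) G G1 G2.
     geodesic h (line_through p1 p2) G \<and> p1 \<in> G \<and> p2 \<in> G \<and>
     geodesic h (line_through p1 p2) G1 \<and> p1 \<in> G1 \<and>
     geodesic h (line_through p1 p2) G2 \<and> p2 \<in> G2 \<and>
     oriented_angle p1 G1 G = Arg2pi (primitive \<alpha>1 ^ 3) \<and>
     oriented_angle p2 G G2 = Arg2pi (primitive \<alpha>2 ^ 3))"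

text \<open>
  The next seven predicates contain only the conditions particular to each type; that both arguments
  are quadruples with the same product is required in \<open>elementary_relation\<close>.
\<close>

definition bending :: "form \<Rightarrow> quadruple \<Rightarrow> quadruple \<Rightarrow> bool" where
  "bending h = (\<lambda>(p1, p2, \<alpha>1, \<alpha>2) (q1, q2, \<beta>1, \<beta>2).
     \<beta>1 = \<alpha>1 \<and> \<beta>2 = \<alpha>2 \<and>
     (\<exists>C\<in>SU21 h. C \<circ> product h (p1, p2, \<alpha>1, \<alpha>2) = product h (p1, p2, \<alpha>1, \<alpha>2) \<circ> C \<and>
                 q1 = act C p1 \<and> q2 = act C p2))"

definition f_bending :: "form \<Rightarrow> quadruple \<Rightarrow> quadruple \<Rightarrow> bool" where
  "f_bending h = (\<lambda>(p1, p2, \<alpha>1, \<alpha>2) (q1, q2, \<beta>1, \<beta>2).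
     (\<exists>G G1 G2. associated_geodesics h (p1, p2, \<alpha>1, \<alpha>2) G G1 G2 \<and> q1 \<in> G1 \<and> q2 \<in> G2) \<and>
     sig h q1 = sig h p1 \<and> sig h q2 = sig h p2 \<and>
     \<not> orthogonal_pts h p1 q1 \<and> \<not> orthogonal_pts h p2 q2 \<and>
     same_component \<alpha>1 \<beta>1 \<and> same_component \<alpha>2 \<beta>2 \<and>
     \<alpha>1 * \<alpha>2 = \<beta>1 * \<beta>2 \<and>
     (\<forall>x \<in> geodesic_arc h p1 q1 \<union> geodesic_arc h p2 q2.
         \<not> fixed_point (product h (p1, p2, \<alpha>1, \<alpha>2)) x))"

definition change_orientation :: "form \<Rightarrow> quadruple \<Rightarrow> quadruple \<Rightarrow> bool" where
  "change_orientation h = (\<lambda>(p1, p2, \<alpha>1, \<alpha>2) (q1, q2, \<beta>1, \<beta>2).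
     q1 = p2 \<and> \<beta>1 = \<alpha>2 \<and> q2 = act (refl_iso h \<alpha>2 p2) p1 \<and> \<beta>2 = \<alpha>1)"

definition change_components :: "quadruple \<Rightarrow> quadruple \<Rightarrow> bool" where
  "change_components = (\<lambda>(p1, p2, \<alpha>1, \<alpha>2) (q1, q2, \<beta>1, \<beta>2).
     q1 = p1 \<and> q2 = p2 \<and>
     (\<beta>1 = inverse omega * \<alpha>1 \<and> \<beta>2 = omega * \<alpha>2 \<or>
      \<beta>1 = omega * \<alpha>1 \<and> \<beta>2 = inverse omega * \<alpha>2))"

definition simultaneous_sign_change :: "form \<Rightarrow> quadruple \<Rightarrow> quadruple \<Rightarrow> bool" where
  "simultaneous_sign_change h = (\<lambda>(p1, p2, \<alpha>1, \<alpha>2) (q1, q2, \<beta>1, \<beta>2).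
     \<beta>1 = \<alpha>1 \<and> \<beta>2 = \<alpha>2 \<and>
     sig h p1 = - sig h q1 \<and> sig h p2 = - sig h q2 \<and>
     tance h p1 p2 = tance h q1 q2 \<and>
     \<not> regular_elliptic h (product h (p1, p2, \<alpha>1, \<alpha>2)))"

definition single_sign_change :: "form \<Rightarrow> quadruple \<Rightarrow> quadruple \<Rightarrow> bool" where
  "single_sign_change h = (\<lambda>(p1, p2, \<alpha>1, \<alpha>2) (q1, q2, \<beta>1, \<beta>2).
     \<alpha>1 * \<alpha>2 = \<beta>1 * \<beta>2 \<and>
     \<not> (\<exists>\<zeta>\<in>Omega. same_component (\<zeta> * \<alpha>1) \<beta>1 \<and> same_component (inverse \<zeta> * \<alpha>2) \<beta>2) \<and>
     tance h p1 p2 > 1 \<and> tance h q1 q2 < 0 \<and>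
     goldman (trace (matrix (product h (p1, p2, \<alpha>1, \<alpha>2)))) \<ge> 0)"

definition orthogonal_relation :: "quadruple \<Rightarrow> quadruple \<Rightarrow> bool" where
  "orthogonal_relation = (\<lambda>(p1, p2, \<alpha>1, \<alpha>2) (q1, q2, \<beta>1, \<beta>2).
     \<alpha>1 * \<alpha>2 \<noteq> \<beta>1 * \<beta>2)"

definition elementary_relation :: "form \<Rightarrow> quadruple \<Rightarrow> quadruple \<Rightarrow> bool" where
  "elementary_relation h P Q \<longleftrightarrow>
     is_quadruple h P \<and> is_quadruple h Q \<and> product h P = product h Q \<and>
     (bending h P Q \<or> f_bending h P Q \<or> change_orientation h P Q \<or> change_components P Q \<or>
      simultaneous_sign_change h P Q \<or> single_sign_change h P Q \<or> orthogonal_relation P Q)"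


subsection \<open>Independence of representatives\<close>

lemma rep_pv_nonzero: "rep_pv p \<noteq> 0"
  using Quotient_rep_reflp[OF Quotient_pv, of p] by (simp add: proportional_def)

lemma abs_rep_pv: "abs_pv (rep_pv p) = p"
  by (rule Quotient_abs_rep[OF Quotient_pv])

lemma abs_pv_eq_iff:
  assumes "x \<noteq> 0" "y \<noteq> 0"
  shows "abs_pv x = abs_pv y \<longleftrightarrow> (\<exists>c. y = c *s x)"
proof -
  have "proportional x y \<longleftrightarrow> abs_pv x = abs_pv y"
    using Quotient_rel[OF Quotient_pv, of x y] proportional_refl assms by simp
  then show ?thesis using assms by (auto simp: proportional_def)
qed

lemma rep_abs_pv:
  assumes "v \<noteq> 0"
  obtains c where "c \<noteq> 0" "rep_pv (abs_pv v) = c *s v"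
proof -
  obtain c where "rep_pv (abs_pv v) = c *s v"
    using abs_pv_eq_iff[OF assms rep_pv_nonzero, of "abs_pv v"] abs_rep_pv by auto
  moreover from this have "c \<noteq> 0" using rep_pv_nonzero[of "abs_pv v"] by auto
  ultimately show ?thesis using that by blast
qed

lemma hermitian_form_scale:
  assumes "hermitian_form h"
  shows "h (c *s x) y = c * h x y" "h x (c *s y) = cnj c * h x y"
proof -
  have l: "h (c *s x) y = c * h x y" and s: "h y x = cnj (h x y)" for c x y
    using assms unfolding hermitian_form_def by blast+
  show "h (c *s x) y = c * h x y" by (rule l)
  show "h x (c *s y) = cnj c * h x y"
    by (subst s[of x "c *s y"], subst l, subst s[of x y], simp)
qed

lemma orthogonal_abs_pv:
  assumes "hermitian_form h" "v \<noteq> 0" "w \<noteq> 0"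
  shows "orthogonal_pts h (abs_pv v) (abs_pv w) \<longleftrightarrow> h v w = 0"
proof -
  obtain c where "c \<noteq> 0" "rep_pv (abs_pv v) = c *s v" using assms(2) by (rule rep_abs_pv)
  moreover obtain d where "d \<noteq> 0" "rep_pv (abs_pv w) = d *s w" using assms(3) by (rule rep_abs_pv)
  ultimately show ?thesis by (simp add: orthogonal_pts_def hermitian_form_scale[OF assms(1)])
qed

lemma sig_abs_pv:
  assumes "hermitian_form h" "v \<noteq> 0"
  shows "sig h (abs_pv v) = sgn (Re (h v v))"
proof -
  obtain c where c: "c \<noteq> 0" "rep_pv (abs_pv v) = c *s v"
    using assms(2) by (rule rep_abs_pv)
  have "h (c *s v) (c *s v) = of_real ((cmod c)\<^sup>2) * h v v"
    by (simp only: hermitian_form_scale[OF assms(1)] complex_norm_square ac_simps)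
  then have "Re (h (c *s v) (c *s v)) = (cmod c)\<^sup>2 * Re (h v v)" by simp
  with c show ?thesis by (simp add: sig_def sgn_mult)
qed

lemma tance_abs_pv:
  assumes "hermitian_form h" "v \<noteq> 0" "w \<noteq> 0"
  shows "tance h (abs_pv v) (abs_pv w) = Re ((h v w * h w v) / (h v v * h w w))"
proof -
  obtain c where c: "c \<noteq> 0" "rep_pv (abs_pv v) = c *s v" using assms(2) by (rule rep_abs_pv)
  obtain d where d: "d \<noteq> 0" "rep_pv (abs_pv w) = d *s w" using assms(3) by (rule rep_abs_pv)
  define k where "k = c * cnj c * (d * cnj d)"
  have "k \<noteq> 0" using c d by (simp add: k_def)
  moreover have "h (c *s v) (d *s w) * h (d *s w) (c *s v) = k * (h v w * h w v)"
    "h (c *s v) (c *s v) * h (d *s w) (d *s w) = k * (h v v * h w w)"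
    by (simp_all only: hermitian_form_scale[OF assms(1)] k_def ac_simps)
  ultimately show ?thesis by (simp add: tance_def c d)
qed

lemma refl_iso_abs_pv:
  assumes "hermitian_form h" "v \<noteq> 0"
  shows "refl_iso h \<alpha> (abs_pv v) x = ((inverse (\<alpha>\<^sup>2) - \<alpha>) * (h x v / h v v)) *s v + \<alpha> *s x"
proof -
  obtain c where c: "c \<noteq> 0" "rep_pv (abs_pv v) = c *s v"
    using assms(2) by (rule rep_abs_pv)
  have "h x (c *s v) / h (c *s v) (c *s v) = (cnj c * h x v) / (cnj c * (c * h v v))"
    by (simp only: hermitian_form_scale[OF assms(1)] ac_simps)
  also have "\<dots> = h x v / (c * h v v)"
    by (rule mult_divide_mult_cancel_left) (use c in simp)
  finally have "h x (c *s v) / h (c *s v) (c *s v) * c = h x v / h v v"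
    using c(1) by simp
  then show ?thesis
    by (simp only: refl_iso_def c vector_smult_assoc mult.assoc)
qed

end

theory Submission
  imports Defs
begin

text \<open>
  If the two products of parameters differ, the relation is itself a length 4 orthogonal relation.
  Otherwise both pairs span the same line \<open>W\<close>. Write \<open>\<alpha>\<^sub>i\<^sup>3 = e\<^bsup>2ix\<^sub>i\<^esup>\<close> with \<open>0 < x\<^sub>i < \<pi>\<close>. The product \<open>R\<close>,
  divided by a square root \<open>u\<close> of the determinant of its restriction to \<open>W\<close>, is an operator \<open>A\<close> on \<open>W\<close> with
  \<open>A + A\<^sup>-\<^sup>1 = 2m\<close>, where \<open>m = cos (x\<^sub>1 - x\<^sub>2) - 2 sin x\<^sub>1 sin x\<^sub>2 ta(p\<^sub>1,p\<^sub>2)\<close>.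

  If \<open>R\<close> has a nonisotropic eigenvector in \<open>W\<close>, it is diagonal in an orthogonal basis and also a product of
  two reflections centred on another line through two of the three fixed points, with a different product
  of parameters; two orthogonal relations through that third product suffice.

  Otherwise \<open>m \<le> -1\<close> with tance above 1, or \<open>m \<ge> 1\<close> with negative tance, and \<open>x\<^sub>1 + x\<^sub>2\<close> is determined up
  to adding \<open>\<pi>\<close>, which changes the sign of \<open>m\<close>. If the two sums differ, this is a single change of sign.
  If they agree, the signs of the points can be made to agree by a change of orientation (\<open>m \<ge> 1\<close>) or a simultaneous
  change of signs (\<open>m < -1\<close>), while for \<open>m = -1\<close> they agree already. The operator \<open>T = i(A - m)\<close> on \<open>W\<close> is
  selfadjoint with \<open>T\<^sup>2 = 1 - m\<^sup>2 \<le> 0\<close>, and \<open>G\<^sub>i\<close> is given by the real plane spanned by \<open>p\<^sub>i\<close> and \<open>Tp\<^sub>i\<close>. A suitable isometry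
  \<open>c - idT\<close> with real \<open>c, d\<close> moves \<open>q\<^sub>1\<close> onto \<open>G\<^sub>1\<close>, a bending, and then \<open>q\<^sub>2\<close> lies on \<open>G\<^sub>2\<close>
  because \<open>q\<^sub>2\<close> and \<open>p\<^sub>2\<close> are images of \<open>q\<^sub>1\<close> and \<open>p\<^sub>1\<close> under explicit polynomials in \<open>A\<close>; so an
  \<open>f\<close>-bending remains.
\<close>

section \<open>Hermitian forms of signature \<open>++-\<close>\<close>

text \<open>The number \<open>kap = \<alpha>1 * \<alpha>2\<close> is the eigenvalue of the product
  at the polar point of its line. The tance differs from 1 because the line is noneuclidean, and
  this keeps \<open>kap\<close> apart from the eigenvalues on the line. So the line is the image of
  \<open>R - kap\<close>, and equal products of parameters force equal lines. The delicate condition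
  of an f-bending is that its arcs avoid fixed points. When all eigenvectors on the line are
  isotropic, it holds automatically, since an arc between points of equal sign consists of
  nonisotropic points. A nonisotropic fixed point could lie on an arc, which is why that case is
  settled by a detour without arcs. An f-bending also preserves the signs of both points, so these
  must be matched beforehand. The sign of the tance is fixed by \<open>m\<close>: for
  \<open>m \<ge> 1\<close> the two points have opposite signs and can be interchanged; for
  \<open>m \<le> -1\<close> their signs agree and must be reversed together. The map
  \<open>T\<close>, which multiplies the form by \<open>1 - m\<^sup>2\<close>, does this unless
  \<open>m = -1\<close>. There \<open>T\<close> is nilpotent, and the sign of
  \<open>h (T p1) p1\<close> ties the sign of \<open>p1\<close> to data common to both
  pairs.\<close>

lemma in_span3: "x \<in> vec.span {a, b, c} \<longleftrightarrow> (\<exists>r s t. x = r *s a + s *s b + t *s c)"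
  by (auto simp: vec.span_insert vec.span_singleton image_iff diff_eq_eq ac_simps)

lemma in_span2: "x \<in> vec.span {a, b} \<longleftrightarrow> (\<exists>r s. x = r *s a + s *s b)"
  by (auto simp: vec.span_insert vec.span_singleton image_iff diff_eq_eq ac_simps)

locale hform =
  fixes h :: form
  assumes herm: "hermitian_form h"
    and sgnt: "has_signature h UNIV [1, 1, -1]"
begin

lemma h_add_left: "h (x + y) z = h x z + h y z"
  using herm unfolding hermitian_form_def by blast

lemma h_scale_left: "h (c *s x) y = c * h x y"
  using herm unfolding hermitian_form_def by blast

lemma h_cnj: "h y x = cnj (h x y)"
  using herm unfolding hermitian_form_def by blast

lemma h_add_right: "h z (x + y) = h z x + h z y"
  by (subst (1 2 3) h_cnj) (simp add: h_add_left)

lemma h_scale_right: "h x (c *s y) = cnj c * h x y"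
  using hermitian_form_scale[OF herm] by blast

lemma h_zero_left [simp]: "h 0 y = 0"
  using h_scale_left[of 0 0 y] by simp

lemma h_zero_right [simp]: "h x 0 = 0"
  using h_scale_right[of x 0 0] by simp

lemma h_minus_left: "h (- x) y = - h x y"
  using h_scale_left[of "-1" x y] by (simp add: vector_sneg_minus1[symmetric])

lemma h_minus_right: "h x (- y) = - h x y"
  using h_scale_right[of x "-1" y] by (simp add: vector_sneg_minus1[symmetric])

lemma h_diff_left: "h (x - y) z = h x z - h y z"
  using h_add_left[of x "- y" z] by (simp add: h_minus_left)

lemma h_diff_right: "h z (x - y) = h z x - h z y"
  using h_add_right[of z x "- y"] by (simp add: h_minus_right)

lemmas h_simps = h_add_left h_add_right h_scale_left h_scale_right h_diff_left h_diff_right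
  h_minus_left h_minus_right

lemma h_self_real: "h x x = of_real (Re (h x x))"
  using h_cnj[of x x] by (metis Reals_cnj_iff of_real_Re)

lemma h_eq_0_commute: "h x y = 0 \<longleftrightarrow> h y x = 0"
  by (metis h_cnj complex_cnj_zero)

lemma Re_h_self_eq_0: "Re (h x x) = 0 \<longleftrightarrow> h x x = 0"
  by (metis h_self_real of_real_0 zero_complex.simps(1))

lemma signature_basis:
  obtains b1 b2 b3 where "\<And>x. \<exists>r s t. x = r *s b1 + s *s b2 + t *s b3"
    "h b1 b1 = 1" "h b2 b2 = 1" "h b3 b3 = -1"
    "h b1 b2 = 0" "h b1 b3 = 0" "h b2 b1 = 0" "h b2 b3 = 0" "h b3 b1 = 0" "h b3 b2 = 0"
proof -
  obtain bs where "length bs = length [1::complex, 1, -1]" and "vec.span (set bs) = UNIV"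
    and g: "\<forall>i<length [1::complex, 1, -1]. \<forall>j<length [1::complex, 1, -1].
      h (bs ! i) (bs ! j) = (if i = j then [1, 1, -1] ! i else 0)"
    using sgnt unfolding has_signature_def by (elim exE conjE)
  then have bs: "length bs = 3" "vec.span (set bs) = UNIV"
      "\<And>i j. i < 3 \<Longrightarrow> j < 3 \<Longrightarrow> h (bs ! i) (bs ! j) = (if i = j then [1, 1, -1] ! i else 0)"
    by auto
  then obtain b1 b2 b3 where b: "bs = [b1, b2, b3]"
    by (auto simp: length_Suc_conv eval_nat_numeral)
  have s: "\<exists>r s t. x = r *s b1 + s *s b2 + t *s b3" for x
  proof -
    have "x \<in> vec.span {b1, b2, b3}" using bs(2) b by auto
    then show ?thesis by (simp only: in_span3)
  qed
  have g: "h ([b1, b2, b3] ! i) ([b1, b2, b3] ! j) = (if i = j then [1, 1, -1] ! i else 0)"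
    if "i < 3" "j < 3" for i j
    using bs(3)[OF that] b by simp
  show ?thesis
    by (rule that[OF s]) (use g[of 0 0] g[of 0 1] g[of 0 2] g[of 1 0] g[of 1 1] g[of 1 2]
        g[of 2 0] g[of 2 1] g[of 2 2] in simp_all)
qed

lemma nondegenerate:
  assumes "\<And>y. h x y = 0"
  shows "x = 0"
proof -
  obtain b1 b2 b3 where b: "\<And>x. \<exists>r s t. x = r *s b1 + s *s b2 + t *s b3"
    "h b1 b1 = 1" "h b2 b2 = 1" "h b3 b3 = -1"
    "h b1 b2 = 0" "h b1 b3 = 0" "h b2 b1 = 0" "h b2 b3 = 0" "h b3 b1 = 0" "h b3 b2 = 0"
    using signature_basis by blast
  obtain r s t where x: "x = r *s b1 + s *s b2 + t *s b3" using b(1) by blast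
  show ?thesis
    using assms[of b1] assms[of b2] assms[of b3] by (simp add: x h_simps b(2-))
qed

text \<open>In an orthonormal basis, orthogonality equates the negative part of the product with the
  positive part, which Cauchy-Schwarz bounds. If \<open>r\<close> were not positive, this bound
  would contradict that the negative coordinate of \<open>p\<close> dominates.\<close>

lemma orthogonal_to_negative:
  assumes p: "Re (h p p) < 0" and r: "h r p = 0" "r \<noteq> 0"
  shows "Re (h r r) > 0"
proof -
  obtain b1 b2 b3 where b: "\<And>x. \<exists>r s t. x = r *s b1 + s *s b2 + t *s b3"
    "h b1 b1 = 1" "h b2 b2 = 1" "h b3 b3 = -1"
    "h b1 b2 = 0" "h b1 b3 = 0" "h b2 b1 = 0" "h b2 b3 = 0" "h b3 b1 = 0" "h b3 b2 = 0"
    using signature_basis by blast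
  obtain p1 p2 p3 where pe: "p = p1 *s b1 + p2 *s b2 + p3 *s b3" using b(1) by blast
  obtain r1 r2 r3 where re: "r = r1 *s b1 + r2 *s b2 + r3 *s b3" using b(1) by blast
  have "h p p = p1 * cnj p1 + p2 * cnj p2 - p3 * cnj p3"
    by (simp add: pe h_simps b(2-) algebra_simps)
  then have pp: "(cmod p3)\<^sup>2 > (cmod p1)\<^sup>2 + (cmod p2)\<^sup>2"
    using p by (simp flip: complex_norm_square of_real_add of_real_diff)
  have "h r r = r1 * cnj r1 + r2 * cnj r2 - r3 * cnj r3"
    by (simp add: re h_simps b(2-) algebra_simps)
  then have rr: "Re (h r r) = (cmod r1)\<^sup>2 + (cmod r2)\<^sup>2 - (cmod r3)\<^sup>2"
    by (simp flip: complex_norm_square of_real_add of_real_diff)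
  have "r1 * cnj p1 + r2 * cnj p2 = r3 * cnj p3"
    using r(1) by (simp add: pe re h_simps b(2-) algebra_simps)
  then have e: "cmod r3 * cmod p3 \<le> cmod r1 * cmod p1 + cmod r2 * cmod p2"
    by (metis complex_mod_cnj norm_mult norm_triangle_ineq)
  show ?thesis
  proof (rule ccontr)
    assume "\<not> ?thesis"
    then have n': "(cmod r3)\<^sup>2 \<ge> (cmod r1)\<^sup>2 + (cmod r2)\<^sup>2" using rr by simp
    show False
    proof (cases "cmod r3 = 0")
      case True
      then have "r1 = 0" "r2 = 0" "r3 = 0" using n' by (auto simp: sum_power2_le_zero_iff)
      then show False using r(2) re by simp
    next
      case False
      have "(cmod r3 * cmod p3)\<^sup>2 \<le> (cmod r1 * cmod p1 + cmod r2 * cmod p2)\<^sup>2"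
        using e by (intro power_mono) auto
      also have "\<dots> \<le> ((cmod r1)\<^sup>2 + (cmod r2)\<^sup>2) * ((cmod p1)\<^sup>2 + (cmod p2)\<^sup>2)"
        using zero_le_power2[of "cmod r1 * cmod p2 - cmod r2 * cmod p1"]
        by (simp add: power2_eq_square algebra_simps)
      also have "\<dots> \<le> (cmod r3)\<^sup>2 * ((cmod p1)\<^sup>2 + (cmod p2)\<^sup>2)"
        using n' by (intro mult_right_mono) auto
      also have "\<dots> < (cmod r3)\<^sup>2 * (cmod p3)\<^sup>2"
        using pp False by simp
      finally show False by (simp add: power_mult_distrib)
    qed
  qed
qed

lemma orthogonal_expansion:
  assumes n: "h e1 e1 \<noteq> 0" "h e2 e2 \<noteq> 0" "h e3 e3 \<noteq> 0"
    and o: "h e1 e2 = 0" "h e1 e3 = 0" "h e2 e3 = 0"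
  shows "x = (h x e1 / h e1 e1) *s e1 + (h x e2 / h e2 e2) *s e2 + (h x e3 / h e3 e3) *s e3"
proof -
  have o': "h e2 e1 = 0" "h e3 e1 = 0" "h e3 e2 = 0" using o h_eq_0_commute by blast+
  have d: "e1 \<noteq> e2" "e1 \<noteq> e3" "e2 \<noteq> e3" using n o by auto
  have ns3: "e3 \<noteq> 0" using n by auto
  have n2: "e2 \<notin> vec.span {e3}"
    using n o by (auto simp: vec.span_singleton h_simps)
  have n1: "e1 \<notin> vec.span {e2, e3}"
  proof
    assume "e1 \<in> vec.span {e2, e3}"
    then obtain s t where "e1 = s *s e2 + t *s e3" by (auto simp: in_span2)
    then have "h e1 e1 = s * h e2 e1 + t * h e3 e1" by (metis h_add_left h_scale_left)
    then show False using n(1) o' by simp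
  qed
  have ind: "vec.independent {e1, e2, e3}"
    using n1 n2 ns3 d by (simp add: vec.independent_insert)
  have "vec.span {e1, e2, e3} = UNIV"
  proof -
    have "UNIV \<subseteq> vec.span {e1, e2, e3}"
      by (rule vec.card_ge_dim_independent[OF _ ind]) (use d in \<open>auto simp: card_cart_basis\<close>)
    then show ?thesis by auto
  qed
  then obtain r s t where x: "x = r *s e1 + s *s e2 + t *s e3"
    using in_span3[of x e1 e2 e3] by auto
  have "h x e1 = r * h e1 e1" "h x e2 = s * h e2 e2" "h x e3 = t * h e3 e3"
    by (simp_all add: x h_simps o o')
  then show ?thesis using x n by simp
qed

text \<open>Gram determinant. It vanishes both for proportional vectors and when the form
  degenerates on the plane, so one inequality encodes distinct points on a noneuclidean
  line.\<close>

definition gram :: "complex ^ 3 \<Rightarrow> complex ^ 3 \<Rightarrow> complex" where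
  "gram p q = h p p * h q q - h p q * h q p"

definition orthocomp :: "complex ^ 3 \<Rightarrow> complex ^ 3 \<Rightarrow> complex ^ 3" where
  "orthocomp p q = q - (h q p / h p p) *s p"

lemma orthocomp:
  assumes "h p p \<noteq> 0"
  shows "h (orthocomp p q) p = 0" "h p (orthocomp p q) = 0"
    "h (orthocomp p q) (orthocomp p q) = gram p q / h p p"
proof -
  show 1: "h (orthocomp p q) p = 0" using assms by (simp add: orthocomp_def h_simps)
  then show 2: "h p (orthocomp p q) = 0" using h_eq_0_commute by blast
  have "h (orthocomp p q) (orthocomp p q) = h (orthocomp p q) q"
    by (subst (2) orthocomp_def) (simp add: h_simps 1)
  also have "\<dots> = gram p q / h p p" using assms by (simp add: orthocomp_def h_simps gram_def field_simps)
  finally show "h (orthocomp p q) (orthocomp p q) = gram p q / h p p" .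
qed

text \<open>Removing from a vector outside the plane its components along an orthogonal basis of the
  plane leaves \<open>c\<close>. An isotropic \<open>c\<close> would be orthogonal to the whole
  space, which nondegeneracy excludes.\<close>

lemma polar_vector:
  assumes "h p p \<noteq> 0" "gram p q \<noteq> 0"
  obtains c where "h c c \<noteq> 0" "h p c = 0" "h q c = 0"
    "\<And>x. h x c = 0 \<Longrightarrow> \<exists>a b. x = a *s p + b *s q"
proof -
  define e where "e = orthocomp p q"
  have e: "h e p = 0" "h p e = 0" "h e e \<noteq> 0"
    using orthocomp[OF assms(1)] assms by (simp_all add: e_def)
  have "vec.span {p, e} \<noteq> UNIV"
  proof
    assume "vec.span {p, e} = (UNIV :: (complex ^ 3) set)"
    then have "vec.dim (UNIV :: (complex ^ 3) set) \<le> card {p, e}"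
      by (metis finite.emptyI finite_insert subset_refl vec.dim_le_card)
    also have "\<dots> \<le> 2" by (simp add: card_insert_if)
    finally show False by (simp add: card_cart_basis)
  qed
  then obtain y where y: "y \<notin> vec.span {p, e}" by blast
  define c where "c = y - (h y p / h p p) *s p - (h y e / h e e) *s e"
  have "h c p = 0" "h c e = 0" using assms e by (simp_all add: c_def h_simps)
  then have cp: "h c p = 0" "h c e = 0" "h p c = 0" "h e c = 0"
    using h_eq_0_commute[of c p] h_eq_0_commute[of c e] by simp_all
  have c0: "c \<noteq> 0"
  proof
    assume "c = 0"
    then have "y = (h y p / h p p) *s p + (h y e / h e e) *s e"
      by (simp add: c_def algebra_simps)
    then have "y \<in> vec.span {p, e}"
      by (metis insertCI vec.span_add vec.span_base vec.span_scale)
    then show False using y by simp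
  qed
  have cc: "h c c \<noteq> 0"
  proof
    assume iso: "h c c = 0"
    have 1: "e \<notin> vec.span {c}" using cp e by (auto simp: vec.span_singleton h_simps)
    have 2: "p \<notin> vec.span {e, c}"
    proof
      assume "p \<in> vec.span {e, c}"
      then obtain s t where "p = s *s e + t *s c" by (auto simp: in_span2)
      then have "h p p = s * h e p + t * h c p" by (metis h_add_left h_scale_left)
      then show False using assms e cp by simp
    qed
    have d: "p \<noteq> e" "p \<noteq> c" "e \<noteq> c" using assms(1) e cp by auto
    have ind: "vec.independent {p, e, c}"
      using 1 2 c0 d by (simp add: vec.independent_insert)
    have "UNIV \<subseteq> vec.span {p, e, c}"
      by (rule vec.card_ge_dim_independent[OF _ ind]) (use d in \<open>auto simp: card_cart_basis\<close>)
    then have sp: "x \<in> vec.span {p, e, c}" for x by auto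
    have "h c x = 0" for x
    proof -
      obtain r s t where x: "x = r *s p + s *s e + t *s c"
        using sp[of x] by (auto simp: in_span3)
      show ?thesis by (simp add: x h_simps cp iso)
    qed
    then show False using nondegenerate c0 by blast
  qed
  have qe: "q = (h q p / h p p) *s p + e" by (simp add: e_def orthocomp_def)
  have qc: "h q c = 0" by (subst qe) (simp add: h_simps cp)
  have id: "a *s p + b *s e = (a - b * k) *s p + b *s (k *s p + e)" for a b k
    by (simp add: vec_eq_iff algebra_simps)
  have "\<exists>a b. x = a *s p + b *s q" if "h x c = 0" for x
  proof -
    have "x = (h x p / h p p) *s p + (h x e / h e e) *s e + (h x c / h c c) *s c"
      by (rule orthogonal_expansion) (use assms e cp cc in auto)
    also have "\<dots> = (h x p / h p p) *s p + (h x e / h e e) *s e" using that by simp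
    also have "\<dots> = (h x p / h p p - (h x e / h e e) * (h q p / h p p)) *s p + (h x e / h e e) *s q"
      using id[of "h x p / h p p" "h x e / h e e" "h q p / h p p"] by (simp only: qe[symmetric])
    finally show ?thesis by blast
  qed
  then show ?thesis by (rule that[OF cc cp(3) qc])
qed

end

section \<open>Parameters\<close>

lemma cis_third_cube: "cis (t / 3) ^ 3 = cis t"
  by (subst Complex.DeMoivre) simp

lemma cis_eq_1_iff: "cis t = 1 \<longleftrightarrow> (\<exists>n. t = of_int n * (2 * pi))"
proof -
  have "cis t = 1 \<longleftrightarrow> cos t = 1"
    using sin_cos_squared_add[of t] by (auto simp: complex_eq_iff power2_eq_square)
  then show ?thesis by (auto simp: cos_one_2pi_int)
qed

lemma cis_eq_1_small:
  assumes "cis t = 1" "\<bar>t\<bar> < 2 * pi"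
  shows "t = 0"
proof -
  obtain n :: int where n: "t = of_int n * (2 * pi)" using assms(1) by (auto simp: cis_eq_1_iff)
  then have "\<bar>real_of_int n\<bar> < 1" using assms(2) by (simp add: abs_mult)
  then have "n = 0" by linarith
  then show ?thesis using n by simp
qed

lemma omega_cube: "omega ^ 3 = 1"
  unfolding omega_def cis_third_cube cis_eq_1_iff by (rule exI[of _ 1]) simp

lemma omega_ne_0: "omega \<noteq> 0"
  using omega_cube by auto

lemma omega_ne_1: "omega \<noteq> 1"
  using cis_eq_1_small[of "2 * pi / 3"] pi_gt_zero by (auto simp: omega_def)

lemma omega_sum: "1 + omega + omega\<^sup>2 = 0"
proof -
  have "(omega - 1) * (1 + omega + omega\<^sup>2) = omega ^ 3 - 1" by algebra
  then show ?thesis using omega_cube omega_ne_1 by simp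
qed

lemma Omega_iff: "z \<in> Omega \<longleftrightarrow> z ^ 3 = 1"
proof -
  have "z ^ 3 - 1 = (z - 1) * (z - omega) * (z - omega\<^sup>2)"
    using omega_sum omega_cube by algebra
  then show ?thesis by (auto simp: Omega_def)
qed

lemma parameter_iff: "parameter \<alpha> \<longleftrightarrow> cmod \<alpha> = 1 \<and> \<alpha> ^ 3 \<noteq> 1"
  by (simp add: parameter_def Omega_iff)

lemma Omega_norm: "z \<in> Omega \<Longrightarrow> cmod z = 1"
  unfolding Omega_iff by (metis norm_one norm_power norm_ge_zero power_eq_1_iff zero_neq_numeral)

lemma parameter_Omega_mult: "parameter \<alpha> \<Longrightarrow> z \<in> Omega \<Longrightarrow> parameter (z * \<alpha>)"
  using Omega_norm[of z] by (simp add: parameter_iff norm_mult power_mult_distrib Omega_iff)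

text \<open>Half the argument of the cube equals the argument of
  \<open>primitive \<alpha> ^ 3\<close>, the angle between associated geodesics. It does not change
  when the parameter is multiplied by an element of \<open>Omega\<close>.\<close>

definition ang :: "complex \<Rightarrow> real" where
  "ang \<alpha> = Arg2pi (\<alpha> ^ 3) / 2"

lemma ang:
  assumes "parameter \<alpha>"
  shows "0 < ang \<alpha>" "ang \<alpha> < pi" "\<alpha> ^ 3 = cis (2 * ang \<alpha>)"
proof -
  have n: "cmod (\<alpha> ^ 3) = 1" "\<alpha> ^ 3 \<noteq> 1" using assms by (simp_all add: parameter_iff norm_power)
  show e: "\<alpha> ^ 3 = cis (2 * ang \<alpha>)"
    using Arg2pi_eq[of "\<alpha> ^ 3"] n by (simp add: ang_def cis_conv_exp mult.commute)
  have "Arg2pi (\<alpha> ^ 3) \<noteq> 0" using e n by (auto simp: ang_def)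
  then show "0 < ang \<alpha>" "ang \<alpha> < pi"
    using Arg2pi_ge_0[of "\<alpha> ^ 3"] Arg2pi_lt_2pi[of "\<alpha> ^ 3"] by (simp_all add: ang_def)
qed

lemma ang_unique:
  assumes "0 \<le> x" "x < pi" "\<alpha> ^ 3 = cis (2 * x)"
  shows "ang \<alpha> = x"
proof -
  have "Arg2pi (\<alpha> ^ 3) = 2 * x"
    by (rule Arg2pi_unique[of 1]) (use assms in \<open>auto simp: cis_conv_exp mult.commute\<close>)
  then show ?thesis by (simp add: ang_def)
qed

lemma ang_Omega_mult: "z \<in> Omega \<Longrightarrow> ang (z * \<alpha>) = ang \<alpha>"
  by (simp add: ang_def power_mult_distrib Omega_iff)

lemma sin_ang_pos: "parameter \<alpha> \<Longrightarrow> sin (ang \<alpha>) > 0"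
  using ang sin_gt_zero by blast

lemma Arg2pi_primitive:
  assumes "parameter \<alpha>"
  shows "Arg2pi (primitive \<alpha> ^ 3) = ang \<alpha>"
proof -
  note a = ang[OF assms]
  have "primitive \<alpha> = cis (ang \<alpha> / 3)"
    unfolding primitive_def
  proof (rule the_equality)
    show "cis (ang \<alpha> / 3) \<in> arc_J \<and> cis (ang \<alpha> / 3) ^ 6 = \<alpha> ^ 3"
      using a cis_third_cube[of "ang \<alpha>"] power_mult[of "cis (ang \<alpha> / 3)" 3 2]
      by (auto simp: arc_J_def Complex.DeMoivre[of _ 2] intro!: exI[of _ "ang \<alpha> / 3"])
  next
    fix b assume b: "b \<in> arc_J \<and> b ^ 6 = \<alpha> ^ 3"
    then obtain t where t: "b = cis t" "0 < t" "t < pi / 3" by (auto simp: arc_J_def)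
    have "\<alpha> ^ 3 = cis (2 * (3 * t))" using b t by (simp add: Complex.DeMoivre[of t 6])
    then have "ang \<alpha> = 3 * t" using t by (intro ang_unique) auto
    then show "b = cis (ang \<alpha> / 3)" using t by simp
  qed
  then have "primitive \<alpha> ^ 3 = cis (ang \<alpha>)" by (simp add: cis_third_cube)
  then show ?thesis
    using a by (intro Arg2pi_unique[of 1]) (auto simp: cis_conv_exp mult.commute)
qed

lemma parameter_component:
  assumes "parameter \<alpha>"
  obtains j where "j \<in> {0, 1, 2}" "\<alpha> = omega ^ j * cis (2 * ang \<alpha> / 3)"
proof -
  have "(\<alpha> / cis (2 * ang \<alpha> / 3)) ^ 3 = 1"
    using ang(3)[OF assms] by (simp add: power_divide cis_third_cube)
  then have "\<alpha> / cis (2 * ang \<alpha> / 3) \<in> {omega ^ 0, omega ^ 1, omega ^ 2}"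
    unfolding Omega_iff[symmetric] Omega_def by simp
  then obtain j where "j \<in> {0, 1, 2}" "\<alpha> / cis (2 * ang \<alpha> / 3) = omega ^ j" by blast
  then show ?thesis using that by (simp add: divide_eq_eq)
qed

lemma same_componentI:
  assumes "parameter \<alpha>" "parameter \<beta>" "j \<in> {0, 1, 2}"
    "\<alpha> = omega ^ j * cis (2 * ang \<alpha> / 3)" "\<beta> = omega ^ j * cis (2 * ang \<beta> / 3)"
  shows "same_component \<alpha> \<beta>"
  unfolding same_component_def arc_I_def
  using assms ang(1,2)[OF assms(1)] ang(1,2)[OF assms(2)]
  by (intro bexI[of _ j] conjI CollectI exI[of _ "2 * ang \<alpha> / 3"] exI[of _ "2 * ang \<beta> / 3"]) auto

lemma same_component_quotient:
  assumes "same_component \<alpha> \<beta>"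
  shows "\<alpha> / \<beta> = cis (2 * (ang \<alpha> - ang \<beta>) / 3)"
proof -
  obtain j t s where j: "\<alpha> = omega ^ j * cis t" "\<beta> = omega ^ j * cis s"
    "0 < t" "t < 2 * pi / 3" "0 < s" "s < 2 * pi / 3"
    using assms unfolding same_component_def arc_I_def by blast
  have o: "(omega ^ j) ^ 3 = 1" by (metis omega_cube power_mult mult.commute power_one)
  have "ang \<alpha> = 3 * t / 2" "ang \<beta> = 3 * s / 2"
    by (rule ang_unique; use j o in \<open>simp add: power_mult_distrib Complex.DeMoivre[of _ 3]\<close>)+
  then have "t - s = 2 * (ang \<alpha> - ang \<beta>) / 3" by simp
  moreover have "\<alpha> / \<beta> = cis (t - s)" using j omega_ne_0 by (auto simp: cis_divide)
  ultimately show ?thesis by (simp only:)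
qed

text \<open>A parameter is \<open>cis (2 * ang \<alpha> / 3)\<close> times a power of
  \<open>omega\<close>. Choose \<open>z\<close> to align these powers for the first parameters;
  equal products and equal angle sums then force the inverse factor to align the second
  ones.\<close>

lemma same_component_of_equal_sum:
  assumes p: "parameter \<alpha>1" "parameter \<alpha>2" "parameter \<beta>1" "parameter \<beta>2"
    and e: "\<alpha>1 * \<alpha>2 = \<beta>1 * \<beta>2" and s: "ang \<alpha>1 + ang \<alpha>2 = ang \<beta>1 + ang \<beta>2"
  obtains z where "z \<in> Omega" "same_component \<alpha>1 (z * \<beta>1)" "same_component \<alpha>2 (inverse z * \<beta>2)"
proof -
  obtain i j k where i: "i \<in> {0, 1, 2}" "\<alpha>1 = omega ^ i * cis (2 * ang \<alpha>1 / 3)"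
    and j: "j \<in> {0, 1, 2}" "\<alpha>2 = omega ^ j * cis (2 * ang \<alpha>2 / 3)"
    and k: "\<beta>1 = omega ^ k * cis (2 * ang \<beta>1 / 3)"
    using parameter_component p by metis
  have o: "omega ^ n \<noteq> 0" "(omega ^ n) ^ 3 = 1" for n
    by (simp add: omega_ne_0, metis omega_cube power_mult mult.commute power_one)
  define z where "z = omega ^ i / omega ^ k"
  have z: "z \<in> Omega" "inverse z \<in> Omega" "z \<noteq> 0"
    using o omega_ne_0 by (simp_all add: z_def Omega_iff power_divide)
  have 1: "z * \<beta>1 = omega ^ i * cis (2 * ang \<beta>1 / 3)"
    by (subst k) (use omega_ne_0 in \<open>simp add: z_def\<close>)
  have b0: "\<beta>1 \<noteq> 0" using p(3) by (auto simp: parameter_iff)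
  have "2 * ang \<alpha>1 / 3 + 2 * ang \<alpha>2 / 3 = 2 * ang \<beta>1 / 3 + 2 * ang \<beta>2 / 3"
    using s by (simp add: field_simps)
  then have c: "cis (2 * ang \<alpha>1 / 3) * cis (2 * ang \<alpha>2 / 3) = cis (2 * ang \<beta>1 / 3) * cis (2 * ang \<beta>2 / 3)"
    by (simp only: cis_mult)
  have "(z * \<beta>1) * (inverse z * \<beta>2) = \<alpha>1 * \<alpha>2" using e z by simp
  also have "\<dots> = (omega ^ i * omega ^ j) * (cis (2 * ang \<alpha>1 / 3) * cis (2 * ang \<alpha>2 / 3))"
    by (subst i(2), subst j(2)) (simp only: ac_simps)
  also have "\<dots> = (z * \<beta>1) * (omega ^ j * cis (2 * ang \<beta>2 / 3))"
    unfolding c 1 by (simp only: ac_simps)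
  finally have 2: "inverse z * \<beta>2 = omega ^ j * cis (2 * ang \<beta>2 / 3)"
    using z b0 by (metis mult_cancel_left mult_eq_0_iff)
  show ?thesis
  proof (rule that[of z])
    show "same_component \<alpha>1 (z * \<beta>1)"
      by (rule same_componentI[OF p(1) parameter_Omega_mult[OF p(3) z(1)] i])
        (subst ang_Omega_mult[OF z(1)], rule 1)
    show "same_component \<alpha>2 (inverse z * \<beta>2)"
      by (rule same_componentI[OF p(2) parameter_Omega_mult[OF p(4) z(2)] j])
        (subst ang_Omega_mult[OF z(2)], rule 2)
  qed (rule z)
qed

text \<open>The two quotients of parameters multiply to 1, and their total argument is too small to
  be a nonzero multiple of \<open>2 * pi\<close>. The contrapositive supplies the component
  condition of a single change of sign.\<close>

lemma equal_sum_of_same_component: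
  assumes p: "parameter \<alpha>1" "parameter \<alpha>2" "parameter \<beta>1" "parameter \<beta>2"
    and e: "\<alpha>1 * \<alpha>2 = \<beta>1 * \<beta>2" and z: "z \<in> Omega"
    and c: "same_component (z * \<alpha>1) \<beta>1" "same_component (inverse z * \<alpha>2) \<beta>2"
  shows "ang \<alpha>1 + ang \<alpha>2 = ang \<beta>1 + ang \<beta>2"
proof -
  have z': "inverse z \<in> Omega" "z \<noteq> 0" using z by (auto simp: Omega_iff power_inverse)
  have b: "\<beta>1 \<noteq> 0" "\<beta>2 \<noteq> 0" using p by (auto simp: parameter_iff)
  have "1 = (z * \<alpha>1 / \<beta>1) * (inverse z * \<alpha>2 / \<beta>2)" using e z' b by (simp add: field_simps)
  also have "\<dots> = cis (2 * (ang \<alpha>1 - ang \<beta>1) / 3 + 2 * (ang \<alpha>2 - ang \<beta>2) / 3)"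
    using same_component_quotient[OF c(1)] same_component_quotient[OF c(2)]
    by (simp add: ang_Omega_mult z z' cis_mult)
  finally have "2 * (ang \<alpha>1 - ang \<beta>1) / 3 + 2 * (ang \<alpha>2 - ang \<beta>2) / 3 = 0"
    by (intro cis_eq_1_small) (use ang(1,2)[OF p(1)] ang(1,2)[OF p(2)] ang(1,2)[OF p(3)] ang(1,2)[OF p(4)]
        in \<open>auto simp: abs_if field_simps\<close>)
  then show ?thesis by (simp add: field_simps)
qed

text \<open>Cubing the common product shows that the sums differ by a multiple of \<open>pi\<close>;
  both lie strictly between 0 and \<open>2 * pi\<close>, which leaves three cases.\<close>

lemma ang_sum_cases:
  assumes p: "parameter \<alpha>1" "parameter \<alpha>2" "parameter \<beta>1" "parameter \<beta>2"
    and e: "\<alpha>1 * \<alpha>2 = \<beta>1 * \<beta>2"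
  shows "ang \<alpha>1 + ang \<alpha>2 = ang \<beta>1 + ang \<beta>2 \<or>
    ang \<alpha>1 + ang \<alpha>2 = ang \<beta>1 + ang \<beta>2 + pi \<or> ang \<alpha>1 + ang \<alpha>2 = ang \<beta>1 + ang \<beta>2 - pi"
proof -
  have "(\<alpha>1 * \<alpha>2) ^ 3 = cis (2 * (ang \<alpha>1 + ang \<alpha>2))" "(\<beta>1 * \<beta>2) ^ 3 = cis (2 * (ang \<beta>1 + ang \<beta>2))"
    by (simp_all add: power_mult_distrib ang(3)[OF p(1)] ang(3)[OF p(2)] ang(3)[OF p(3)] ang(3)[OF p(4)]
        cis_mult distrib_left)
  then have "cis (2 * (ang \<alpha>1 + ang \<alpha>2) - 2 * (ang \<beta>1 + ang \<beta>2)) = 1"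
    using e by (simp flip: cis_divide)
  then obtain n :: int where n: "2 * (ang \<alpha>1 + ang \<alpha>2) - 2 * (ang \<beta>1 + ang \<beta>2) = of_int n * (2 * pi)"
    by (auto simp: cis_eq_1_iff)
  then have n': "(ang \<alpha>1 + ang \<alpha>2) - (ang \<beta>1 + ang \<beta>2) = of_int n * pi" by simp
  have "\<bar>of_int n * pi\<bar> < 2 * pi" unfolding n'[symmetric]
    using ang(1,2)[OF p(1)] ang(1,2)[OF p(2)] ang(1,2)[OF p(3)] ang(1,2)[OF p(4)] by (auto simp: abs_if)
  then have "\<bar>real_of_int n\<bar> < 2" by (simp add: abs_mult)
  then have "n = -1 \<or> n = 0 \<or> n = 1" by linarith
  then show ?thesis using n' by auto
qed

section \<open>Reflections and quadruples\<close>

context hform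
begin

definition rf :: "complex \<Rightarrow> complex ^ 3 \<Rightarrow> complex ^ 3 \<Rightarrow> complex ^ 3" where
  "rf \<alpha> v x = ((inverse (\<alpha>\<^sup>2) - \<alpha>) * (h x v / h v v)) *s v + \<alpha> *s x"

lemma refl_iso_rf: "v \<noteq> 0 \<Longrightarrow> refl_iso h \<alpha> (abs_pv v) = rf \<alpha> v"
  using refl_iso_abs_pv[OF herm] by (auto simp: rf_def fun_eq_iff)

lemma refl_iso_rep: "refl_iso h \<alpha> p = rf \<alpha> (rep_pv p)"
  by (simp add: refl_iso_def rf_def fun_eq_iff)

lemma rf_add: "rf \<alpha> v (x + y) = rf \<alpha> v x + rf \<alpha> v y"
  by (simp add: rf_def h_simps vec_eq_iff algebra_simps add_divide_distrib)

lemma rf_scale: "rf \<alpha> v (c *s x) = c *s rf \<alpha> v x"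
  by (simp add: rf_def h_simps vec_eq_iff distrib_left mult_ac)

lemma rf_diff: "rf \<alpha> v (x - y) = rf \<alpha> v x - rf \<alpha> v y"
  using rf_add[of \<alpha> v "x - y" y] by simp

lemma rf_self: "h v v \<noteq> 0 \<Longrightarrow> rf \<alpha> v v = inverse (\<alpha>\<^sup>2) *s v"
  by (simp add: rf_def vec_eq_iff algebra_simps)

lemma rf_orthogonal: "h x v = 0 \<Longrightarrow> rf \<alpha> v x = \<alpha> *s x"
  by (simp add: rf_def)

lemma rf_Omega: "z \<in> Omega \<Longrightarrow> rf (z * \<alpha>) v x = z *s rf \<alpha> v x"
proof -
  assume "z \<in> Omega"
  then have "z ^ 3 = 1" "z \<noteq> 0" by (auto simp: Omega_iff)
  then have "inverse (z\<^sup>2) = z" by (simp add: field_simps power2_eq_square power3_eq_cube)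
  then show ?thesis by (simp add: rf_def power_mult_distrib vec_eq_iff algebra_simps)
qed

lemma rf_isometry:
  assumes v: "h v v \<noteq> 0" and \<alpha>: "cmod \<alpha> = 1"
  shows "h (rf \<alpha> v x) (rf \<alpha> v y) = h x y"
proof -
  define k where "k = inverse (\<alpha>\<^sup>2) - \<alpha>"
  have a: "\<alpha> * cnj \<alpha> = 1" using \<alpha> by (metis complex_norm_square of_real_1 power_one)
  have ka: "k + \<alpha> = inverse (\<alpha>\<^sup>2)" by (simp add: k_def)
  have "k * cnj k + k * cnj \<alpha> + \<alpha> * cnj k = (k + \<alpha>) * cnj (k + \<alpha>) - \<alpha> * cnj \<alpha>"
    by (simp add: algebra_simps)
  also have "\<dots> = inverse ((\<alpha> * cnj \<alpha>)\<^sup>2) - \<alpha> * cnj \<alpha>"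
    unfolding ka by (simp add: power_mult_distrib)
  finally have k: "k * cnj k + k * cnj \<alpha> + \<alpha> * cnj k = 0" using a by simp
  have n: "cnj (h v v) = h v v" "cnj (h y v) = h v y" using h_cnj by metis+
  have "h (rf \<alpha> v x) (rf \<alpha> v y) =
      (k * cnj k + k * cnj \<alpha> + \<alpha> * cnj k) * (h x v * h v y / h v v) + \<alpha> * cnj \<alpha> * h x y"
    unfolding rf_def k_def[symmetric] using v by (simp add: h_simps n field_simps power2_eq_square)
  then show ?thesis using k a by simp
qed

text \<open>Counterpart of \<open>is_quadruple\<close> for vectors, so that the algebra can use any
  representatives.\<close>

definition quad :: "complex ^ 3 \<Rightarrow> complex ^ 3 \<Rightarrow> complex \<Rightarrow> complex \<Rightarrow> bool" where
  "quad p1 p2 \<alpha>1 \<alpha>2 \<longleftrightarrow> h p1 p1 \<noteq> 0 \<and> h p2 p2 \<noteq> 0 \<and> h p1 p2 \<noteq> 0 \<and> gram p1 p2 \<noteq> 0 \<and>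
     parameter \<alpha>1 \<and> parameter \<alpha>2"

lemma line_through_abs:
  assumes "p \<noteq> 0" "q \<noteq> 0"
  shows "line_through (abs_pv p) (abs_pv q) = vec.span {p, q}"
proof -
  obtain c where c: "c \<noteq> 0" "rep_pv (abs_pv p) = c *s p" using rep_abs_pv[OF assms(1)] .
  obtain d where d: "d \<noteq> 0" "rep_pv (abs_pv q) = d *s q" using rep_abs_pv[OF assms(2)] .
  have "vec.span {c *s p, d *s q} = vec.span {p, q}"
  proof (rule vec.span_eq[THEN iffD2], intro conjI subsetI)
    fix x assume "x \<in> {c *s p, d *s q}"
    then show "x \<in> vec.span {p, q}" by (auto intro: vec.span_scale vec.span_base)
  next
    fix x assume "x \<in> {p, q}"
    then have "x = inverse c *s (c *s p) \<or> x = inverse d *s (d *s q)"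
      using c d by (auto simp: vector_smult_assoc)
    then show "x \<in> vec.span {c *s p, d *s q}"
      by (metis insertCI vec.span_base vec.span_scale)
  qed
  then show ?thesis by (simp add: line_through_def c d)
qed

text \<open>A null vector of the basis lies in the radical and gives a nontrivial solution of the
  Gram system. Conversely, \<open>orthocomp p q\<close> is isotropic and orthogonal to
  \<open>p\<close>; then \<open>p\<close> cannot be negative, by
  \<open>orthogonal_to_negative\<close>, and it can be normalised to
  \<open>h p p = 1\<close>.\<close>

lemma euclidean_span_iff:
  assumes p: "h p p \<noteq> 0" and i: "\<And>c. q \<noteq> c *s p"
  shows "euclidean_line h (vec.span {p, q}) \<longleftrightarrow> gram p q = 0"
proof
  assume "euclidean_line h (vec.span {p, q})"
  then obtain bs where bs: "length bs = length [1::complex, 0]" "distinct bs" "vec.independent (set bs)"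
      "vec.span (set bs) = vec.span {p, q}"
      and g: "\<forall>i<length [1::complex, 0]. \<forall>j<length [1::complex, 0]. h (bs ! i) (bs ! j) = (if i = j then [1, 0] ! i else 0)"
    unfolding euclidean_line_def has_signature_def by (elim exE conjE)
  from bs(1) obtain b1 b2 where b: "bs = [b1, b2]" by (auto simp: length_Suc_conv)
  have hb: "h b1 b2 = 0" "h b2 b2 = 0"
    using g[rule_format, of 0 1] g[rule_format, of 1 1] by (simp_all add: b)
  have sp: "vec.span {b1, b2} = vec.span {p, q}" using bs(4) b by simp
  have b0: "b2 \<noteq> 0" using bs(3) b vec.dependent_zero[of "{b1, b2}"] by auto
  have o: "h x b2 = 0" if "x \<in> vec.span {p, q}" for x
    using that unfolding sp[symmetric] by (auto simp: in_span2 h_simps hb)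
  have pq: "h p b2 = 0" "h q b2 = 0" by (rule o, simp add: vec.span_base)+
  have "b2 \<in> vec.span {p, q}" unfolding sp[symmetric] by (simp add: vec.span_base)
  then obtain r s where rs: "b2 = r *s p + s *s q" by (auto simp: in_span2)
  have "r * h p p + s * h q p = 0" "r * h p q + s * h q q = 0"
    using pq h_eq_0_commute[of b2] rs by (auto simp: h_simps)
  then have "r * gram p q = 0 \<and> s * gram p q = 0" unfolding gram_def by algebra
  moreover have "r \<noteq> 0 \<or> s \<noteq> 0" using b0 rs by auto
  ultimately show "gram p q = 0" by auto
next
  assume g: "gram p q = 0"
  define e where "e = orthocomp p q"
  have e: "h e p = 0" "h p e = 0" "h e e = 0" using orthocomp[OF p] g p by (simp_all add: e_def)
  have e0: "e \<noteq> 0" using i by (auto simp: e_def orthocomp_def)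
  have pos: "Re (h p p) > 0"
  proof (rule ccontr)
    assume "\<not> Re (h p p) > 0"
    then have "Re (h p p) < 0" using p Re_h_self_eq_0[of p] by linarith
    then show False using orthogonal_to_negative[of p e] e e0 by auto
  qed
  define k where "k = complex_of_real (1 / sqrt (Re (h p p)))"
  have k0: "k \<noteq> 0" using pos by (simp add: k_def)
  have "k * cnj k * of_real (Re (h p p)) = 1"
    using pos by (simp add: k_def flip: of_real_mult of_real_divide)
  then have "k * cnj k * h p p = 1" by (simp only: h_self_real[of p, symmetric])
  moreover have "h (k *s p) (k *s p) = k * cnj k * h p p" by (simp add: h_simps)
  ultimately have kk: "h (k *s p) (k *s p) = 1" by simp
  have "vec.span {k *s p, e} = vec.span {p, q}"
  proof (rule vec.span_eq[THEN iffD2], intro conjI subsetI)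
    fix x assume x: "x \<in> {k *s p, e}"
    have "k *s p \<in> vec.span {p, q}" "e \<in> vec.span {p, q}"
      unfolding e_def orthocomp_def by (intro vec.span_scale vec.span_diff vec.span_base; simp)+
    then show "x \<in> vec.span {p, q}" using x by blast
  next
    fix x assume "x \<in> {p, q}"
    moreover have "p = inverse k *s (k *s p)" using k0 by (simp add: vector_smult_assoc)
    moreover have "q = ((h q p / h p p) * inverse k) *s (k *s p) + e"
      using k0 by (simp add: vector_smult_assoc e_def orthocomp_def)
    ultimately show "x \<in> vec.span {k *s p, e}"
      by (metis (no_types) insertE insertI1 insertI2 singletonD vec.span_add vec.span_base vec.span_scale)
  qed
  moreover have "k *s p \<noteq> e" using kk e by auto
  moreover have "vec.independent {k *s p, e}"
  proof -
    have "k *s p \<noteq> t *s e" for t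
    proof
      assume "k *s p = t *s e"
      then have "1 = h (t *s e) (t *s e)" using kk by simp
      then show False using e by (simp add: h_simps)
    qed
    then have "k *s p \<notin> vec.span {e}" by (auto simp: vec.span_singleton)
    then show ?thesis using e0 by (simp add: vec.independent_insert)
  qed
  ultimately show "euclidean_line h (vec.span {p, q})"
    unfolding euclidean_line_def has_signature_def using kk e
    by (intro exI[of _ "[k *s p, e]"]) (auto simp: less_Suc_eq h_simps)
qed

lemma gram_scale: "gram p (c *s p) = 0"
  by (simp add: gram_def h_simps)

lemma is_quadruple_iff:
  assumes "p1 \<noteq> 0" "p2 \<noteq> 0"
  shows "is_quadruple h (abs_pv p1, abs_pv p2, \<alpha>1, \<alpha>2) \<longleftrightarrow> quad p1 p2 \<alpha>1 \<alpha>2"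
proof -
  have s: "sig h (abs_pv p1) \<noteq> 0 \<longleftrightarrow> h p1 p1 \<noteq> 0" "sig h (abs_pv p2) \<noteq> 0 \<longleftrightarrow> h p2 p2 \<noteq> 0"
    using assms by (simp_all add: sig_abs_pv[OF herm] sgn_zero_iff Re_h_self_eq_0)
  have o: "orthogonal_pts h (abs_pv p1) (abs_pv p2) \<longleftrightarrow> h p1 p2 = 0"
    using assms by (simp add: orthogonal_abs_pv[OF herm])
  have d: "abs_pv p1 \<noteq> abs_pv p2 \<longleftrightarrow> (\<forall>c. p2 \<noteq> c *s p1)" using assms by (simp add: abs_pv_eq_iff)
  have e: "euclidean_line h (line_through (abs_pv p1) (abs_pv p2)) \<longleftrightarrow> gram p1 p2 = 0"
    if "h p1 p1 \<noteq> 0" "\<forall>c. p2 \<noteq> c *s p1"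
    using that assms by (simp add: line_through_abs euclidean_span_iff)
  have g: "\<forall>c. p2 \<noteq> c *s p1" if "gram p1 p2 \<noteq> 0" using that gram_scale by metis
  show ?thesis
    unfolding is_quadruple_def admissible_pair_def quad_def prod.case s o d using e g by blast
qed

lemma is_quadruple_rep:
  "is_quadruple h (p1, p2, \<alpha>1, \<alpha>2) \<longleftrightarrow> quad (rep_pv p1) (rep_pv p2) \<alpha>1 \<alpha>2"
  using is_quadruple_iff[of "rep_pv p1" "rep_pv p2"] by (simp add: rep_pv_nonzero abs_rep_pv)

end

text \<open>Both eigenvalues of a reflection share the phase
  \<open>\<alpha> * cis (- ang \<alpha>)\<close>. Without it they are conjugate, so on a line the
  reflection is this phase times an operator of determinant 1.\<close>

lemma parameter_reflection:
  assumes "parameter \<alpha>"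
  shows "inverse (\<alpha>\<^sup>2) = (\<alpha> * cis (- ang \<alpha>)) * cis (- ang \<alpha>)" "\<alpha> = (\<alpha> * cis (- ang \<alpha>)) * cis (ang \<alpha>)"
    "inverse (\<alpha>\<^sup>2) - \<alpha> = - 2 * \<i> * sin (ang \<alpha>) * (\<alpha> * cis (- ang \<alpha>))"
proof -
  have a0: "\<alpha> \<noteq> 0" using assms by (auto simp: parameter_iff)
  have "cis (- ang \<alpha>) * cis (- ang \<alpha>) = inverse (\<alpha> ^ 3)"
    using ang(3)[OF assms] by (simp add: cis_mult)
  then show 1: "inverse (\<alpha>\<^sup>2) = (\<alpha> * cis (- ang \<alpha>)) * cis (- ang \<alpha>)"
    using a0 by (simp add: mult.assoc power2_eq_square power3_eq_cube)
  show 2: "\<alpha> = (\<alpha> * cis (- ang \<alpha>)) * cis (ang \<alpha>)" by (simp add: mult.assoc cis_mult)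
  have 3: "cis (- ang \<alpha>) - cis (ang \<alpha>) = - 2 * \<i> * sin (ang \<alpha>)" by (simp add: complex_eq_iff)
  have "inverse (\<alpha>\<^sup>2) - \<alpha> = (\<alpha> * cis (- ang \<alpha>)) * (cis (- ang \<alpha>) - cis (ang \<alpha>))"
    using 1 2 by (metis right_diff_distrib)
  then show "inverse (\<alpha>\<^sup>2) - \<alpha> = - 2 * \<i> * sin (ang \<alpha>) * (\<alpha> * cis (- ang \<alpha>))"
    unfolding 3 by simp
qed

section \<open>The product on its line\<close>

lemma cis_diff_sum:
  "cis (x - y) + cis (y - x) = complex_of_real (2 * cos (x - y))"
  using sin_minus[of "x - y"] cos_minus[of "x - y"] by (simp add: complex_eq_iff)

locale config = hform +
  fixes p1 p2 :: "complex ^ 3" and \<alpha>1 \<alpha>2 :: complex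
  assumes quad: "quad p1 p2 \<alpha>1 \<alpha>2"
begin

abbreviation "x1 \<equiv> ang \<alpha>1"
abbreviation "x2 \<equiv> ang \<alpha>2"
definition n1 :: real where "n1 = Re (h p1 p1)"
definition n2 :: real where "n2 = Re (h p2 p2)"
abbreviation "g \<equiv> h p1 p2"
abbreviation "W \<equiv> vec.span {p1, p2}"

definition R :: "complex ^ 3 \<Rightarrow> complex ^ 3" where "R x = rf \<alpha>2 p2 (rf \<alpha>1 p1 x)"
definition kap :: complex where "kap = \<alpha>1 * \<alpha>2"
text \<open>A square root of \<open>1 / kap\<close>, the determinant on \<open>W\<close>. The angle
  sum selects the root: shifting the sum by \<open>pi\<close> negates \<open>u\<close>, hence
  \<open>A\<close> and \<open>m\<close>.\<close>

definition u :: complex where "u = kap * cis (- (x1 + x2))"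
definition t :: real where "t = (cmod g)\<^sup>2 / (n1 * n2)"
definition m :: real where "m = cos (x1 - x2) - 2 * sin x1 * sin x2 * t"
definition A :: "complex ^ 3 \<Rightarrow> complex ^ 3" where "A x = inverse u *s R x"
definition T :: "complex ^ 3 \<Rightarrow> complex ^ 3" where "T x = \<i> *s (A x - of_real m *s x)"

lemma par: "parameter \<alpha>1" "parameter \<alpha>2"
  using quad by (simp_all add: quad_def)

lemma nonzero: "n1 \<noteq> 0" "n2 \<noteq> 0" "g \<noteq> 0" "h p1 p1 \<noteq> 0" "h p2 p2 \<noteq> 0" "h p2 p1 \<noteq> 0" "gram p1 p2 \<noteq> 0"
  "p1 \<noteq> 0" "p2 \<noteq> 0"
  using quad by (auto simp: quad_def n1_def n2_def Re_h_self_eq_0 h_eq_0_commute[of p2 p1])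

lemma hpp: "h p1 p1 = of_real n1" "h p2 p2 = of_real n2" "h p2 p1 = cnj g"
  unfolding n1_def n2_def using h_self_real h_cnj by blast+

lemma t_eq: "of_real t = g * cnj g / (of_real n1 * of_real n2)"
  unfolding t_def by (simp flip: complex_norm_square)

lemma t_ne: "t \<noteq> 0" "t \<noteq> 1"
proof -
  show "t \<noteq> 0" using nonzero by (simp add: t_def)
  have "gram p1 p2 = of_real n1 * of_real n2 * (1 - of_real t)"
    unfolding t_eq gram_def hpp using nonzero by (simp add: field_simps)
  then show "t \<noteq> 1" using nonzero by auto
qed

lemma sin_pos: "sin x1 > 0" "sin x2 > 0"
  using par sin_ang_pos by auto

lemma cmod_kap: "cmod kap = 1" and cmod_u: "cmod u = 1"
  using par by (simp_all add: kap_def u_def parameter_iff norm_mult)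

lemma kap_u_nz: "kap \<noteq> 0" "u \<noteq> 0"
  using cmod_kap cmod_u by auto

lemma u_mult: "u = (\<alpha>1 * cis (- x1)) * (\<alpha>2 * cis (- x2))"
  by (simp add: u_def kap_def cis_mult mult_ac)

lemma kap_u: "kap = u * cis (x1 + x2)"
  by (simp add: u_def mult.assoc cis_mult)

lemma u_square_kap: "u\<^sup>2 * kap = 1"
proof -
  have "cis (- (x1 + x2)) ^ 2 * kap ^ 3 = 1"
    using ang(3)[OF par(1)] ang(3)[OF par(2)]
    by (simp add: kap_def power_mult_distrib cis_mult Complex.DeMoivre algebra_simps)
  then show ?thesis by (simp add: u_def power_mult_distrib power2_eq_square power3_eq_cube mult_ac)
qed

lemma rf_p1: "rf \<alpha>1 p1 x = (\<alpha>1 * cis (- x1)) *s (cis x1 *s x - ((2 * \<i> * sin x1) * (h x p1 / n1)) *s p1)"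
proof -
  have "\<alpha>1 *s x = (\<alpha>1 * cis (- x1)) *s (cis x1 *s x)"
    by (simp only: vector_smult_assoc parameter_reflection(2)[OF par(1), symmetric])
  then show ?thesis
    unfolding rf_def parameter_reflection(3)[OF par(1)] hpp by (simp add: vec_eq_iff algebra_simps)
qed

lemma rf_p2: "rf \<alpha>2 p2 x = (\<alpha>2 * cis (- x2)) *s (cis x2 *s x - ((2 * \<i> * sin x2) * (h x p2 / n2)) *s p2)"
proof -
  have "\<alpha>2 *s x = (\<alpha>2 * cis (- x2)) *s (cis x2 *s x)"
    by (simp only: vector_smult_assoc parameter_reflection(2)[OF par(2), symmetric])
  then show ?thesis
    unfolding rf_def parameter_reflection(3)[OF par(2)] hpp by (simp add: vec_eq_iff algebra_simps)
qed

lemma A_add: "A (x + y) = A x + A y" and A_scale: "A (c *s x) = c *s A x"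
  by (simp_all add: A_def R_def rf_add rf_scale vec_eq_iff algebra_simps)

lemma A_diff: "A (x - y) = A x - A y"
  using A_add[of x "- y"] A_scale[of "-1" y] by (simp add: vector_sneg_minus1[symmetric])

lemma R_A: "R x = u *s A x"
  using kap_u_nz by (simp add: A_def vector_smult_assoc)

lemma R_isometry: "h (R x) (R y) = h x y"
  using par nonzero by (simp add: R_def rf_isometry parameter_iff)

lemma A_isometry: "h (A x) (A y) = h x y"
proof -
  have "inverse u * cnj (inverse u) = 1"
    using cmod_u by (metis complex_norm_square norm_inverse inverse_1 of_real_1 power_one)
  moreover have "h (A x) (A y) = (inverse u * cnj (inverse u)) * h x y"
    by (simp add: A_def h_simps R_isometry mult_ac)
  ultimately show ?thesis by simp
qed

lemma A_eq:
  "A x = cis x2 *s (cis x1 *s x - ((2 * \<i> * sin x1) * (h x p1 / n1)) *s p1)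
     - ((2 * \<i> * sin x2) * ((cis x1 * h x p2 - (2 * \<i> * sin x1) * (h x p1 / n1) * g) / n2)) *s p2"
  (is "_ = ?G")
proof -
  have "R x = u *s ?G"
    unfolding R_def rf_p1 rf_scale rf_p2 u_mult
    by (simp only: vector_smult_assoc h_diff_left h_scale_left)
  moreover have "inverse u *s (u *s v) = v" for v using kap_u_nz by (simp add: vector_smult_assoc)
  ultimately show ?thesis unfolding A_def by (simp only:)
qed

lemma A_p1: "A p1 = cis (x2 - x1) *s p1 - (2 * \<i> * sin x2 * cis (- x1) * (g / n2)) *s p2"
proof -
  have c: "cis x1 - 2 * \<i> * sin x1 = cis (- x1)" by (simp add: complex_eq_iff)
  have n: "h p1 p1 / n1 = 1" using nonzero hpp by simp
  have "A p1 = cis x2 *s (cis x1 *s p1 - ((2 * \<i> * sin x1) * 1) *s p1)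
     - ((2 * \<i> * sin x2) * ((cis x1 * g - (2 * \<i> * sin x1) * 1 * g) / n2)) *s p2"
    by (subst A_eq) (simp only: n)
  also have "\<dots> = (cis x2 * (cis x1 - 2 * \<i> * sin x1)) *s p1
     - ((2 * \<i> * sin x2) * ((cis x1 - 2 * \<i> * sin x1) * (g / n2))) *s p2"
    by (simp add: vec_eq_iff algebra_simps diff_divide_distrib)
  finally have "A p1 = (cis x2 * (cis x1 - 2 * \<i> * sin x1)) *s p1
     - ((2 * \<i> * sin x2) * ((cis x1 - 2 * \<i> * sin x1) * (g / n2))) *s p2" .
  then show ?thesis unfolding c by (simp add: cis_mult mult_ac)
qed

text \<open>The coefficient of \<open>p2\<close> is brought into the form \<open>2 * m\<close> minus
  the coefficient of \<open>p1\<close> in \<open>A p1\<close>: here \<open>2 * m\<close> emerges as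
  the trace of \<open>A\<close> on \<open>W\<close>.\<close>

lemma A_p2:
  "A p2 = (of_real (2 * m) - cis (x2 - x1)) *s p2 - (2 * \<i> * sin x1 * cis x2 * (cnj g / n1)) *s p1"
proof -
  have c: "cis x1 * cis x2 - 2 * \<i> * sin x2 * cis x1 = cis (x1 - x2)" by (simp add: complex_eq_iff sin_diff cos_diff)
  have n: "h p2 p2 / n2 = 1" using nonzero hpp by simp
  have "A p2 = (cis x1 * cis x2 - 2 * \<i> * sin x2 * cis x1 - 4 * sin x1 * sin x2 * (cnj g * g / (of_real n1 * of_real n2))) *s p2
      - (2 * \<i> * sin x1 * cis x2 * (cnj g / n1)) *s p1"
    unfolding A_eq using n hpp nonzero
    by (simp add: vec_eq_iff algebra_simps diff_divide_distrib add_divide_distrib)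
  also have "4 * sin x1 * sin x2 * (cnj g * g / (of_real n1 * of_real n2)) = 4 * sin x1 * sin x2 * complex_of_real t"
    unfolding t_eq by (simp only: mult.commute[of "cnj g" g])
  also have "cis x1 * cis x2 - 2 * \<i> * sin x2 * cis x1 - 4 * sin x1 * sin x2 * complex_of_real t = of_real (2 * m) - cis (x2 - x1)"
    unfolding c using cis_diff_sum[of x1 x2] by (simp add: m_def algebra_simps)
  finally show ?thesis .
qed

lemma in_W: "x \<in> W \<longleftrightarrow> (\<exists>a b. x = a *s p1 + b *s p2)"
  by (rule in_span2)

lemma p_in_W: "p1 \<in> W" "p2 \<in> W"
  by (simp_all add: vec.span_base)

lemma A_W: "x \<in> W \<Longrightarrow> A x \<in> W"
proof -
  assume "x \<in> W"
  then obtain a b where "x = a *s p1 + b *s p2" by (auto simp: in_W)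
  then show ?thesis
    by (simp only: A_add A_scale A_p1 A_p2) (intro vec.span_add vec.span_scale vec.span_diff p_in_W)
qed

text \<open>Cayley-Hamilton for the matrix of \<open>A\<close> in \<open>p1\<close>,
  \<open>p2\<close>, which has trace \<open>2 * m\<close> and determinant 1.\<close>

lemma A_A: "x \<in> W \<Longrightarrow> A (A x) = of_real (2 * m) *s A x - x"
proof -
  define a b c where "a = cis (x2 - x1)" and "b = 2 * \<i> * sin x2 * cis (- x1) * (g / n2)"
    and "c = 2 * \<i> * sin x1 * cis x2 * (cnj g / n1)"
  have p1: "A p1 = a *s p1 - b *s p2" using A_p1 by (simp add: a_def b_def)
  have p2: "A p2 = (of_real (2 * m) - a) *s p2 - c *s p1" using A_p2 by (simp add: a_def c_def)
  have "c * b = - (4 * sin x1 * sin x2) * (cis x2 * cis (- x1)) * (g * cnj g / (of_real n1 * of_real n2))"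
    by (simp add: b_def c_def algebra_simps)
  then have cb: "c * b = - (4 * sin x1 * sin x2 * of_real t) * a"
    unfolding t_eq[symmetric] by (simp add: a_def cis_mult)
  have "a * (of_real (2 * m) - a) - c * b = a * cis (x1 - x2)"
  proof -
    have "of_real (2 * m) = cis (x1 - x2) + a - 4 * sin x1 * sin x2 * complex_of_real t"
      using cis_diff_sum[of x1 x2] by (simp add: a_def m_def)
    then show ?thesis by (simp only: cb) (simp add: algebra_simps)
  qed
  then have det: "a * (of_real (2 * m) - a) - c * b = 1" by (simp add: a_def cis_mult)
  have "A (A p1) = (a * a + b * c) *s p1 - (b * of_real (2 * m)) *s p2"
    unfolding p1 A_diff A_scale p2 by (simp add: vec_eq_iff algebra_simps)
  also have "a * a + b * c = of_real (2 * m) * a - 1" using det by (simp add: algebra_simps)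
  finally have 1: "A (A p1) = of_real (2 * m) *s A p1 - p1"
    unfolding p1 by (simp add: vec_eq_iff algebra_simps)
  have "A (A p2) = ((of_real (2 * m) - a) * (of_real (2 * m) - a) + b * c) *s p2 - (c * of_real (2 * m)) *s p1"
    unfolding p2 A_diff A_scale p1 by (simp add: vec_eq_iff algebra_simps)
  also have "(of_real (2 * m) - a) * (of_real (2 * m) - a) + b * c = of_real (2 * m) * (of_real (2 * m) - a) - 1"
    using det by (simp add: algebra_simps)
  finally have 2: "A (A p2) = of_real (2 * m) *s A p2 - p2"
    unfolding p2 by (simp add: vec_eq_iff algebra_simps)
  assume "x \<in> W"
  then obtain r s where x: "x = r *s p1 + s *s p2" by (auto simp: in_W)
  show ?thesis unfolding x A_add A_scale 1 2 by (simp add: vec_eq_iff algebra_simps)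
qed

lemma T_add: "T (x + y) = T x + T y" and T_scale: "T (c *s x) = c *s T x"
  and A_T: "A x = of_real m *s x - \<i> *s T x"
  by (simp_all add: T_def A_add A_scale vec_eq_iff algebra_simps)

lemma T_W: "x \<in> W \<Longrightarrow> T x \<in> W"
  unfolding T_def by (intro vec.span_scale vec.span_diff A_W)

lemma T_T: "x \<in> W \<Longrightarrow> T (T x) = of_real (1 - m\<^sup>2) *s x"
  by (simp add: T_def A_diff A_scale A_A vec_eq_iff algebra_simps power2_eq_square)

text \<open>The adjoint of the isometry \<open>A\<close> is its inverse, which on \<open>W\<close>
  is \<open>2 * m - A\<close>. So \<open>A - m\<close> is skew, and the factor \<open>\<i>\<close>
  makes it selfadjoint.\<close>

lemma T_selfadjoint: "x \<in> W \<Longrightarrow> y \<in> W \<Longrightarrow> h (T x) y = h x (T y)"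
proof -
  assume "x \<in> W" "y \<in> W"
  have "h x (A y) = h (A x) (A (A y))" by (simp only: A_isometry)
  also have "\<dots> = of_real (2 * m) * h x y - h (A x) y"
    using \<open>y \<in> W\<close> by (simp add: A_A h_simps A_isometry)
  finally have "h (A x) y + h x (A y) - of_real (2 * m) * h x y = 0" by simp
  moreover have "h (T x) y - h x (T y) = \<i> * (h (A x) y + h x (A y) - of_real (2 * m) * h x y)"
    by (simp add: T_def h_simps algebra_simps)
  ultimately show ?thesis by simp
qed

lemma T_p1: "T p1 = (\<i> * (cis (x2 - x1) - of_real m)) *s p1 + (2 * sin x2 * cis (- x1) * (g / n2)) *s p2"
  by (simp add: T_def A_p1 vec_eq_iff algebra_simps)

lemma T_p2: "T p2 = (\<i> * (of_real m - cis (x2 - x1))) *s p2 + (2 * sin x1 * cis x2 * (cnj g / n1)) *s p1"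
  by (simp add: T_def A_p2 vec_eq_iff algebra_simps)

text \<open>The factor \<open>sin x1\<close> allows the tance to be eliminated through the
  definition of \<open>m\<close>. What remains involves only \<open>n1\<close>, the angles and
  \<open>m\<close>; at \<open>m = -1\<close> it compares the sign of \<open>p1\<close> with that of
  \<open>h (T p1) p1\<close>.\<close>

lemma h_T_p1: "sin x1 * Re (h (T p1) p1) = n1 * (cos x2 - m * cos x1)"
proof -
  have "h (T p1) p1 = \<i> * (cis (x2 - x1) - of_real m) * n1 + 2 * sin x2 * cis (- x1) * (g * cnj g / (of_real n1 * of_real n2)) * n1"
    unfolding T_p1 h_simps hpp using nonzero by (simp add: field_simps)
  also have "\<dots> = of_real n1 * (\<i> * (cis (x2 - x1) - of_real m) + 2 * sin x2 * cis (- x1) * of_real t)"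
    unfolding t_eq[symmetric] by (simp add: algebra_simps)
  finally have "Re (h (T p1) p1) = n1 * (- sin (x2 - x1) + 2 * sin x2 * cos x1 * t)" by simp
  then have "sin x1 * Re (h (T p1) p1) = sin x1 * (n1 * (- sin (x2 - x1) + 2 * sin x2 * cos x1 * t))" by simp
  also have "\<dots> = n1 * (- sin x1 * sin (x2 - x1) + cos x1 * (2 * sin x1 * sin x2 * t))"
    by (simp add: algebra_simps)
  also have "2 * sin x1 * sin x2 * t = cos (x1 - x2) - m" by (simp add: m_def)
  also have "- sin x1 * sin (x2 - x1) + cos x1 * (cos (x1 - x2) - m)
      = (sin x1 ^ 2 + cos x1 ^ 2) * cos x2 - m * cos x1"
    unfolding sin_diff cos_diff by algebra
  finally show ?thesis by simp
qed

text \<open>The difference is a nonzero multiple of \<open>t - 1\<close>. It follows that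
  \<open>kap / u = cis (x1 + x2)\<close> is not a root of the characteristic polynomial of
  \<open>A\<close> on \<open>W\<close>.\<close>

lemma cos_sum_ne: "cos (x1 + x2) \<noteq> m"
proof -
  have "cos (x1 + x2) - m = 2 * sin x1 * sin x2 * (t - 1)"
    by (simp add: m_def cos_add cos_diff algebra_simps)
  then show ?thesis using t_ne sin_pos by auto
qed

lemma R_minus_kap_in_W: "R y - kap *s y \<in> W"
proof -
  have "A y - cis (x1 + x2) *s y \<in> W"
  proof -
    have "A y - cis (x1 + x2) *s y = - ((cis x2 * (2 * \<i> * sin x1) * (h y p1 / n1)) *s p1)
       - ((2 * \<i> * sin x2) * ((cis x1 * h y p2 - (2 * \<i> * sin x1) * (h y p1 / n1) * g) / n2)) *s p2"
      unfolding A_eq by (simp add: vec_eq_iff algebra_simps cis_mult[symmetric])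
    also have "\<dots> \<in> W" by (intro vec.span_diff vec.span_neg vec.span_scale p_in_W)
    finally show ?thesis .
  qed
  moreover have "R y - kap *s y = u *s (A y - cis (x1 + x2) *s y)"
    unfolding R_A kap_u by (simp add: vec_eq_iff algebra_simps)
  ultimately show ?thesis by (metis vec.span_scale)
qed

text \<open>Modulo \<open>W\<close> the product acts as \<open>kap\<close>, and on \<open>W\<close>
  the operator \<open>R - kap\<close> is invertible. The line is thus recovered from
  \<open>R\<close> and \<open>kap\<close>, without reference to the centres.\<close>

lemma W_eq_range: "W = range (\<lambda>y. R y - kap *s y)"
proof
  show "range (\<lambda>y. R y - kap *s y) \<subseteq> W" using R_minus_kap_in_W by blast
next
  show "W \<subseteq> range (\<lambda>y. R y - kap *s y)"
  proof
    fix x assume x: "x \<in> W"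
    define c where "c = cis (x1 + x2)"
    define k where "k = 2 * c * of_real (cos (x1 + x2) - m)"
    have k0: "k \<noteq> 0" using cos_sum_ne by (simp add: k_def c_def)
    \<comment> \<open>By Cayley-Hamilton \<open>(A - c) (2 * m - c - A)\<close> is the scalar
      \<open>1 - 2 * m * c + c\<^sup>2\<close>, so \<open>y\<close> is a preimage of
      \<open>x\<close> up to a nonzero factor.\<close>
    define y where "y = (of_real (2 * m) - c) *s x - A x"
    have "A y = (of_real (2 * m) - c) *s A x - (of_real (2 * m) *s A x - x)"
      by (simp only: y_def A_diff A_scale A_A[OF x])
    then have "A y - c *s y = (1 - of_real (2 * m) * c + c\<^sup>2) *s x"
      by (simp add: y_def vec_eq_iff algebra_simps power2_eq_square)
    also have "1 - of_real (2 * m) * c + c\<^sup>2 = k"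
    proof -
      have "c * of_real (2 * cos (x1 + x2)) = c * (c + cnj c)" by (simp add: c_def complex_eq_iff)
      also have "\<dots> = c\<^sup>2 + 1" by (simp add: c_def distrib_left cis_cnj cis_mult power2_eq_square)
      finally show ?thesis by (simp add: k_def algebra_simps)
    qed
    finally have "u *s (A y - c *s y) = (u * k) *s x" by (simp add: vector_smult_assoc)
    moreover have "R y - kap *s y = u *s (A y - c *s y)"
      unfolding R_A kap_u c_def by (simp add: vec_eq_iff algebra_simps)
    ultimately have 1: "R y - kap *s y = (u * k) *s x" by simp
    have "R (inverse (u * k) *s y) - kap *s (inverse (u * k) *s y) = inverse (u * k) *s (R y - kap *s y)"
      unfolding R_A by (simp add: A_scale vec_eq_iff algebra_simps)
    also have "\<dots> = (inverse (u * k) * (u * k)) *s x" unfolding 1 by (simp only: vector_smult_assoc)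
    also have "inverse (u * k) * (u * k) = 1" by (rule left_inverse) (use kap_u_nz k0 in simp)
    also have "1 *s x = x" by simp
    finally show "x \<in> range (\<lambda>y. R y - kap *s y)" by (intro range_eqI) (rule sym)
  qed
qed

end

section \<open>Products with a nonisotropic eigenvector on the line\<close>

lemma unit_inverse: "cmod z = 1 \<Longrightarrow> cnj z = inverse z"
  by (metis complex_norm_square divide_conv_cnj inverse_eq_divide mult_1 norm_eq_zero zero_neq_one)

text \<open>A real line meets the unit circle in at most two points; expanding
  \<open>c * cnj c = 1\<close> along the line leaves \<open>w * (w - 1) = 0\<close>.\<close>

lemma unit_circle_chord:
  assumes "cmod a = 1" "cmod b = 1" "cmod c = 1" "a \<noteq> b"
    and c: "c = of_real (1 - w) * a + of_real w * b"
  shows "w = 0 \<or> w = 1"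
proof -
  define d where "d = b - a"
  have ca: "c = a + of_real w * d" unfolding c d_def by (simp add: algebra_simps)
  have ab: "a * cnj a = 1" "b * cnj b = 1" "c * cnj c = 1"
    using assms by (metis complex_norm_square of_real_1 power_one)+
  have "(a + d) * cnj (a + d) = 1" using ab by (simp add: d_def)
  moreover have "(a + d) * cnj (a + d) = a * cnj a + ((a * cnj d + d * cnj a) + d * cnj d)"
    by (simp add: algebra_simps)
  ultimately have 1: "a * cnj d + d * cnj a = - (d * cnj d)"
    unfolding ab(1) eq_neg_iff_add_eq_0 by simp
  have "1 = a * cnj a + of_real w * (a * cnj d + d * cnj a) + of_real w * of_real w * (d * cnj d)"
    using ab(3) unfolding ca by (simp add: algebra_simps)
  then have "of_real (w * (w - 1)) * (d * cnj d) = 0"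
    unfolding 1 ab by (simp add: algebra_simps)
  moreover have "d * cnj d \<noteq> 0" using assms(4) by (simp add: d_def)
  ultimately have "w * (w - 1) = 0" by (metis mult_eq_0_iff of_real_eq_0_iff)
  then show ?thesis by auto
qed

lemma unit_cube_root:
  assumes "cmod z = 1"
  obtains a where "cmod a = 1" "a ^ 3 = z"
proof -
  have "cis (Arg2pi z) = z" using Arg2pi_eq[of z] assms by (simp add: cis_conv_exp mult.commute)
  then have "cis (Arg2pi z / 3) ^ 3 = z" by (simp add: cis_third_cube)
  then show ?thesis using that[of "cis (Arg2pi z / 3)"] by simp
qed

context hform
begin

text \<open>
  The weights \<open>w\<close> and \<open>1 - w\<close> prescribe \<open>\<langle>z\<^sub>ie\<^sub>i, z\<^sub>ie\<^sub>i\<rangle> / \<langle>p,p\<rangle>\<close> for \<open>p = z\<^sub>1e\<^sub>1 + z\<^sub>2e\<^sub>2\<close>; the number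
  \<open>\<mu> = \<alpha>\<^sub>2\<alpha>\<^sub>1\<^sup>-\<^sup>2\<close> is then the one for which \<open>w\<close> is the cross ratio
  \<open>(l\<^sub>1 - k)(l\<^sub>2 - \<mu>) / ((\<mu> - k)(l\<^sub>2 - l\<^sub>1))\<close>.
\<close>

lemma diagonal_product_aux:
  fixes w :: real
  assumes n: "h e1 e1 \<noteq> 0" "h e2 e2 \<noteq> 0" "h e3 e3 \<noteq> 0"
    and o: "h e1 e2 = 0" "h e1 e3 = 0" "h e2 e3 = 0"
    and l: "cmod l1 = 1" "cmod l2 = 1" "cmod k = 1" "l1 \<noteq> l2" "l1 \<noteq> k" "l2 \<noteq> k" "l1 * l2 * k = 1"
    and w: "w \<noteq> 0" "w \<noteq> 1" "w * (1 - w) * (Re (h e1 e1) * Re (h e2 e2)) > 0"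
    and \<mu>: "of_real w * ((\<mu> - k) * (l2 - l1)) = (l1 - k) * (l2 - \<mu>)" "cmod \<mu> = 1" "\<mu> * k ^ 2 \<noteq> 1"
  shows "\<exists>p1 p2 \<alpha>1 \<alpha>2. quad p1 p2 \<alpha>1 \<alpha>2 \<and> \<alpha>1 * \<alpha>2 = k \<and>
    rf \<alpha>2 p2 (rf \<alpha>1 p1 e1) = l1 *s e1 \<and> rf \<alpha>2 p2 (rf \<alpha>1 p1 e2) = l2 *s e2 \<and>
    rf \<alpha>2 p2 (rf \<alpha>1 p1 e3) = k *s e3"
proof -
  have o': "h e2 e1 = 0" "h e3 e1 = 0" "h e3 e2 = 0" using o h_eq_0_commute by blast+
  define r1 r2 where "r1 = Re (h e1 e1)" and "r2 = Re (h e2 e2)"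
  have hr: "h e1 e1 = of_real r1" "h e2 e2 = of_real r2" "r1 \<noteq> 0" "r2 \<noteq> 0"
    using n h_self_real Re_h_self_eq_0 by (auto simp: r1_def r2_def)
  \<comment> \<open>The sign to be given to \<open>h p1 p1\<close>. It makes
    \<open>w * N / r1\<close> positive, and the third part of \<open>w\<close> then makes
    \<open>(1 - w) * N / r2\<close> positive too, so real square roots exist.\<close>
  define N where "N = sgn (w * r1)"
  have N0: "N \<noteq> 0" "N * N = 1" using w hr by (auto simp: N_def sgn_if)
  have pos1: "w * N / r1 > 0"
  proof -
    have "w * N / r1 = ((w * r1) * sgn (w * r1)) / (r1 * r1)" using hr by (simp add: N_def)
    also have "\<dots> = \<bar>w * r1\<bar> / r1\<^sup>2" by (simp only: abs_sgn power2_eq_square)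
    also have "\<dots> > 0" using w(1) hr by simp
    finally show ?thesis .
  qed
  have pos2: "(1 - w) * N / r2 > 0"
  proof -
    have "(w * N / r1) * ((1 - w) * N / r2) = w * (1 - w) * (r1 * r2) * (N * N) / (r1\<^sup>2 * r2\<^sup>2)"
      using hr by (simp add: field_simps power2_eq_square)
    also have "\<dots> = w * (1 - w) * (r1 * r2) / (r1\<^sup>2 * r2\<^sup>2)" by (simp only: N0 mult_1_right)
    also have "\<dots> > 0" using w(3) hr(3,4) by (intro divide_pos_pos) (simp_all flip: r1_def r2_def)
    finally show ?thesis using pos1 by (rule zero_less_mult_pos)
  qed
  define z1 z2 where "z1 = sqrt (w * N / r1)" and "z2 = sqrt ((1 - w) * N / r2)"
  have z: "z1 > 0" "z2 > 0" "z1 * z1 * r1 = w * N" "z2 * z2 * r2 = (1 - w) * N"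
  proof -
    have "z1 * z1 = w * N / r1" "z2 * z2 = (1 - w) * N / r2"
      using real_sqrt_pow2[OF less_imp_le[OF pos1]] real_sqrt_pow2[OF less_imp_le[OF pos2]]
      by (simp_all add: z1_def z2_def power2_eq_square)
    then show "z1 * z1 * r1 = w * N" "z2 * z2 * r2 = (1 - w) * N" using hr(3,4) by simp_all
  qed (use pos1 pos2 in \<open>simp_all add: z1_def z2_def\<close>)
  define p1 where "p1 = of_real z1 *s e1 + of_real z2 *s e2"
  \<comment> \<open>This is \<open>R p1 - \<mu> p1\<close> for the wanted \<open>R\<close>: the
    first reflection multiplies \<open>p1\<close> by \<open>inverse (\<alpha>1\<^sup>2)\<close>, the
    second sends \<open>p1\<close> to \<open>\<alpha>2 *s p1\<close> plus a multiple of its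
    centre.\<close>
  define p2 where "p2 = ((l1 - \<mu>) * of_real z1) *s e1 + ((l2 - \<mu>) * of_real z2) *s e2"
  have e1p1: "h e1 p1 = of_real (r1 * z1)" and e2p1: "h e2 p1 = of_real (r2 * z2)"
    by (simp_all add: p1_def h_simps o o' hr)
  have zc: "of_real z1 * of_real (r1 * z1) = complex_of_real (w * N)"
    "of_real z2 * of_real (r2 * z2) = complex_of_real ((1 - w) * N)"
    unfolding of_real_mult[symmetric] z(3,4)[symmetric] by (simp_all add: mult_ac)
  have p11: "h p1 p1 = of_real N"
  proof -
    have "h p1 p1 = of_real z1 * h e1 p1 + of_real z2 * h e2 p1"
      by (subst (1) p1_def) (simp add: h_simps)
    also have "\<dots> = of_real N" unfolding e1p1 e2p1 zc by (simp add: algebra_simps)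
    finally show ?thesis .
  qed
  have nz: "l1 \<noteq> 0" "l2 \<noteq> 0" "k \<noteq> 0" "\<mu> \<noteq> 0" using l \<mu> by auto
  have cn: "cnj l1 = inverse l1" "cnj l2 = inverse l2" "cnj k = inverse k" "cnj \<mu> = inverse \<mu>"
    using l \<mu> unit_inverse by blast+
  have \<mu>k: "\<mu> \<noteq> k"
  proof
    assume "\<mu> = k"
    then have "(l1 - k) * (l2 - k) = 0" using \<mu>(1) by simp
    then show False using l by simp
  qed
  \<comment> \<open>\<open>M\<close> is the quotient of \<open>h (R p1) p1\<close> by
    \<open>h p1 p1\<close> for the wanted \<open>R\<close>. It lies on the line through
    \<open>l1\<close> and \<open>l2\<close> but off the unit circle, hence differs from
    \<open>\<mu>\<close> (giving nonorthogonal centres) and from \<open>inverse (k\<^sup>2)\<close>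
    (giving a nonzero Gram determinant).\<close>
  define M where "M = of_real w * l1 + of_real (1 - w) * l2"
  have M\<mu>: "M \<noteq> \<mu>"
  proof
    assume "M = \<mu>"
    then have "\<mu> = of_real (1 - w) * l2 + of_real w * l1" by (simp add: M_def add.commute)
    then show False using unit_circle_chord[of l2 l1 \<mu> w] l \<mu> w by auto
  qed
  have \<mu>l: "\<mu> \<noteq> l1" "\<mu> \<noteq> l2"
  proof -
    show "\<mu> \<noteq> l2" using \<mu>(1) w(1) \<mu>k l by auto
    show "\<mu> \<noteq> l1"
    proof
      assume "\<mu> = l1"
      then have "of_real w * ((l1 - k) * (l2 - l1)) = 1 * ((l1 - k) * (l2 - l1))" using \<mu>(1) by simp
      then have "complex_of_real w = 1" using l by (metis mult_cancel_right mult_eq_0_iff right_minus_eq)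
      then show False using w by simp
    qed
  qed
  define c where "c = h p1 p2"
  have wv: "of_real w = (l1 - k) * (l2 - \<mu>) / ((\<mu> - k) * (l2 - l1))"
    using \<mu>(1) \<mu>k l(4) by (subst eq_divide_eq) simp
  have wv': "complex_of_real (1 - w) = (\<mu> - l1) * (l2 - k) / ((\<mu> - k) * (l2 - l1))"
    unfolding of_real_diff wv using \<mu>k l by (simp add: divide_simps) (simp add: algebra_simps)
  have e1p2: "h e1 p2 = of_real (r1 * z1) * (inverse l1 - inverse \<mu>)"
    and e2p2: "h e2 p2 = of_real (r2 * z2) * (inverse l2 - inverse \<mu>)"
    by (simp_all add: p2_def h_simps o o' hr cn)
  have c1: "c = of_real N * (of_real w * (inverse l1 - inverse \<mu>) + of_real (1 - w) * (inverse l2 - inverse \<mu>))"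
  proof -
    have "c = of_real z1 * h e1 p2 + of_real z2 * h e2 p2"
      by (simp add: c_def p1_def h_simps)
    also have "\<dots> = (of_real z1 * of_real (r1 * z1)) * (inverse l1 - inverse \<mu>)
        + (of_real z2 * of_real (r2 * z2)) * (inverse l2 - inverse \<mu>)"
      unfolding e1p2 e2p2 by (simp only: mult.assoc)
    also have "\<dots> = of_real N * (of_real w * (inverse l1 - inverse \<mu>) + of_real (1 - w) * (inverse l2 - inverse \<mu>))"
      unfolding zc by (simp add: algebra_simps)
    finally show ?thesis .
  qed
  have "cnj (M - \<mu>) = of_real w * (inverse l1 - inverse \<mu>) + of_real (1 - w) * (inverse l2 - inverse \<mu>)"
    by (simp add: M_def cn algebra_simps)
  then have c2: "c = of_real N * cnj (M - \<mu>)" using c1 by simp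
  then have c0: "c \<noteq> 0" using N0 M\<mu> by simp
  define b where "b = of_real w * (inverse l1 - inverse \<mu>) + of_real (1 - w) * (inverse l2 - inverse \<mu>)"
  have bv: "b = - k * (\<mu> - l1) * (l2 - \<mu>) / ((\<mu> - k) * \<mu> * l1 * l2)"
    unfolding b_def wv wv' using nz \<mu>k l by (simp add: divide_simps) (simp add: algebra_simps)
  have cb: "c = of_real N * b" using c1 b_def by simp
  have p22: "h p2 p2 = of_real N * ((inverse (k\<^sup>2) - \<mu>) * b)"
  proof -
    have "h p2 p2 = (l1 - \<mu>) * of_real z1 * h e1 p2 + (l2 - \<mu>) * of_real z2 * h e2 p2"
      by (subst (1) p2_def) (simp add: h_simps)
    also have "\<dots> = (of_real z1 * of_real (r1 * z1)) * ((l1 - \<mu>) * (inverse l1 - inverse \<mu>))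
        + (of_real z2 * of_real (r2 * z2)) * ((l2 - \<mu>) * (inverse l2 - inverse \<mu>))"
      unfolding e1p2 e2p2 by (simp only: mult_ac)
    also have "\<dots> = of_real N * (of_real w * ((l1 - \<mu>) * (inverse l1 - inverse \<mu>))
        + of_real (1 - w) * ((l2 - \<mu>) * (inverse l2 - inverse \<mu>)))"
      unfolding zc by (simp add: algebra_simps)
    also have "of_real w * ((l1 - \<mu>) * (inverse l1 - inverse \<mu>))
        + of_real (1 - w) * ((l2 - \<mu>) * (inverse l2 - inverse \<mu>)) = (inverse (k\<^sup>2) - \<mu>) * b"
    proof -
      have kk: "inverse (k\<^sup>2) = l1 * l2 / k" using l(7) nz by (simp add: field_simps power2_eq_square)
      show ?thesis unfolding kk bv wv wv' using nz \<mu>k l(4-6) by (simp add: divide_simps) (simp add: algebra_simps)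
    qed
    finally show ?thesis .
  qed
  have k2\<mu>: "inverse (k\<^sup>2) \<noteq> \<mu>" using \<mu>(3) nz by (auto simp: field_simps)
  have b0: "b \<noteq> 0" using c0 cb by auto
  have p22_0: "h p2 p2 \<noteq> 0" unfolding p22 using k2\<mu> b0 N0 by simp
  \<comment> \<open>Forced by \<open>\<alpha>1 * \<alpha>2 = k\<close> and
    \<open>\<alpha>2 = \<mu> * \<alpha>1\<^sup>2\<close>. The conditions that the cubes
    \<open>k / \<mu>\<close> and \<open>k\<^sup>2 * \<mu>\<close> differ from 1 are
    \<open>\<mu> \<noteq> k\<close> and the last hypothesis on \<open>\<mu>\<close>.\<close>
  obtain \<alpha>1 where a1: "cmod \<alpha>1 = 1" "\<alpha>1 ^ 3 = k / \<mu>"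
    using unit_cube_root[of "k / \<mu>"] l \<mu> by (auto simp: norm_divide)
  define \<alpha>2 where "\<alpha>2 = k / \<alpha>1"
  have a10: "\<alpha>1 \<noteq> 0" using a1 by auto
  have a12: "\<alpha>1 * \<alpha>2 = k" using a10 by (simp add: \<alpha>2_def)
  have a23: "\<alpha>2 ^ 3 = k\<^sup>2 * \<mu>"
  proof -
    have "\<alpha>2 ^ 3 = k ^ 3 / (k / \<mu>)" by (simp only: \<alpha>2_def power_divide a1(2))
    also have "k ^ 3 = k\<^sup>2 * k" by (simp add: power2_eq_square power3_eq_cube)
    finally show ?thesis using nz by simp
  qed
  have par: "parameter \<alpha>1" "parameter \<alpha>2"
    unfolding parameter_iff a23 a1(2) using a1 l \<mu>k nz \<mu>(3)
    by (auto simp: \<alpha>2_def norm_divide mult.commute)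
  have gr: "gram p1 p2 \<noteq> 0"
  proof -
    have "gram p1 p2 = of_real N * (of_real N * ((inverse (k\<^sup>2) - \<mu>) * b)) - c * cnj c"
      unfolding gram_def p11 p22 c_def using h_cnj by metis
    also have "\<dots> = of_real (N * N) * b * (inverse (k\<^sup>2) - \<mu> - cnj b)"
      unfolding cb by (simp add: algebra_simps)
    finally have e: "gram p1 p2 = b * (inverse (k\<^sup>2) - \<mu> - cnj b)" by (simp add: N0)
    have "cnj b = M - \<mu>" using c2 cb N0 by (metis complex_cnj_cnj mult_cancel_left of_real_eq_0_iff)
    then have "gram p1 p2 = b * (inverse (k\<^sup>2) - M)" using e by simp
    moreover have "inverse (k\<^sup>2) \<noteq> M"
    proof
      assume "inverse (k\<^sup>2) = M"
      moreover have "cmod (inverse (k\<^sup>2)) = 1" using l by (simp add: norm_inverse norm_power)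
      ultimately show False
        using unit_circle_chord[of l2 l1 M w] l w by (auto simp: M_def add.commute)
    qed
    ultimately show ?thesis using b0 by simp
  qed
  have q: "quad p1 p2 \<alpha>1 \<alpha>2"
    unfolding quad_def using par gr p22_0 c0 N0 p11 by (auto simp: c_def)
  have Rp: "rf \<alpha>2 p2 (rf \<alpha>1 p1 p1) = (l1 * of_real z1) *s e1 + (l2 * of_real z2) *s e2"
  proof -
    have "rf \<alpha>1 p1 p1 = inverse (\<alpha>1\<^sup>2) *s p1" using p11 N0 by (intro rf_self) simp
    moreover have "rf \<alpha>2 p2 p1 = ((inverse (\<alpha>2\<^sup>2) - \<alpha>2) * (c / h p2 p2)) *s p2 + \<alpha>2 *s p1"
      by (simp only: rf_def c_def)
    ultimately have "rf \<alpha>2 p2 (rf \<alpha>1 p1 p1) = (inverse (\<alpha>1\<^sup>2) * (inverse (\<alpha>2\<^sup>2) - \<alpha>2) * (c / h p2 p2)) *s p2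
        + (inverse (\<alpha>1\<^sup>2) * \<alpha>2) *s p1"
      by (simp only: rf_scale vector_add_ldistrib vector_smult_assoc mult.assoc)
    also have 1: "inverse (\<alpha>1\<^sup>2) * \<alpha>2 = \<mu>"
      using a1 a10 nz by (simp add: \<alpha>2_def field_simps power2_eq_square power3_eq_cube)
    also have "inverse (\<alpha>1\<^sup>2) * (inverse (\<alpha>2\<^sup>2) - \<alpha>2) = inverse (k\<^sup>2) - \<mu>"
      using 1 by (simp add: right_diff_distrib flip: a12) (simp add: power_mult_distrib)
    also have "(inverse (k\<^sup>2) - \<mu>) * (c / h p2 p2) = 1"
      unfolding p22 cb using N0 b0 k2\<mu> by simp
    finally show ?thesis by (simp add: p1_def p2_def vec_eq_iff algebra_simps)
  qed
  have Re1: "rf \<alpha>2 p2 (rf \<alpha>1 p1 e1) = l1 *s e1"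
  proof -
    have 1: "rf \<alpha>2 p2 p1 = \<alpha>1\<^sup>2 *s ((l1 * of_real z1) *s e1 + (l2 * of_real z2) *s e2)"
    proof -
      have "rf \<alpha>1 p1 p1 = inverse (\<alpha>1\<^sup>2) *s p1" using p11 N0 by (intro rf_self) simp
      then have "inverse (\<alpha>1\<^sup>2) *s rf \<alpha>2 p2 p1 = (l1 * of_real z1) *s e1 + (l2 * of_real z2) *s e2"
        using Rp by (simp only: rf_scale)
      then show ?thesis using a10 by (metis (no_types) right_inverse power_not_zero vector_smult_assoc vector_smult_lid)
    qed
    have 2: "rf \<alpha>1 p1 e1 = ((inverse (\<alpha>1\<^sup>2) - \<alpha>1) * (of_real (r1 * z1) / of_real N)) *s p1 + \<alpha>1 *s e1"
      by (simp add: rf_def e1p1 p11)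
    have 3: "rf \<alpha>2 p2 e1 = ((inverse (\<alpha>2\<^sup>2) - \<alpha>2) * (of_real (r1 * z1) * (inverse l1 - inverse \<mu>) / h p2 p2)) *s p2 + \<alpha>2 *s e1"
      by (simp add: rf_def e1p2)
    have s1: "(inverse (\<alpha>1\<^sup>2) - \<alpha>1) * \<alpha>1\<^sup>2 = 1 - k / \<mu>"
    proof -
      have "(inverse (\<alpha>1\<^sup>2) - \<alpha>1) * \<alpha>1\<^sup>2 = 1 - \<alpha>1 ^ 3"
      proof -
        have "inverse (\<alpha>1\<^sup>2) * \<alpha>1\<^sup>2 = 1" by (rule left_inverse) (use a10 in simp)
        moreover have "\<alpha>1 * \<alpha>1\<^sup>2 = \<alpha>1 ^ 3" by (simp add: power2_eq_square power3_eq_cube)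
        ultimately show ?thesis by (simp only: left_diff_distrib)
      qed
      then show ?thesis by (simp only: a1(2))
    qed
    have s2: "\<alpha>1 * (inverse (\<alpha>2\<^sup>2) - \<alpha>2) = k / \<mu> * (inverse (k\<^sup>2) - \<mu>)"
    proof -
      have "\<alpha>1 * inverse (\<alpha>2\<^sup>2) = \<alpha>1 ^ 3 * inverse (k\<^sup>2)"
        using a10 nz by (simp add: \<alpha>2_def field_simps power2_eq_square power3_eq_cube)
      then show ?thesis using nz by (simp add: right_diff_distrib a12 a1)
    qed
    define q where "q = complex_of_real (r1 / N)"
    have s3: "of_real (r1 * z1) / of_real N = q * of_real z1" using N0 by (simp add: q_def)
    have s4: "of_real z1 * (q * of_real z1) = complex_of_real w"
    proof -
      have "z1 * (r1 / N * z1) = w" using z(3) N0 by (simp add: field_simps)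
      then show ?thesis unfolding q_def of_real_mult[symmetric] by simp
    qed
    have id: "(G * r) *s ((l1 * of_real z1) *s e1 + (l2 * of_real z2) *s e2) + (F * r) *s p2 + k *s e1 =
        ((G * l1 + F * (l1 - \<mu>)) * (of_real z1 * r) + k) *s e1
        + ((G * l2 + F * (l2 - \<mu>)) * (r * of_real z2)) *s e2" for F G r
      by (simp add: p2_def vec_eq_iff algebra_simps)
    have "rf \<alpha>2 p2 (rf \<alpha>1 p1 e1) =
      ((inverse (\<alpha>1\<^sup>2) - \<alpha>1) * \<alpha>1\<^sup>2 * (q * of_real z1)) *s ((l1 * of_real z1) *s e1 + (l2 * of_real z2) *s e2)
      + (\<alpha>1 * (inverse (\<alpha>2\<^sup>2) - \<alpha>2) * (of_real (r1 * z1) * (inverse l1 - inverse \<mu>) / h p2 p2)) *s p2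
      + (\<alpha>1 * \<alpha>2) *s e1"
      unfolding 2 rf_add rf_scale 1 3 s3
      by (simp only: vector_add_ldistrib vector_smult_assoc mult_ac add.assoc times_divide_eq_right)
    also have "\<dots> =
      ((1 - k / \<mu>) * (q * of_real z1)) *s ((l1 * of_real z1) *s e1 + (l2 * of_real z2) *s e2)
      + (k / \<mu> * (inverse (k\<^sup>2) - \<mu>) * (of_real (r1 * z1) * (inverse l1 - inverse \<mu>) / h p2 p2)) *s p2
      + k *s e1"
      unfolding s1 s2 a12 ..
    also have "k / \<mu> * (inverse (k\<^sup>2) - \<mu>) * (of_real (r1 * z1) * (inverse l1 - inverse \<mu>) / h p2 p2)
        = k / \<mu> * (inverse l1 - inverse \<mu>) / b * (q * of_real z1)"
      unfolding p22 s3[symmetric] using k2\<mu> N0 b0 by (simp add: mult_ac)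
    also have "((1 - k / \<mu>) * (q * of_real z1)) *s ((l1 * of_real z1) *s e1 + (l2 * of_real z2) *s e2)
        + (k / \<mu> * (inverse l1 - inverse \<mu>) / b * (q * of_real z1)) *s p2 + k *s e1 =
        (((1 - k / \<mu>) * l1 + k / \<mu> * (inverse l1 - inverse \<mu>) / b * (l1 - \<mu>)) * (of_real z1 * (q * of_real z1)) + k) *s e1
        + (((1 - k / \<mu>) * l2 + k / \<mu> * (inverse l1 - inverse \<mu>) / b * (l2 - \<mu>)) * (q * of_real z1 * of_real z2)) *s e2"
      by (rule id)
    also have "(1 - k / \<mu>) * l2 + k / \<mu> * (inverse l1 - inverse \<mu>) / b * (l2 - \<mu>) = 0"
      unfolding bv using nz \<mu>k l \<mu>l by (simp add: divide_simps)
    also have "((1 - k / \<mu>) * l1 + k / \<mu> * (inverse l1 - inverse \<mu>) / b * (l1 - \<mu>)) * (of_real z1 * (q * of_real z1)) + k = l1"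
      unfolding s4 bv wv using nz \<mu>k l \<mu>l by (simp add: divide_simps) (simp add: algebra_simps)
    finally show ?thesis by simp
  qed
  have Re2: "rf \<alpha>2 p2 (rf \<alpha>1 p1 e2) = l2 *s e2"
  proof -
    have "of_real z2 *s e2 = p1 - of_real z1 *s e1" by (simp add: p1_def)
    then have "of_real z2 *s rf \<alpha>2 p2 (rf \<alpha>1 p1 e2) = rf \<alpha>2 p2 (rf \<alpha>1 p1 (p1 - of_real z1 *s e1))"
      by (simp flip: rf_scale)
    also have "\<dots> = rf \<alpha>2 p2 (rf \<alpha>1 p1 p1) - of_real z1 *s rf \<alpha>2 p2 (rf \<alpha>1 p1 e1)"
      by (simp only: rf_diff rf_scale)
    also have "\<dots> = of_real z2 *s (l2 *s e2)" unfolding Rp Re1 by (simp add: vec_eq_iff mult_ac)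
    finally show ?thesis using z(2) by (auto simp only: vector_mul_lcancel of_real_eq_0_iff)
  qed
  have Re3: "rf \<alpha>2 p2 (rf \<alpha>1 p1 e3) = k *s e3"
  proof -
    have "h e3 p1 = 0" "h e3 p2 = 0" by (simp_all add: p1_def p2_def h_simps o')
    then show ?thesis by (simp add: rf_orthogonal rf_scale vector_smult_assoc a12)
  qed
  show ?thesis using q a12 Re1 Re2 Re3 by blast
qed

text \<open>A weight can fail only if its \<open>\<mu>\<close> has \<open>\<mu> * k ^ 2 = 1\<close>,
  which would make the second reflection trivial. Distinct weights give distinct
  \<open>\<mu>\<close>, so one of any two admissible weights succeeds.\<close>

lemma diagonal_product:
  assumes n: "h e1 e1 \<noteq> 0" "h e2 e2 \<noteq> 0" "h e3 e3 \<noteq> 0"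
    and o: "h e1 e2 = 0" "h e1 e3 = 0" "h e2 e3 = 0"
    and l: "cmod l1 = 1" "cmod l2 = 1" "cmod k = 1" "l1 \<noteq> l2" "l1 \<noteq> k" "l2 \<noteq> k" "l1 * l2 * k = 1"
  shows "\<exists>p1 p2 \<alpha>1 \<alpha>2. quad p1 p2 \<alpha>1 \<alpha>2 \<and> \<alpha>1 * \<alpha>2 = k \<and>
    rf \<alpha>2 p2 (rf \<alpha>1 p1 e1) = l1 *s e1 \<and> rf \<alpha>2 p2 (rf \<alpha>1 p1 e2) = l2 *s e2 \<and>
    rf \<alpha>2 p2 (rf \<alpha>1 p1 e3) = k *s e3"
proof -
  have nz: "l1 \<noteq> 0" "l2 \<noteq> 0" "k \<noteq> 0" using l by auto
  have \<mu>: "\<exists>\<mu>. of_real w * ((\<mu> - k) * (l2 - l1)) = (l1 - k) * (l2 - \<mu>) \<and> cmod \<mu> = 1"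
    if w: "w \<noteq> 0" "w \<noteq> 1" for w :: real
  proof -
    define D where "D = (l1 - k) + of_real w * (l2 - l1)"
    have D0: "D \<noteq> 0"
    proof
      assume "D = 0"
      then have "k = of_real (1 - w) * l1 + of_real w * l2" by (simp add: D_def algebra_simps)
      then show False using unit_circle_chord[of l1 l2 k w] l w by auto
    qed
    \<comment> \<open>The cross ratio equation is linear in \<open>\<mu>\<close> with leading
      coefficient \<open>D\<close>. Because \<open>l1 * l2 * k = 1\<close>, its constant side is
      exactly \<open>- cnj D\<close>, so the solution has modulus 1.\<close>
    define \<mu> where "\<mu> = - cnj D / D"
    have "cnj D = (inverse l1 - inverse k) + of_real w * (inverse l2 - inverse l1)"
      using l by (simp add: D_def unit_inverse)
    then have "cnj D = (l1 * l2 * k) * ((inverse l1 - inverse k) + of_real w * (inverse l2 - inverse l1))"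
      using l(7) by simp
    also have "\<dots> = l2 * k - l1 * l2 + of_real w * (l1 * k - l2 * k)"
      using nz by (simp add: field_simps)
    finally have cD: "cnj D = l2 * k - l1 * l2 + of_real w * (l1 * k - l2 * k)" .
    have \<mu>D: "\<mu> * D = - cnj D" using D0 by (simp add: \<mu>_def)
    have "of_real w * ((\<mu> - k) * (l2 - l1)) - (l1 - k) * (l2 - \<mu>) = \<mu> * D - of_real w * k * (l2 - l1) - (l1 - k) * l2"
      by (simp add: D_def algebra_simps)
    also have "\<dots> = 0" unfolding \<mu>D cD by (simp add: algebra_simps)
    finally show ?thesis using D0 by (intro exI[of _ \<mu>]) (simp add: \<mu>_def norm_divide)
  qed
  have fin: ?thesis if ab: "a \<noteq> b" and a: "a \<noteq> 0" "a \<noteq> 1" "a * (1 - a) * (Re (h e1 e1) * Re (h e2 e2)) > 0"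
    and b: "b \<noteq> 0" "b \<noteq> 1" "b * (1 - b) * (Re (h e1 e1) * Re (h e2 e2)) > 0" for a b :: real
  proof -
    obtain m where m: "of_real a * ((m - k) * (l2 - l1)) = (l1 - k) * (l2 - m)" "cmod m = 1" using \<mu> a by blast
    obtain m' where m': "of_real b * ((m' - k) * (l2 - l1)) = (l1 - k) * (l2 - m')" "cmod m' = 1" using \<mu> b by blast
    have "m * k ^ 2 \<noteq> 1 \<or> m' * k ^ 2 \<noteq> 1"
    proof (rule ccontr)
      assume "\<not> ?thesis"
      then have "m * k ^ 2 = m' * k ^ 2" by simp
      then have e: "m' = m" using nz by simp
      have "(of_real a - of_real b) * ((m - k) * (l2 - l1)) = 0"
        using m(1) m'(1) unfolding e by (simp add: left_diff_distrib)
      then have "m = k" using ab l by simp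
      then show False using m(1) l by simp
    qed
    then show ?thesis
      using diagonal_product_aux[OF n o l a m] diagonal_product_aux[OF n o l b m'] by blast
  qed
  have r: "Re (h e1 e1) * Re (h e2 e2) \<noteq> 0" using n by (simp add: Re_h_self_eq_0)
  show ?thesis
  proof (cases "Re (h e1 e1) * Re (h e2 e2) > 0")
    case True
    \<comment> \<open>On a definite plane the weights must lie between 0 and 1; on an indefinite one
      they must lie outside that interval.\<close>
    then show ?thesis by (intro fin[of "1/3" "2/3"]) auto
  next
    case False
    then have "Re (h e1 e1) * Re (h e2 e2) < 0" using r by linarith
    then show ?thesis by (intro fin[of 2 3]) auto
  qed
qed

end

section \<open>Geodesics\<close>

lemma abs_pv_scale: "c \<noteq> 0 \<Longrightarrow> v \<noteq> 0 \<Longrightarrow> abs_pv (c *s v) = abs_pv v"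
  by (metis abs_pv_eq_iff vector_mul_eq_0)

lemma scaleR_scalar: "r *\<^sub>R (v :: complex ^ 3) = complex_of_real r *s v"
  by (simp add: vec_eq_iff) (simp add: scaleR_conv_of_real)

lemma PP_span_iff: "v \<noteq> 0 \<Longrightarrow> abs_pv v \<in> PP (vec.span S) \<longleftrightarrow> v \<in> vec.span S"
proof -
  assume v: "v \<noteq> 0"
  obtain c where c: "c \<noteq> 0" "rep_pv (abs_pv v) = c *s v" using rep_abs_pv[OF v] .
  have "v \<in> vec.span S" if "c *s v \<in> vec.span S"
  proof -
    have "inverse c *s (c *s v) \<in> vec.span S" by (rule vec.span_scale[OF that])
    then show ?thesis using c by (simp add: vector_smult_assoc)
  qed
  then show ?thesis by (auto simp: PP_def c intro: vec.span_scale)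
qed

definition geo :: "complex ^ 3 \<Rightarrow> complex ^ 3 \<Rightarrow> pv set" where
  "geo p w = abs_pv ` (span {p, w} - {0})"

lemma in_real_span2: "x \<in> span {p, w} \<longleftrightarrow> (\<exists>a b. x = of_real a *s p + of_real b *s (w :: complex ^ 3))"
  by (auto simp: span_insert span_singleton image_iff diff_eq_eq scaleR_scalar ac_simps)

lemma in_geo: "x \<in> geo p w \<longleftrightarrow> (\<exists>a b. of_real a *s p + of_real b *s w \<noteq> 0 \<and> x = abs_pv (of_real a *s p + of_real b *s w))"
  by (simp add: geo_def image_iff Bex_def in_real_span2) blast

definition indep :: "complex ^ 3 \<Rightarrow> complex ^ 3 \<Rightarrow> bool" where
  "indep p w \<longleftrightarrow> (\<forall>a b. a *s p + b *s w = 0 \<longrightarrow> a = 0 \<and> b = 0)"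

lemma indepD: "indep p w \<Longrightarrow> a *s p + b *s w = 0 \<Longrightarrow> a = 0 \<and> b = 0"
  by (simp add: indep_def)

lemma indep_cancel:
  assumes "indep p w" "a *s p + b *s w = a' *s p + b' *s w"
  shows "a = a' \<and> b = b'"
proof -
  have "(a - a') *s p + (b - b') *s w = 0" using assms(2) by (simp add: vec_eq_iff algebra_simps)
  then show ?thesis using indepD[OF assms(1)] by fastforce
qed

lemma indepI:
  assumes "p \<noteq> 0" "\<And>c. w \<noteq> c *s p"
  shows "indep p w"
  unfolding indep_def
proof (intro allI impI)
  fix a b assume ab: "a *s p + b *s w = 0"
  have "b = 0"
  proof (rule ccontr)
    assume b: "b \<noteq> 0"
    have "w = (- a / b) *s p"
    proof -
      have "b *s w = (- a) *s p" using ab by (simp add: eq_neg_iff_add_eq_0 add.commute)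
      then have "inverse b *s (b *s w) = inverse b *s ((- a) *s p)" by simp
      then show ?thesis using b by (simp add: vector_smult_assoc divide_inverse mult.commute)
    qed
    then show False using assms by blast
  qed
  then show "a = 0 \<and> b = 0" using ab assms by (simp add: vector_mul_eq_0)
qed

lemma geo_commute: "geo p w = geo w p"
  by (simp add: geo_def insert_commute)

lemma geo_scale:
  assumes "c \<noteq> 0"
  shows "geo (c *s p) (c *s w) = geo p w"
proof -
  have e: "of_real a *s (c *s p) + of_real b *s (c *s w) = c *s (of_real a *s p + of_real b *s w)" for a b
    by (simp add: vec_eq_iff algebra_simps)
  have "(c *s v \<noteq> 0 \<and> x = abs_pv (c *s v)) = (v \<noteq> 0 \<and> x = abs_pv v)" for v x
    using assms abs_pv_scale by (metis vector_mul_eq_0)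
  then show ?thesis by (intro set_eqI) (simp only: in_geo e)
qed

lemma geo_scale_right:
  assumes "r \<noteq> 0"
  shows "geo p (of_real r *s w) = geo p w"
proof (rule set_eqI)
  fix x
  have "of_real a *s p + of_real b *s w = of_real a *s p + of_real (b / r) *s (of_real r *s w)" for a b
    using assms by (simp add: vector_smult_assoc)
  moreover have "of_real a *s p + of_real b *s (of_real r *s w) = of_real a *s p + of_real (b * r) *s w" for a b
    by (simp add: vector_smult_assoc)
  ultimately show "x \<in> geo p (of_real r *s w) \<longleftrightarrow> x \<in> geo p w"
    unfolding in_geo by metis
qed

lemma (in hform) geodesic_geo:
  assumes i: "indep p w" and s: "p \<in> vec.span S" "w \<in> vec.span S"
    and r: "h p p \<in> \<real>" "h p w \<in> \<real>" "h w w \<in> \<real>" and n: "h p p \<noteq> 0"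
  shows "geodesic h (vec.span S) (geo p w)"
  unfolding geodesic_def
proof (intro exI[of _ "span {p, w}"] conjI ballI)
  have d: "p \<noteq> w"
  proof
    assume "p = w"
    then have "1 *s p + (- 1) *s w = 0" by (simp add: vec_eq_iff)
    then show False using indepD[OF i] by fastforce
  qed
  have w0: "w \<noteq> 0" using indepD[OF i, of 0 1] by auto
  have "p \<notin> span {w}"
  proof
    assume "p \<in> span {w}"
    then obtain k where "p = of_real k *s w" by (auto simp: span_singleton scaleR_scalar)
    then have "1 *s p + (- of_real k) *s w = 0" by (simp add: vec_eq_iff)
    then show False using indepD[OF i] by fastforce
  qed
  then have "independent {p, w}" using w0 by (simp add: independent_insert)
  then have "dim {p, w} = card {p, w}" by (rule dim_eq_card_independent)
  then show "dim (span {p, w}) = 2" using d by simp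
  have r': "h w p \<in> \<real>" using r(2) by (metis h_cnj Reals_cnj_iff)
  fix u v assume "u \<in> span {p, w}" "v \<in> span {p, w}"
  then show "h u v \<in> \<real>"
    by (auto simp: in_real_span2 h_simps r r' intro!: Reals_add Reals_mult)
next
  show "\<exists>u\<in>span {p, w}. \<exists>v\<in>span {p, w}. h u v \<noteq> 0"
    using n by (meson insertI1 span_base)
next
  show "geo p w = abs_pv ` (span {p, w} - {0})" by (rule geo_def)
  show "geo p w \<subseteq> PP (vec.span S)"
  proof
    fix x assume "x \<in> geo p w"
    then obtain a b where x: "of_real a *s p + of_real b *s w \<noteq> 0" "x = abs_pv (of_real a *s p + of_real b *s w)"
      by (auto simp: in_geo)
    have "of_real a *s p + of_real b *s w \<in> vec.span S"
      by (intro vec.span_add vec.span_scale s)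
    then show "x \<in> PP (vec.span S)" using x PP_span_iff by simp
  qed
qed simp

text \<open>Equal sets of points determine vectors only up to complex factors. Matching both
  \<open>w\<close> and \<open>p + w\<close> with vectors of the other plane forces these factors to
  be real.\<close>

lemma tangent_vectors_geo:
  assumes p: "rep_pv P = p" and i: "indep p w" and u: "u \<in> tangent_vectors P (geo p w)"
  obtains r a where "r \<noteq> 0" "u = of_real r *s w + of_real a *s p"
proof -
  have e: "geo p u = geo p w" using u by (simp add: tangent_vectors_def p geo_def)
  have i0: "a *s p + b *s w \<noteq> 0" if "b \<noteq> 0" for a b using indepD[OF i] that by blast
  have hit: "\<exists>c a' b'. of_real a *s p + of_real b *s w = c *s (of_real a' *s p + of_real b' *s u)" if "b \<noteq> 0" for a b
  proof -
    have nz: "of_real a *s p + of_real b *s w \<noteq> 0" using i0 that by simp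
    then have "abs_pv (of_real a *s p + of_real b *s w) \<in> geo p u" unfolding e in_geo by blast
    then obtain a' b' where ab: "of_real a' *s p + of_real b' *s u \<noteq> 0"
      "abs_pv (of_real a *s p + of_real b *s w) = abs_pv (of_real a' *s p + of_real b' *s u)"
      by (auto simp: in_geo)
    then show ?thesis using abs_pv_eq_iff[OF ab(1) nz] by metis
  qed
  obtain l a b where 1: "of_real 0 *s p + of_real 1 *s w = l *s (of_real a *s p + of_real b *s u)"
    using hit[of 1 0] by auto
  obtain l' a' b' where 2: "of_real 1 *s p + of_real 1 *s w = l' *s (of_real a' *s p + of_real b' *s u)"
    using hit[of 1 1] by auto
  have l0: "l \<noteq> 0" using 1 i0[of 1 0] by auto
  have b0: "b \<noteq> 0"
  proof
    assume "b = 0"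
    then have "(- l * of_real a) *s p + 1 *s w = 0" using 1 by (simp add: vec_eq_iff)
    then show False using indepD[OF i] by fastforce
  qed
  have ue: "u = of_real (1 / b) *s (inverse l *s w) - of_real (a / b) *s p"
  proof -
    have "inverse l *s w = inverse l *s (l *s (of_real a *s p + of_real b *s u))" using 1 by simp
    also have "\<dots> = (inverse l * l) *s (of_real a *s p + of_real b *s u)" by (simp only: vector_smult_assoc)
    also have "\<dots> = of_real a *s p + of_real b *s u" using l0 by simp
    finally show ?thesis using b0 by (simp add: vec_eq_iff field_simps)
  qed
  have "1 *s p + 1 *s w = (l' * (of_real a' - of_real (b' * a / b))) *s p + (l' * of_real (b' / b) * inverse l) *s w"
    using 2 unfolding ue by (simp add: vec_eq_iff algebra_simps)
  from indep_cancel[OF i this] have c: "1 = l' * of_real (a' - b' * a / b)" "1 = l' * of_real (b' / b) * inverse l"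
    by simp_all
  have l'r: "l' = of_real (1 / (a' - b' * a / b))" 
    by (metis c(1) mult_zero_right nonzero_eq_divide_eq of_real_1 of_real_divide zero_neq_one)
  have "l = l' * of_real (b' / b)" using c(2) l0 by (simp add: field_simps)
  then obtain k where k: "l = of_real k" unfolding l'r of_real_mult[symmetric] by blast
  have "u = of_real (1 / (b * k)) *s w + of_real (- a / b) *s p"
    unfolding ue k by (simp add: vec_eq_iff field_simps)
  moreover have "1 / (b * k) \<noteq> 0" using b0 l0 k by simp
  ultimately show ?thesis using that by blast
qed

text \<open>Tangent vectors are unique up to nonzero real multiples and real multiples of
  \<open>p\<close>, so a second candidate \<open>t\<close> makes \<open>cis (t - \<theta>)\<close>
  real. The factor \<open>r\<close> may be negative since geodesics are unoriented.\<close>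

lemma oriented_angle_geo:
  assumes p: "rep_pv P = p" and i1: "indep p w1" and i2: "indep p w2"
    and w: "w2 = (of_real r * cis \<theta>) *s w1 + c *s p" and r: "r \<noteq> 0" and \<theta>: "0 \<le> \<theta>" "\<theta> < pi"
  shows "oriented_angle P (geo p w1) (geo p w2) = \<theta>"
  unfolding oriented_angle_def
proof (rule the_equality, intro conjI \<theta>)
  have t1: "of_real r *s w1 \<in> tangent_vectors P (geo p w1)"
    using geo_scale_right[OF r, of p w1] by (simp add: tangent_vectors_def p geo_def)
  have t2: "w2 \<in> tangent_vectors P (geo p w2)" by (simp add: tangent_vectors_def p geo_def)
  have "w2 = cis \<theta> *s (of_real r *s w1) + c *s rep_pv P"
    unfolding w p by (simp add: vector_smult_assoc mult.commute)
  with t1 t2 show "\<exists>u1\<in>tangent_vectors P (geo p w1). \<exists>u2\<in>tangent_vectors P (geo p w2). \<exists>c.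
      u2 = cis \<theta> *s u1 + c *s rep_pv P" by blast
next
  fix t assume t: "0 \<le> t \<and> t < pi \<and> (\<exists>u1\<in>tangent_vectors P (geo p w1). \<exists>u2\<in>tangent_vectors P (geo p w2). \<exists>c.
      u2 = cis t *s u1 + c *s rep_pv P)"
  then obtain u1 u2 d where u: "u1 \<in> tangent_vectors P (geo p w1)" "u2 \<in> tangent_vectors P (geo p w2)"
    "u2 = cis t *s u1 + d *s p" unfolding p by blast
  obtain r1 a1 where u1: "r1 \<noteq> 0" "u1 = of_real r1 *s w1 + of_real a1 *s p"
    using tangent_vectors_geo[OF p i1 u(1)] .
  obtain r2 a2 where u2: "r2 \<noteq> 0" "u2 = of_real r2 *s w2 + of_real a2 *s p"
    using tangent_vectors_geo[OF p i2 u(2)] .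
  have "(of_real r2 * c + of_real a2) *s p + (of_real (r2 * r) * cis \<theta>) *s w1 =
      (cis t * of_real a1 + d) *s p + (cis t * of_real r1) *s w1"
    using u(3) unfolding u1 u2 w by (simp add: vec_eq_iff algebra_simps)
  from indep_cancel[OF i1 this] have e: "of_real (r2 * r) * cis \<theta> = cis t * of_real r1" by blast
  have "of_real (r2 * r / r1) = cis t * cis (- \<theta>)"
  proof -
    have "of_real (r2 * r) = of_real (r2 * r) * (cis \<theta> * cis (- \<theta>))" by (simp add: cis_mult)
    also have "\<dots> = cis t * of_real r1 * cis (- \<theta>)" by (simp only: mult.assoc[symmetric] e)
    finally show ?thesis using u1(1) by (simp add: field_simps)
  qed
  then have "of_real (r2 * r / r1) = cis (t - \<theta>)" by (simp add: cis_mult)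
  then have "sin (t - \<theta>) = 0" by (metis Im_complex_of_real cis.sel(2))
  then show "t = \<theta>" using t \<theta> sin_zero_pi_iff[of "t - \<theta>"] by auto
qed

context hform
begin

text \<open>On the side given by the sign \<open>e\<close> of \<open>h p p\<close>, every term of
  \<open>e * h v v\<close> is nonnegative and their sum is positive. The other side meets the point
  orthogonal to \<open>p\<close>, so this side is the arc.\<close>

lemma geodesic_arc_nonisotropic:
  assumes p: "rep_pv P = p" and q: "rep_pv Q = q" and ne: "P \<noteq> Q" and o: "h p q \<noteq> 0"
    and s: "Re (h p p) * Re (h q q) > 0" and x: "x \<in> geodesic_arc h P Q"
  shows "\<exists>v. x = abs_pv v \<and> v \<in> vec.span {p, q} \<and> h v v \<noteq> 0"
proof -
  define e where "e = sgn (Re (h p p))"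
  have np: "Re (h p p) \<noteq> 0" using s by auto
  have e: "e * Re (h p p) > 0" "e * e = 1" "e = 1 \<or> e = -1" "e * Re (h q q) > 0"
    using s by (auto simp: e_def sgn_if zero_less_mult_iff)
  define G where "G = (cmod (h p q))\<^sup>2"
  have G: "G > 0" "h p q * h q p = of_real G" "h p q * cnj (h p q) = of_real G"
    unfolding G_def complex_norm_square h_cnj[of q p] using o by simp_all
  have p0: "p \<noteq> 0" "q \<noteq> 0" using p q rep_pv_nonzero by blast+
  have P: "P = abs_pv p" "Q = abs_pv q" using p q abs_rep_pv[of P] abs_rep_pv[of Q] by simp_all
  define v where "v = (\<lambda>f s t. of_real s *s p + of_real (f * t) *s (h p q *s q))"
  have side: "x \<in> geodesic_side h P Q f \<longleftrightarrow> (\<exists>s t. 0 \<le> s \<and> 0 \<le> t \<and> v f s t \<noteq> 0 \<and> x = abs_pv (v f s t))" for x f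
    unfolding geodesic_side_def p q scaleR_scalar v_def by blast
  have hp: "h (v f s t) p = of_real (s * Re (h p p) + f * t * G)" for f s t
  proof -
    have "h (v f s t) p = of_real s * h p p + of_real (f * t) * (h p q * h q p)"
      by (simp add: v_def h_simps)
    then show ?thesis by (subst (asm) h_self_real) (simp add: G)
  qed
  have hv: "Re (h (v f s t) (v f s t)) = s\<^sup>2 * Re (h p p) + 2 * (f * (s * t)) * G + f\<^sup>2 * (t\<^sup>2 * (G * Re (h q q)))" for f s t
  proof -
    have "h (v f s t) (v f s t) = of_real (s\<^sup>2) * h p p + of_real (f * (s * t)) * (h p q * cnj (h p q))
        + of_real (f * (s * t)) * (h p q * h q p) + of_real (f\<^sup>2 * t\<^sup>2) * (h p q * cnj (h p q)) * h q q"
      by (simp add: v_def h_simps algebra_simps power2_eq_square)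
    then show ?thesis unfolding G by simp
  qed
  have pos: "s > 0 \<or> t > 0" if "0 \<le> s" "0 \<le> t" "v f s t \<noteq> 0" for f s t
    using that by (auto simp: v_def order_le_less)
  have pos1: "s * A + t * C > 0" if "0 \<le> s" "0 \<le> t" "s > 0 \<or> t > 0" "A > 0" "C > 0" for s t A C :: real
    using that by (auto intro: add_pos_nonneg add_nonneg_pos)
  have pos2: "s\<^sup>2 * A + 2 * (s * t) * C + t\<^sup>2 * (C * B) > 0"
    if "0 \<le> s" "0 \<le> t" "s > 0 \<or> t > 0" "A > 0" "C > 0" "B > 0" for s t A B C :: real
  proof -
    have "s\<^sup>2 > 0 \<or> t\<^sup>2 > 0" using that by auto
    then have "s\<^sup>2 * A + t\<^sup>2 * (C * B) > 0" using that by (intro pos1) auto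
    moreover have "2 * (s * t) * C \<ge> 0" using that by simp
    ultimately show ?thesis by linarith
  qed
  have no: "\<not> orthogonal_pts h y P" if y: "y \<in> geodesic_side h P Q e" for y
  proof -
    obtain s t where st: "0 \<le> s" "0 \<le> t" "v e s t \<noteq> 0" "y = abs_pv (v e s t)" using y side by blast
    have "e * (s * Re (h p p) + e * t * G) = s * (e * Re (h p p)) + (e * e) * (t * G)"
      by (simp add: algebra_simps)
    also have "\<dots> > 0" unfolding e(2) mult_1 by (rule pos1[OF st(1,2) pos[OF st(1-3)] e(1) G(1)])
    finally have "s * Re (h p p) + e * t * G \<noteq> 0" by auto
    then show ?thesis unfolding st(4) P orthogonal_abs_pv[OF herm st(3) p0(1)] hp by (simp only: of_real_eq_0_iff not_False_eq_True)
  qed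
  have yes: "\<exists>y\<in>geodesic_side h P Q (- e). orthogonal_pts h y P"
  proof -
    \<comment> \<open>These weights solve \<open>s * Re (h p p) - e * t * G = 0\<close> and so give
      the point orthogonal to \<open>p\<close>; the vector is nonzero because the two points are
      distinct.\<close>
    have g: "v (- e) G \<bar>Re (h p p)\<bar> \<noteq> 0"
    proof
      assume 0: "v (- e) G \<bar>Re (h p p)\<bar> = 0"
      have "of_real (- e * \<bar>Re (h p p)\<bar>) * h p q \<noteq> 0" using e np o by auto
      moreover have "q = (- of_real G / (of_real (- e * \<bar>Re (h p p)\<bar>) * h p q)) *s p"
        if "of_real (- e * \<bar>Re (h p p)\<bar>) * h p q \<noteq> 0"
        using 0 that unfolding v_def vector_smult_assoc
        by (simp add: vec_eq_iff field_simps add_eq_0_iff)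
      ultimately show False using ne P abs_pv_eq_iff[OF p0] by blast
    qed
    have "h (v (- e) G \<bar>Re (h p p)\<bar>) p = 0"
      unfolding hp using e(3) by (auto simp: e_def sgn_if split: if_splits)
    then have "orthogonal_pts h (abs_pv (v (- e) G \<bar>Re (h p p)\<bar>)) P"
      unfolding P orthogonal_abs_pv[OF herm g p0(1)] .
    moreover have "abs_pv (v (- e) G \<bar>Re (h p p)\<bar>) \<in> geodesic_side h P Q (- e)"
      unfolding side using g G by (intro exI[of _ G] exI[of _ "\<bar>Re (h p p)\<bar>"]) auto
    ultimately show ?thesis by blast
  qed
  have "geodesic_arc h P Q = geodesic_side h P Q e"
    unfolding geodesic_arc_def using ne
  proof (simp only: if_False, intro the_equality)
    show "geodesic_side h P Q e \<in> {geodesic_side h P Q 1, geodesic_side h P Q (- 1)} \<and>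
        (\<forall>x\<in>geodesic_side h P Q e. \<not> orthogonal_pts h x P)" using no e(3) by auto
  next
    fix B assume B: "B \<in> {geodesic_side h P Q 1, geodesic_side h P Q (- 1)} \<and> (\<forall>x\<in>B. \<not> orthogonal_pts h x P)"
    then have "B \<noteq> geodesic_side h P Q (- e)" using yes by blast
    then show "B = geodesic_side h P Q e" using B e(3) by auto
  qed
  then obtain s t where st: "0 \<le> s" "0 \<le> t" "v e s t \<noteq> 0" "x = abs_pv (v e s t)" using x side by blast
  have "e * Re (h (v e s t) (v e s t)) = s\<^sup>2 * (e * Re (h p p)) + 2 * (e * e * (s * t)) * G + (e * e) * (t\<^sup>2 * (G * (e * Re (h q q))))"
    unfolding hv by (simp add: algebra_simps power2_eq_square)
  also have "\<dots> = s\<^sup>2 * (e * Re (h p p)) + 2 * (s * t) * G + t\<^sup>2 * (G * (e * Re (h q q)))"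
    unfolding e(2) by simp
  also have "\<dots> > 0"
    by (rule pos2[OF st(1,2) pos[OF st(1-3)] e(1) G(1) e(4)])
  finally have "h (v e s t) (v e s t) \<noteq> 0" by auto
  moreover have "v e s t \<in> vec.span {p, q}"
    unfolding v_def by (intro vec.span_add vec.span_scale vec.span_base) auto
  ultimately show ?thesis using st(4) by blast
qed

end

section \<open>Changes of orientation and of components, bendings\<close>

context hform
begin

lemma rf_conj:
  assumes "\<And>x y. C (x + y) = C x + C y" "\<And>c x. C (c *s x) = c *s C x" "\<And>x y. h (C x) (C y) = h x y"
  shows "rf \<alpha> (C v) (C x) = C (rf \<alpha> v x)"
  by (simp add: rf_def assms)

lemma product_abs:
  assumes "p1 \<noteq> 0" "p2 \<noteq> 0"
  shows "product h (abs_pv p1, abs_pv p2, \<alpha>1, \<alpha>2) = (\<lambda>x. rf \<alpha>2 p2 (rf \<alpha>1 p1 x))"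
  using assms by (simp add: product_def refl_iso_rf fun_eq_iff)

lemma quadD:
  assumes "quad p1 p2 \<alpha>1 \<alpha>2"
  shows "p1 \<noteq> 0" "p2 \<noteq> 0" "h p1 p1 \<noteq> 0" "h p2 p2 \<noteq> 0" "h p1 p2 \<noteq> 0" "gram p1 p2 \<noteq> 0"
    "parameter \<alpha>1" "parameter \<alpha>2"
  using assms by (auto simp: quad_def)

lemma elementary_relationI:
  assumes "quad p1 p2 \<alpha>1 \<alpha>2" "quad q1 q2 \<beta>1 \<beta>2"
    and "\<And>x. rf \<alpha>2 p2 (rf \<alpha>1 p1 x) = rf \<beta>2 q2 (rf \<beta>1 q1 x)"
    and "bending h (abs_pv p1, abs_pv p2, \<alpha>1, \<alpha>2) (abs_pv q1, abs_pv q2, \<beta>1, \<beta>2) \<or>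
      f_bending h (abs_pv p1, abs_pv p2, \<alpha>1, \<alpha>2) (abs_pv q1, abs_pv q2, \<beta>1, \<beta>2) \<or>
      change_orientation h (abs_pv p1, abs_pv p2, \<alpha>1, \<alpha>2) (abs_pv q1, abs_pv q2, \<beta>1, \<beta>2) \<or>
      change_components (abs_pv p1, abs_pv p2, \<alpha>1, \<alpha>2) (abs_pv q1, abs_pv q2, \<beta>1, \<beta>2) \<or>
      simultaneous_sign_change h (abs_pv p1, abs_pv p2, \<alpha>1, \<alpha>2) (abs_pv q1, abs_pv q2, \<beta>1, \<beta>2) \<or>
      single_sign_change h (abs_pv p1, abs_pv p2, \<alpha>1, \<alpha>2) (abs_pv q1, abs_pv q2, \<beta>1, \<beta>2) \<or>
      orthogonal_relation (abs_pv p1, abs_pv p2, \<alpha>1, \<alpha>2) (abs_pv q1, abs_pv q2, \<beta>1, \<beta>2)"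
  shows "elementary_relation h (abs_pv p1, abs_pv p2, \<alpha>1, \<alpha>2) (abs_pv q1, abs_pv q2, \<beta>1, \<beta>2)"
  unfolding elementary_relation_def
  using assms quadD[OF assms(1)] quadD[OF assms(2)]
  by (simp add: is_quadruple_iff product_abs)

lemma act_abs:
  assumes "\<And>c x. f (c *s x) = c *s f x" "v \<noteq> 0" "f v \<noteq> 0"
  shows "act f (abs_pv v) = abs_pv (f v)"
proof -
  obtain c where "c \<noteq> 0" "rep_pv (abs_pv v) = c *s v" using rep_abs_pv[OF assms(2)] .
  then show ?thesis by (simp add: act_def assms abs_pv_scale)
qed

text \<open>Conjugating the first reflection by the second one moves its centre \<open>p1\<close> by
  the latter and keeps its parameter.\<close>

lemma elementary_change_orientation:
  assumes q: "quad p1 p2 \<alpha>1 \<alpha>2"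
  shows "quad p2 (rf \<alpha>2 p2 p1) \<alpha>2 \<alpha>1"
    "\<And>x. rf \<alpha>1 (rf \<alpha>2 p2 p1) (rf \<alpha>2 p2 x) = rf \<alpha>2 p2 (rf \<alpha>1 p1 x)"
    "elementary_relation h (abs_pv p1, abs_pv p2, \<alpha>1, \<alpha>2) (abs_pv p2, abs_pv (rf \<alpha>2 p2 p1), \<alpha>2, \<alpha>1)"
    "h (rf \<alpha>2 p2 p1) (rf \<alpha>2 p2 p1) = h p1 p1"
proof -
  note d = quadD[OF q]
  define C where "C = rf \<alpha>2 p2"
  have C: "C (x + y) = C x + C y" "C (c *s x) = c *s C x" "h (C x) (C y) = h x y" for x y c
    using d by (simp_all add: C_def rf_add rf_scale rf_isometry parameter_iff)
  have Cp: "C p2 = inverse (\<alpha>2\<^sup>2) *s p2" using d by (simp add: C_def rf_self)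
  have n: "h (C p1) (C p1) = h p1 p1" by (rule C)
  then show "h (rf \<alpha>2 p2 p1) (rf \<alpha>2 p2 p1) = h p1 p1" by (simp add: C_def)
  have "inverse (\<alpha>2\<^sup>2) * h p2 (C p1) = h p2 p1" using C(3)[of p2 p1] by (simp add: Cp h_simps)
  then have o: "h p2 (C p1) \<noteq> 0" using d h_eq_0_commute[of p1 p2] by auto
  have "gram (C p2) (C p1) = gram p1 p2" by (simp add: gram_def C mult.commute)
  moreover have "gram (k *s x) y = k * cnj k * gram x y" for k x y
    by (simp add: gram_def h_simps algebra_simps)
  ultimately have g: "gram p2 (C p1) \<noteq> 0" using d by (auto simp: Cp)
  show q2: "quad p2 (rf \<alpha>2 p2 p1) \<alpha>2 \<alpha>1"
    unfolding quad_def C_def[symmetric] n using d o g by auto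
  show e: "rf \<alpha>1 (rf \<alpha>2 p2 p1) (rf \<alpha>2 p2 x) = rf \<alpha>2 p2 (rf \<alpha>1 p1 x)" for x
    unfolding C_def[symmetric] by (rule rf_conj) (rule C)+
  have "act (refl_iso h \<alpha>2 (abs_pv p2)) (abs_pv p1) = abs_pv (rf \<alpha>2 p2 p1)"
    unfolding refl_iso_rf[OF d(2)] using n d C_def by (intro act_abs) (auto simp: rf_scale)
  then show "elementary_relation h (abs_pv p1, abs_pv p2, \<alpha>1, \<alpha>2) (abs_pv p2, abs_pv (rf \<alpha>2 p2 p1), \<alpha>2, \<alpha>1)"
    by (intro elementary_relationI q q2) (simp_all add: e change_orientation_def)
qed

lemma quad_Omega: "quad p1 p2 \<alpha>1 \<alpha>2 \<Longrightarrow> z \<in> Omega \<Longrightarrow> quad p1 p2 (z * \<alpha>1) (inverse z * \<alpha>2)"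
  by (auto simp: quad_def Omega_iff power_inverse intro!: parameter_Omega_mult)

lemma product_Omega:
  assumes "z \<in> Omega"
  shows "rf (inverse z * \<alpha>2) p2 (rf (z * \<alpha>1) p1 x) = rf \<alpha>2 p2 (rf \<alpha>1 p1 x)"
proof -
  have z: "z \<noteq> 0" "inverse z \<in> Omega" using assms by (auto simp: Omega_iff power_inverse)
  show ?thesis
    unfolding rf_Omega[OF assms] rf_Omega[OF z(2)] rf_scale using z by (simp add: vector_smult_assoc)
qed

lemma elementary_change_components:
  assumes q: "quad p1 p2 \<alpha>1 \<alpha>2" and z: "z \<in> Omega"
  shows "(elementary_relation h)\<^sup>*\<^sup>* (abs_pv p1, abs_pv p2, \<alpha>1, \<alpha>2) (abs_pv p1, abs_pv p2, z * \<alpha>1, inverse z * \<alpha>2)"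
proof -
  have w2: "omega\<^sup>2 = inverse omega"
    using omega_cube omega_ne_0 by (simp add: field_simps power2_eq_square power3_eq_cube)
  have step: "elementary_relation h (abs_pv p1, abs_pv p2, \<alpha>1, \<alpha>2) (abs_pv p1, abs_pv p2, z * \<alpha>1, inverse z * \<alpha>2)"
    if "z = omega \<or> z = inverse omega"
    using that by (intro elementary_relationI q quad_Omega z) (auto simp: product_Omega[OF z] change_components_def)
  show ?thesis
  proof (cases "z = 1")
    case False
    then have "z = omega \<or> z = inverse omega" using z w2 by (auto simp: Omega_def)
    then show ?thesis using step by blast
  qed simp
qed

section \<open>Determinants of isometries, and bendings by isometries of arbitrary
  determinant\<close>

lemma form_expand:
  "h x y = (\<Sum>k\<in>UNIV. \<Sum>l\<in>UNIV. x $ k * cnj (y $ l) * h (axis k 1) (axis l 1))"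
proof -
  have e: "x = x $ 1 *s axis 1 1 + x $ 2 *s axis 2 1 + x $ 3 *s axis 3 1" for x :: "complex ^ 3"
    by (simp add: vec_eq_iff forall_3 axis_def)
  show ?thesis
    by (subst e[of x], subst e[of y]) (simp add: h_simps sum_3 algebra_simps)
qed

text \<open>With \<open>G\<close> the Gram matrix of the standard basis, being an isometry reads
  \<open>transpose M ** G ** N = G\<close> for the conjugate \<open>N\<close> of \<open>M\<close>,
  and nondegeneracy gives \<open>det G \<noteq> 0\<close>.\<close>

lemma det_isometry:
  assumes iso: "\<And>x y. h (M *v x) (M *v y) = h x y"
  shows "cmod (det M) = 1"
proof -
  define G :: "complex ^ 3 ^ 3" where "G = (\<chi> i j. h (axis i 1) (axis j 1))"
  define N :: "complex ^ 3 ^ 3" where "N = (\<chi> i j. cnj (M $ i $ j))"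
  have col: "(M *v axis i 1) $ k = M $ k $ i" for i k
    by (simp add: matrix_vector_mult_def axis_def if_distrib[of "\<lambda>x. _ * x"] sum.delta' cong: if_cong)
  have "transpose M ** G ** N = G"
  proof -
    have "(transpose M ** G ** N) $ i $ j = h (M *v axis i 1) (M *v axis j 1)" for i j
      by (subst form_expand) (simp add: col matrix_matrix_mult_def transpose_def G_def N_def sum_3 algebra_simps)
    then show ?thesis by (simp add: vec_eq_iff iso G_def)
  qed
  then have "det M * det G * det N = det G" by (metis det_mul det_transpose)
  moreover have "det N = cnj (det M)" by (simp add: det_3 N_def)
  moreover have "det G \<noteq> 0"
  proof
    assume "det G = 0"
    then have "\<not> invertible G" by (simp add: invertible_det_nz)
    then have "\<not> (\<forall>x. G *v x = 0 \<longrightarrow> x = 0)"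
      by (simp add: invertible_left_inverse matrix_left_invertible_ker)
    then obtain x where x: "G *v x = 0" "x \<noteq> 0" by blast
    define y where "y = (\<chi> i. cnj (x $ i))"
    have "h z y = 0" for z
    proof -
      have "h z y = (\<Sum>k\<in>UNIV. z $ k * (G *v x) $ k)"
        by (subst form_expand) (simp add: y_def G_def matrix_vector_mult_def sum_3 algebra_simps)
      then show ?thesis using x by simp
    qed
    then have "y = 0" using nondegenerate h_eq_0_commute by blast
    then show False using x(2) by (simp add: y_def vec_eq_iff)
  qed
  ultimately have "det M * cnj (det M) = 1" by (simp add: mult.assoc mult.left_commute)
  then have "complex_of_real ((cmod (det M))\<^sup>2) = 1" by (simp only: complex_norm_square)
  then have "(cmod (det M))\<^sup>2 = 1" by (metis of_real_eq_1_iff)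
  then show ?thesis by (simp add: power2_eq_1_iff) (metis norm_ge_zero not_one_le_zero neg_0_le_iff_le)
qed

text \<open>Multiplying \<open>C\<close> by a cube root of the inverse of its determinant, a unit
  scalar, puts it into \<open>SU21 h\<close> without moving any point. This frees later
  constructions from controlling determinants.\<close>

lemma elementary_bending:
  assumes q: "quad p1 p2 \<alpha>1 \<alpha>2"
    and add: "\<And>x y. C (x + y) = C x + C y" and sc: "\<And>c x. C (c *s x) = c *s C x"
    and iso: "\<And>x y. h (C x) (C y) = h x y"
    and com: "\<And>x. C (rf \<alpha>2 p2 (rf \<alpha>1 p1 x)) = rf \<alpha>2 p2 (rf \<alpha>1 p1 (C x))"
  shows "elementary_relation h (abs_pv p1, abs_pv p2, \<alpha>1, \<alpha>2) (abs_pv (C p1), abs_pv (C p2), \<alpha>1, \<alpha>2)"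
    "quad (C p1) (C p2) \<alpha>1 \<alpha>2"
    "rf \<alpha>2 (C p2) (rf \<alpha>1 (C p1) x) = rf \<alpha>2 p2 (rf \<alpha>1 p1 x)"
proof -
  note d = quadD[OF q]
  have lin: "Vector_Spaces.linear (*s) (*s) C"
    unfolding Vector_Spaces.linear_iff using add sc vec.vector_space_axioms by blast
  define M where "M = matrix C"
  have M: "M *v x = C x" for x unfolding M_def by (rule matrix_works[OF lin])
  have dM: "cmod (det M) = 1" by (rule det_isometry) (simp add: M iso)
  obtain z where z: "cmod z = 1" "z ^ 3 = inverse (det M)"
    using unit_cube_root[of "inverse (det M)"] dM by (auto simp: norm_inverse)
  have z0: "z \<noteq> 0" "z * cnj z = 1" using z by (auto simp: complex_norm_square[symmetric])
  define E where "E x = z *s C x" for x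
  have E: "E (x + y) = E x + E y" "E (c *s x) = c *s E x" for x y c
    by (simp_all add: E_def add sc vec_eq_iff algebra_simps)
  have linE: "Vector_Spaces.linear (*s) (*s) E"
    unfolding Vector_Spaces.linear_iff using E vec.vector_space_axioms by blast
  have "matrix E = (\<chi> i j. z * M $ i $ j)" by (simp add: matrix_def M_def E_def vec_eq_iff)
  then have "det (matrix E) = z ^ 3 * det M" by (simp add: det_3 power3_eq_cube algebra_simps)
  also have "\<dots> = 1" unfolding z(2) by (rule left_inverse) (use dM in auto)
  finally have detE: "det (matrix E) = 1" .
  have isoE: "h (E x) (E y) = h x y" for x y
  proof -
    have "h (E x) (E y) = (z * cnj z) * h (C x) (C y)" by (simp add: E_def h_simps)
    then show ?thesis using z0 iso by simp
  qed
  have SU: "E \<in> SU21 h" unfolding SU21_def using linE detE isoE by blast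
  have "invertible M" using dM by (auto simp: invertible_det_nz)
  then obtain M' where M': "M ** M' = mat 1" unfolding invertible_def by blast
  have surj: "\<exists>y. x = C y" for x
  proof -
    have "C (M' *v x) = x" using M' by (simp flip: M add: matrix_vector_mul_assoc)
    then show ?thesis by metis
  qed
  show pe: "rf \<alpha>2 (C p2) (rf \<alpha>1 (C p1) x) = rf \<alpha>2 p2 (rf \<alpha>1 p1 x)" for x
  proof -
    obtain y where y: "x = C y" using surj by blast
    show ?thesis unfolding y rf_conj[of C, OF add sc iso] com ..
  qed
  show qC: "quad (C p1) (C p2) \<alpha>1 \<alpha>2" using q by (simp add: quad_def gram_def iso)
  have n0: "C p1 \<noteq> 0" "C p2 \<noteq> 0" using quadD[OF qC] by auto
  have "act E (abs_pv p1) = abs_pv (C p1)" "act E (abs_pv p2) = abs_pv (C p2)"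
    using act_abs[of E p1] act_abs[of E p2] E d n0 z0 by (simp_all add: E_def abs_pv_scale vector_mul_eq_0)
  moreover have "E \<circ> product h (abs_pv p1, abs_pv p2, \<alpha>1, \<alpha>2) = product h (abs_pv p1, abs_pv p2, \<alpha>1, \<alpha>2) \<circ> E"
    unfolding product_abs[OF d(1,2)] by (simp add: fun_eq_iff E_def com rf_scale)
  ultimately have "bending h (abs_pv p1, abs_pv p2, \<alpha>1, \<alpha>2) (abs_pv (C p1), abs_pv (C p2), \<alpha>1, \<alpha>2)"
    unfolding bending_def using SU by auto
  then show "elementary_relation h (abs_pv p1, abs_pv p2, \<alpha>1, \<alpha>2) (abs_pv (C p1), abs_pv (C p2), \<alpha>1, \<alpha>2)"
    by (intro elementary_relationI q qC) (simp_all add: pe)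
qed

end

section \<open>The trace and the tance\<close>

lemma real_phase:
  assumes "Im (x * cnj y) = 0"
  obtains l a b where "l \<noteq> 0" "x = l * of_real a" "y = l * of_real b"
proof (cases "x = 0")
  case True
  then show ?thesis using that[of 1 0 0] that[of y 0 1] by auto
next
  case False
  have "Im (y * cnj x) = 0" using assms by (simp add: algebra_simps)
  then have "y * cnj x = of_real (Re (y * cnj x))" by (simp add: complex_eq_iff)
  moreover have "y = x * ((y * cnj x) / (x * cnj x))" using False by simp
  ultimately have "y = x * of_real (Re (y * cnj x) / (cmod x)\<^sup>2)"
    by (metis complex_norm_square of_real_divide)
  moreover have "x = x * of_real 1" by simp
  ultimately show ?thesis using that[OF False] by blast
qed

text \<open>
  With \<open>r = d / c\<close> the second equation is quadratic, \<open>J + E r + D J r\<^sup>2 = 0\<close>, where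
  \<open>J = Im(a b\<^sup>-)\<close> and \<open>E = |a|\<^sup>2 + D |b|\<^sup>2\<close>; its discriminant is \<open>|a\<^sup>2 + D b\<^sup>2|\<^sup>2\<close>.
\<close>

lemma hyperbolic_rotation_solve:
  fixes a b :: complex and D :: real
  assumes D: "D \<ge> 0" and nz: "a\<^sup>2 + of_real D * b\<^sup>2 \<noteq> 0"
  obtains c d :: real where "c\<^sup>2 - D * d\<^sup>2 = 1"
    "Im ((of_real c * a + \<i> * of_real d * of_real D * b) * cnj (of_real c * b - \<i> * of_real d * a)) = 0"
proof -
  define J E where "J = Im (a * cnj b)" and "E = (cmod a)\<^sup>2 + D * (cmod b)\<^sup>2"
  have disc: "E\<^sup>2 - 4 * D * J\<^sup>2 = (cmod (a\<^sup>2 + of_real D * b\<^sup>2))\<^sup>2"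
    unfolding J_def E_def cmod_power2 by (simp add: power2_eq_square algebra_simps)
  have d0: "E\<^sup>2 - 4 * D * J\<^sup>2 > 0" unfolding disc using nz by simp
  define s where "s = sqrt (E\<^sup>2 - 4 * D * J\<^sup>2)"
  have s: "s > 0" "s\<^sup>2 = E\<^sup>2 - 4 * D * J\<^sup>2" using d0 by (simp_all add: s_def)
  have E0: "E \<ge> 0" using D by (simp add: E_def)
  \<comment> \<open>The root of smaller modulus, in the rationalised form that survives a vanishing
    leading coefficient, in particular \<open>D = 0\<close>. Being the smaller root it satisfies
    \<open>D * r\<^sup>2 < 1\<close>, which is needed to normalise \<open>c\<close>.\<close>
  define r where "r = - 2 * J / (E + s)"
  have r: "r * (E + s) = - 2 * J" using s E0 by (simp add: r_def)
  have quad: "J + E * r + D * J * r\<^sup>2 = 0"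
  proof -
    have "(J + E * r + D * J * r\<^sup>2) * (E + s)\<^sup>2 = J * (E + s)\<^sup>2 + E * (r * (E + s)) * (E + s) + D * J * (r * (E + s))\<^sup>2"
      by (simp add: power2_eq_square algebra_simps)
    also have "\<dots> = J * (s\<^sup>2 - E\<^sup>2 + 4 * D * J\<^sup>2)" unfolding r by (simp add: power2_eq_square algebra_simps)
    also have "\<dots> = 0" using s(2) by simp
    finally show ?thesis using s E0 by auto
  qed
  have lt: "D * r\<^sup>2 < 1"
  proof -
    have "D * r\<^sup>2 * (E + s)\<^sup>2 = D * (r * (E + s))\<^sup>2" by (simp add: power_mult_distrib)
    also have "\<dots> = 4 * D * J\<^sup>2" unfolding r by (simp add: power2_eq_square)
    also have "\<dots> < E\<^sup>2" using d0 by simp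
    also have "\<dots> \<le> 1 * (E + s)\<^sup>2" using s E0 by (simp add: power_mono)
    finally show ?thesis using s E0 by (simp add: mult_less_cancel_right)
  qed
  define c where "c = 1 / sqrt (1 - D * r\<^sup>2)"
  have c2: "c\<^sup>2 * (1 - D * r\<^sup>2) = 1" using lt by (simp add: c_def power_divide)
  define d where "d = r * c"
  have "c\<^sup>2 - D * d\<^sup>2 = 1" using c2 by (simp add: d_def power_mult_distrib algebra_simps)
  moreover have "Im ((of_real c * a + \<i> * of_real d * of_real D * b) * cnj (of_real c * b - \<i> * of_real d * a))
      = (c\<^sup>2 + D * d\<^sup>2) * J + c * d * E"
    unfolding J_def E_def cmod_power2 by (simp add: power2_eq_square algebra_simps)
  moreover have "(c\<^sup>2 + D * d\<^sup>2) * J + c * d * E = c\<^sup>2 * (J + E * r + D * J * r\<^sup>2)"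
    by (simp add: d_def power2_eq_square algebra_simps)
  ultimately show ?thesis using that quad by simp
qed

lemma cos_sum_half: "cos x + cos y = 2 * cos ((x + y) / 2) * cos ((x - y) / 2)" for x y :: real
  using cos_times_cos[of "(x + y) / 2" "(x - y) / 2"] by (simp add: field_simps)

context config
begin

text \<open>\<open>A\<close> is a scalar plus operators \<open>x\<close> to
  \<open>h x v *s w\<close>, each of trace \<open>h w v\<close>.\<close>

lemma trace_R: "trace (matrix R) = kap + of_real (2 * m) * u"
proof -
  have tr: "(\<Sum>i\<in>UNIV. h (axis i 1) v * w $ i) = h w v" for v w
  proof -
    have e: "w = w $ 1 *s axis 1 1 + w $ 2 *s axis 2 1 + w $ 3 *s axis 3 1"
      by (simp add: vec_eq_iff forall_3 axis_def)
    show ?thesis by (subst (2) e) (simp add: h_simps sum_3 algebra_simps)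
  qed
  define k1 k2 k3 where "k1 = cis x2 * (2 * \<i> * sin x1) / n1" and "k2 = 2 * \<i> * sin x2 * cis x1 / n2"
    and "k3 = (2 * \<i> * sin x2) * (2 * \<i> * sin x1) * g / (of_real n1 * of_real n2)"
  have Ae: "A x = (cis x2 * cis x1) *s x - (k1 * h x p1) *s p1 - (k2 * h x p2) *s p2 + (k3 * h x p1) *s p2" for x
    unfolding A_eq k1_def k2_def k3_def by (simp add: vec_eq_iff algebra_simps diff_divide_distrib)
  have "(\<Sum>i\<in>UNIV. A (axis i 1) $ i) = (\<Sum>i\<in>UNIV. cis x2 * cis x1 * (axis i 1 :: complex ^ 3) $ i)
      - k1 * (\<Sum>i\<in>UNIV. h (axis i 1) p1 * p1 $ i) - k2 * (\<Sum>i\<in>UNIV. h (axis i 1) p2 * p2 $ i)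
      + k3 * (\<Sum>i\<in>UNIV. h (axis i 1) p1 * p2 $ i)"
    unfolding Ae by (simp add: sum.distrib sum_subtractf sum_distrib_left mult.assoc)
  also have "\<dots> = 3 * cis x2 * cis x1 - k1 * of_real n1 - k2 * of_real n2 + k3 * cnj g"
    unfolding tr hpp by (simp add: axis_def)
  also have "k1 * of_real n1 = cis x2 * (2 * \<i> * sin x1)" using nonzero by (simp add: k1_def)
  also have "k2 * of_real n2 = 2 * \<i> * sin x2 * cis x1" using nonzero by (simp add: k2_def)
  also have "k3 * cnj g = (2 * \<i> * sin x2) * (2 * \<i> * sin x1) * (g * cnj g / (of_real n1 * of_real n2))"
    by (simp add: k3_def)
  also have "3 * cis x2 * cis x1 - cis x2 * (2 * \<i> * sin x1) - 2 * \<i> * sin x2 * cis x1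
      + (2 * \<i> * sin x2) * (2 * \<i> * sin x1) * (g * cnj g / (of_real n1 * of_real n2)) = cis (x1 + x2) + of_real (2 * m)"
    unfolding t_eq[symmetric] m_def by (simp add: complex_eq_iff cos_add sin_add cos_diff sin_diff algebra_simps)
  finally have 1: "(\<Sum>i\<in>UNIV. A (axis i 1) $ i) = cis (x1 + x2) + of_real (2 * m)" .
  have "trace (matrix R) = u * (\<Sum>i\<in>UNIV. A (axis i 1) $ i)"
    by (simp add: trace_def matrix_def R_A sum_distrib_left)
  then show ?thesis unfolding 1 by (simp add: kap_u algebra_simps)
qed

text \<open>\<open>goldman\<close> of the trace is the discriminant of the characteristic
  polynomial. The eigenvalues are \<open>kap\<close> and two with product \<open>u\<^sup>2\<close>
  and sum \<open>2 * m * u\<close>: the pair contributes \<open>m\<^sup>2 - 1\<close>, their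
  differences from \<open>kap\<close> the square.\<close>

lemma goldman_R: "goldman (trace (matrix R)) = 16 * (m\<^sup>2 - 1) * (cos (x1 + x2) - m)\<^sup>2"
proof -
  define S where "S = x1 + x2"
  have tr: "trace (matrix R) = u * (cis S + of_real (2 * m))"
    unfolding trace_R kap_u S_def by (simp add: algebra_simps)
  have sq: "sin S ^ 2 = 1 - cos S ^ 2" using sin_cos_squared_add[of S] by linarith
  have "(cmod (trace (matrix R)))\<^sup>2 = (cmod (cis S + of_real (2 * m)))\<^sup>2"
    unfolding tr norm_mult cmod_u by simp
  also have "\<dots> = (cos S + 2 * m)\<^sup>2 + (sin S)\<^sup>2" by (simp add: cmod_power2)
  also have "\<dots> = 1 + 4 * m\<^sup>2 + 4 * m * cos S" unfolding sq by (simp add: power2_eq_square algebra_simps)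
  finally have n2: "(cmod (trace (matrix R)))\<^sup>2 = 1 + 4 * m\<^sup>2 + 4 * m * cos S" .
  have u3: "u ^ 3 = cis (- S)"
  proof -
    have "u ^ 3 * cis S = 1" using u_square_kap unfolding kap_u S_def by (simp add: power2_eq_square power3_eq_cube mult_ac)
    then have "u ^ 3 * cis S * cis (- S) = cis (- S)" by simp
    then show ?thesis by (simp add: mult.assoc cis_mult)
  qed
  have "(trace (matrix R)) ^ 3 = cis (- S) * (cis S + of_real (2 * m)) ^ 3"
    unfolding tr power_mult_distrib u3 ..
  also have "\<dots> = (cis (- S) * cis S) * (cis S * cis S + 3 * (cis S * of_real (2 * m)) + 3 * (of_real (2 * m))\<^sup>2) + cis (- S) * (of_real (2 * m)) ^ 3"
    by (simp add: power2_eq_square power3_eq_cube algebra_simps)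
  also have "\<dots> = cis S * cis S + 3 * (cis S * of_real (2 * m)) + 3 * (of_real (2 * m))\<^sup>2 + cis (- S) * (of_real (2 * m)) ^ 3"
    by (simp add: cis_mult)
  finally have "Re ((trace (matrix R)) ^ 3) = (cos S)\<^sup>2 - (sin S)\<^sup>2 + 6 * m * cos S + 12 * m\<^sup>2 + 8 * m ^ 3 * cos S"
    by (simp add: power2_eq_square power3_eq_cube)
  then have r3: "Re ((trace (matrix R)) ^ 3) = 2 * (cos S)\<^sup>2 - 1 + 6 * m * cos S + 12 * m\<^sup>2 + 8 * m ^ 3 * cos S"
    unfolding sq by simp
  have n4: "cmod (trace (matrix R)) ^ 4 = (1 + 4 * m\<^sup>2 + 4 * m * cos S)\<^sup>2"
    unfolding n2[symmetric] by simp
  show ?thesis unfolding goldman_def n4 r3 n2 S_def[symmetric] by algebra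
qed

section \<open>The case without nonisotropic eigenvectors on the line\<close>

definition ne :: bool where
  "ne \<longleftrightarrow> (\<forall>x c. x \<in> W \<longrightarrow> R x = c *s x \<longrightarrow> h x x = 0)"

lemma T_eigenvector: "T x = c *s x \<Longrightarrow> R x = (u * (of_real m - \<i> * c)) *s x"
  unfolding R_A A_T by (simp add: vec_eq_iff algebra_simps)

lemma ne_T: "ne \<Longrightarrow> x \<in> W \<Longrightarrow> T x = c *s x \<Longrightarrow> h x x = 0"
  using T_eigenvector unfolding ne_def by blast

lemma h_T_T: "x \<in> W \<Longrightarrow> y \<in> W \<Longrightarrow> h (T x) (T y) = of_real (1 - m\<^sup>2) * h x y"
  by (simp only: T_selfadjoint T_W T_T h_scale_right complex_cnj_complex_of_real)

lemma h_T_real: "x \<in> W \<Longrightarrow> h (T x) x = of_real (Re (h (T x) x))"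
  using T_selfadjoint[of x x] h_cnj[of x "T x"] by (simp add: complex_eq_iff)

lemma indep_T: "ne \<Longrightarrow> x \<in> W \<Longrightarrow> h x x \<noteq> 0 \<Longrightarrow> indep x (T x)"
  using ne_T by (intro indepI) auto

text \<open>For \<open>m\<^sup>2 < 1\<close> the operator \<open>T\<close> has real eigenvalues
  \<open>e\<close> and \<open>- e\<close>, with eigenvectors \<open>T p1 + e p1\<close> and
  \<open>T p1 - e p1\<close>. The form values of these two add up to a nonzero multiple of
  \<open>n1\<close>, so they cannot both vanish.\<close>

lemma m_ge_1:
  assumes "ne"
  shows "m\<^sup>2 \<ge> 1"
proof (rule ccontr)
  assume "\<not> m\<^sup>2 \<ge> 1"
  then have lt: "1 - m\<^sup>2 > 0" by simp
  define e where "e = sqrt (1 - m\<^sup>2)"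
  have e: "e > 0" "e * e = 1 - m\<^sup>2" using lt by (simp_all add: e_def)
  define a where "a = Re (h (T p1) p1)"
  have z: "2 * e * (e * n1) + 2 * (f * e) * a = 0" if f: "f = 1 \<or> f = -1" for f :: real
  proof -
    define v where "v = T p1 + of_real (f * e) *s p1"
    have ff: "f * f = 1" using f by auto
    have fe: "of_real (f * e) * of_real (f * e) = complex_of_real (1 - m\<^sup>2)"
      unfolding of_real_mult[symmetric] using ff e by (simp add: mult_ac)
    have v: "v \<in> W" unfolding v_def by (intro vec.span_add vec.span_scale T_W p_in_W)
    have "T v = of_real (f * e) *s v"
      unfolding v_def T_add T_scale T_T[OF p_in_W(1)] fe[symmetric] by (simp add: vec_eq_iff algebra_simps)
    then have "h v v = 0" using ne_T assms v by blast
    moreover have "h v v = of_real (1 - m\<^sup>2) * of_real n1 * 2 + of_real (2 * (f * e)) * of_real a"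
    proof -
      have X: "h (T p1) p1 = of_real a" "h p1 (T p1) = of_real a"
        using h_T_real[OF p_in_W(1)] T_selfadjoint[OF p_in_W(1) p_in_W(1)] by (simp_all add: a_def)
      have "h v v = h (T p1) (T p1) + of_real (f * e) * h (T p1) p1 + of_real (f * e) * h p1 (T p1)
         + of_real (f * e) * of_real (f * e) * h p1 p1"
        unfolding v_def by (simp add: h_simps algebra_simps)
      then show ?thesis unfolding fe X hpp h_T_T[OF p_in_W(1) p_in_W(1)] by (simp add: algebra_simps)
    qed
    ultimately have "of_real (1 - m\<^sup>2) * of_real n1 * 2 + of_real (2 * (f * e)) * of_real a = (0 :: complex)"
      by simp
    then have "complex_of_real ((1 - m\<^sup>2) * n1 * 2 + 2 * (f * e) * a) = 0" by simp
    then have "(1 - m\<^sup>2) * n1 * 2 + 2 * (f * e) * a = 0" by (simp only: of_real_eq_0_iff)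
    then show ?thesis unfolding e(2)[symmetric] by (simp add: algebra_simps)
  qed
  have "e * (e * n1) = 0" using z[OF disjI1[OF refl]] z[OF disjI2[OF refl]] by linarith
  then show False using e nonzero by simp
qed

text \<open>\<open>cos (x1 + x2) - m\<close> is a positive multiple of \<open>t - 1\<close>, and
  \<open>cos (x1 - x2) - m\<close> is a positive multiple of \<open>t\<close>.\<close>

lemma tance_sign: "m \<le> -1 \<Longrightarrow> t > 1" "m \<ge> 1 \<Longrightarrow> t < 0"
proof -
  have s: "sin x1 * sin x2 > 0" using sin_pos by simp
  have a: "cos (x1 + x2) - m = 2 * (sin x1 * sin x2) * (t - 1)"
    by (simp add: m_def cos_add cos_diff algebra_simps)
  have b: "cos (x1 - x2) - m = 2 * (sin x1 * sin x2) * t" by (simp add: m_def)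
  show "t > 1" if "m \<le> -1"
  proof -
    have "cos (x1 + x2) - m \<ge> 0" using that cos_ge_minus_one[of "x1 + x2"] by linarith
    then have "t - 1 \<ge> 0" unfolding a using s by (simp add: zero_le_mult_iff)
    then show ?thesis using t_ne by simp
  qed
  show "t < 0" if "m \<ge> 1"
  proof -
    have "cos (x1 - x2) - m \<le> 0" using that cos_le_one[of "x1 - x2"] by linarith
    moreover have "2 * (sin x1 * sin x2) * t > 0" if "t > 0" using that s by simp
    ultimately have "\<not> t > 0" using b by auto
    then show ?thesis using t_ne by simp
  qed
qed

lemma tance_eq: "tance h (abs_pv p1) (abs_pv p2) = t"
proof -
  have "tance h (abs_pv p1) (abs_pv p2) = Re ((g * cnj g) / (of_real n1 * of_real n2))"
    unfolding tance_abs_pv[OF herm nonzero(8,9)] hpp ..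
  also have "\<dots> = t" unfolding t_eq[symmetric] by simp
  finally show ?thesis .
qed

lemma sign_product: "t > 1 \<Longrightarrow> n1 * n2 > 0" "t < 0 \<Longrightarrow> n1 * n2 < 0"
proof -
  have e: "t * (n1 * n2) > 0" using nonzero by (simp add: t_def)
  show "n1 * n2 > 0" if "t > 1" using e that by (auto simp: zero_less_mult_iff[of t])
  show "n1 * n2 < 0" if "t < 0" using e that by (auto simp: zero_less_mult_iff[of t])
qed

end

section \<open>Associated geodesics and \<open>f\<close>-bendings\<close>

context config
begin

lemma config: "config h p1 p2 \<alpha>1 \<alpha>2"
  by unfold_locales

lemma polar:
  obtains c where "h c c \<noteq> 0" "\<And>x. x \<in> W \<longleftrightarrow> h x c = 0" "R c = kap *s c"
proof -
  obtain c where c: "h c c \<noteq> 0" "h p1 c = 0" "h p2 c = 0" "\<And>x. h x c = 0 \<Longrightarrow> \<exists>a b. x = a *s p1 + b *s p2"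
    by (rule polar_vector[OF nonzero(4,7)]) (rule that; blast)
  have W: "x \<in> W \<longleftrightarrow> h x c = 0" for x
    using c by (auto simp: in_W h_simps)
  have "h c p1 = 0" "h c p2 = 0" using c h_eq_0_commute by blast+
  then have "R c = kap *s c"
    by (simp add: R_def rf_orthogonal rf_scale vector_smult_assoc kap_def mult.commute)
  then show ?thesis using that c W by blast
qed

lemma W_split:
  assumes "h c c \<noteq> 0" "\<And>x. x \<in> W \<longleftrightarrow> h x c = 0"
  shows "\<exists>y z. x = y + z *s c \<and> y \<in> W"
proof -
  have "x = (x - (h x c / h c c) *s c) + (h x c / h c c) *s c" by simp
  moreover have "x - (h x c / h c c) *s c \<in> W" using assms by (simp add: h_simps)
  ultimately show ?thesis by blast
qed

text \<open>\<open>A_p2\<close> solved for \<open>p1\<close>. It serves to carry coordinates along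
  \<open>p1\<close>, \<open>T p1\<close> over to coordinates along \<open>p2\<close>,
  \<open>T p2\<close>.\<close>

lemma p1_from_p2:
  "p1 = inverse (2 * \<i> * sin x1 * cis x2 * (cnj g / n1)) *s ((of_real (2 * m) - cis (x2 - x1)) *s p2 - A p2)"
proof -
  define k where "k = 2 * \<i> * sin x1 * cis x2 * (cnj g / n1)"
  have "k \<noteq> 0" using sin_pos nonzero by (simp add: k_def)
  moreover have "(of_real (2 * m) - cis (x2 - x1)) *s p2 - A p2 = k *s p1"
    unfolding A_p2 k_def by simp
  ultimately show ?thesis unfolding k_def[symmetric] by (simp add: vector_smult_assoc)
qed

lemma W_span_T: "x \<in> W \<Longrightarrow> \<exists>a b. x = a *s p1 + b *s T p1"
proof -
  assume "x \<in> W"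
  then obtain a b where x: "x = a *s p1 + b *s p2" by (auto simp: in_W)
  define k where "k = 2 * sin x2 * cis (- x1) * (g / n2)"
  have k0: "k \<noteq> 0" using sin_pos nonzero by (simp add: k_def)
  define l where "l = \<i> * (cis (x2 - x1) - of_real m)"
  have Tp: "T p1 = l *s p1 + k *s p2" unfolding T_p1 l_def k_def ..
  have "p2 = inverse k *s (T p1 - l *s p1)" unfolding Tp using k0 by (simp add: vector_smult_assoc)
  then have "b *s p2 = b *s (inverse k *s (T p1 - l *s p1))" by (rule arg_cong)
  then have "x = (a - b * inverse k * l) *s p1 + (b * inverse k) *s T p1"
    unfolding x by (simp add: vec_eq_iff algebra_simps)
  then show ?thesis by blast
qed

lemma T_form: "h (a *s x + b *s T x) (a *s x + b *s T x) =
    (a * cnj a - of_real (m\<^sup>2 - 1) * (b * cnj b)) * h x x + (a * cnj b + b * cnj a) * h (T x) x" if "x \<in> W"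
proof -
  have "h (a *s x + b *s T x) (a *s x + b *s T x) =
      a * cnj a * h x x + a * cnj b * h x (T x) + b * cnj a * h (T x) x + b * cnj b * h (T x) (T x)"
    by (simp add: h_simps algebra_simps)
  then show ?thesis
    unfolding h_T_T[OF that that] T_selfadjoint[OF that that] by (simp add: algebra_simps)
qed

text \<open>If \<open>q\<close> on the geodesic of \<open>x\<close> and \<open>T x\<close> were
  orthogonal to \<open>x\<close>, then \<open>h q q\<close> would be a nonpositive multiple of
  \<open>h x x\<close>, because the cross term is absorbed and
  \<open>m\<^sup>2 - 1 \<ge> 0\<close>.\<close>

lemma not_orthogonal_T:
  assumes "m\<^sup>2 \<ge> 1" and x: "x \<in> W" and s: "Re (h x x) * Re (h q q) > 0"
    and q: "q = l *s (of_real a *s x + of_real b *s T x)"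
  shows "h x q \<noteq> 0"
proof
  assume 0: "h x q = 0"
  define y where "y = of_real a *s x + of_real b *s T x"
  define n r where "n = Re (h x x)" and "r = Re (h (T x) x)"
  have nx: "h x x = of_real n" "h (T x) x = of_real r" "h x (T x) = of_real r"
    unfolding n_def r_def using h_self_real h_T_real[OF x] T_selfadjoint[OF x x] by simp_all
  have l0: "l \<noteq> 0" using s q by auto
  have "h x y = 0" using 0 l0 by (simp add: q y_def[symmetric] h_simps)
  then have "of_real (a * n + b * r) = (0 :: complex)" by (simp add: y_def h_simps nx)
  then have o: "a * n + b * r = 0" by (simp only: of_real_eq_0_iff)
  have "h y y = of_real ((a\<^sup>2 - (m\<^sup>2 - 1) * b\<^sup>2) * n + 2 * (a * b) * r)"
    unfolding y_def T_form[OF x] nx by (simp add: power2_eq_square algebra_simps)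
  also have "(a\<^sup>2 - (m\<^sup>2 - 1) * b\<^sup>2) * n + 2 * (a * b) * r = 2 * a * (a * n + b * r) - (a\<^sup>2 + (m\<^sup>2 - 1) * b\<^sup>2) * n"
    by (simp add: power2_eq_square algebra_simps)
  also have "2 * a * (a * n + b * r) - (a\<^sup>2 + (m\<^sup>2 - 1) * b\<^sup>2) * n = - ((a\<^sup>2 + (m\<^sup>2 - 1) * b\<^sup>2) * n)"
    unfolding o by simp
  finally have yy: "h y y = of_real (- ((a\<^sup>2 + (m\<^sup>2 - 1) * b\<^sup>2) * n))" .
  have "h q q = (l * cnj l) * h y y" by (simp add: q y_def[symmetric] h_simps)
  also have "\<dots> = of_real ((cmod l)\<^sup>2 * (- ((a\<^sup>2 + (m\<^sup>2 - 1) * b\<^sup>2) * n)))"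
    unfolding yy of_real_mult complex_norm_square ..
  finally have "h q q = of_real ((cmod l)\<^sup>2 * (- ((a\<^sup>2 + (m\<^sup>2 - 1) * b\<^sup>2) * n)))" .
  then have qq: "Re (h q q) = (cmod l)\<^sup>2 * (- ((a\<^sup>2 + (m\<^sup>2 - 1) * b\<^sup>2) * n))" by (simp only: Re_complex_of_real)
  have "Re (h x x) * Re (h q q) = - ((cmod l)\<^sup>2 * (a\<^sup>2 + (m\<^sup>2 - 1) * b\<^sup>2) * n\<^sup>2)"
    unfolding qq n_def[symmetric] by (simp only: power2_eq_square[of n] mult_minus_right mult_ac)
  moreover have "(cmod l)\<^sup>2 * (a\<^sup>2 + (m\<^sup>2 - 1) * b\<^sup>2) * n\<^sup>2 \<ge> 0" using assms(1) by simp
  ultimately show False using s by linarith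
qed

text \<open>Modulo \<open>p1\<close>, \<open>T_p1\<close> shows \<open>T p1\<close> as a real
  multiple of \<open>cis (- x1) *s (g *s p2)\<close>; modulo \<open>p2\<close>, \<open>T_p2\<close>
  shows \<open>T p2\<close> as a real multiple of \<open>cis x2 *s (cnj g *s p1)\<close>. These
  phases are the prescribed angles. The representatives are fixed because tangent vectors are taken
  relative to \<open>rep_pv\<close>.\<close>

lemma associated:
  assumes ne and r: "rep_pv P1 = p1" "rep_pv P2 = p2"
  shows "associated_geodesics h (P1, P2, \<alpha>1, \<alpha>2) (geo p1 (g *s p2)) (geo p1 (T p1)) (geo p2 (T p2))"
proof -
  have P: "P1 = abs_pv p1" "P2 = abs_pv p2" using r abs_rep_pv[of P1] abs_rep_pv[of P2] by simp_all
  have L: "line_through P1 P2 = vec.span {p1, p2}" by (simp add: line_through_def r)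
  have g0: "cnj g \<noteq> 0" using nonzero by simp
  have ind: "indep p1 (g *s p2)"
  proof (rule indepI)
    fix c show "g *s p2 \<noteq> c *s p1"
    proof
      assume "g *s p2 = c *s p1"
      then have "inverse g *s (g *s p2) = inverse g *s (c *s p1)" by simp
      then have "p2 = (inverse g * c) *s p1" using nonzero by (simp add: vector_smult_assoc)
      then show False using nonzero gram_scale by metis
    qed
  qed (rule nonzero)
  have ind2: "indep p2 (cnj g *s p1)"
  proof (rule indepI)
    fix c show "cnj g *s p1 \<noteq> c *s p2"
    proof
      assume "cnj g *s p1 = c *s p2"
      then have "inverse (cnj g) *s (cnj g *s p1) = inverse (cnj g) *s (c *s p2)" by simp
      then have "p1 = (inverse (cnj g) * c) *s p2" using nonzero by (simp add: vector_smult_assoc)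
      then have "gram p2 p1 = 0" using gram_scale by metis
      then show False using nonzero by (simp add: gram_def mult.commute)
    qed
  qed (rule nonzero)
  have iT: "indep p1 (T p1)" "indep p2 (T p2)" using indep_T assms(1) p_in_W nonzero by blast+
  \<comment> \<open>To measure the angle at \<open>p2\<close> the same geodesic needs a real plane
    containing \<open>p2\<close>: multiplying the plane by \<open>cnj g\<close> turns the factor
    \<open>g\<close> of \<open>p2\<close> into a real one.\<close>
  have G2: "geo p1 (g *s p2) = geo p2 (cnj g *s p1)"
  proof -
    have "geo p1 (g *s p2) = geo (cnj g *s p1) (cnj g *s (g *s p2))" by (rule geo_scale[OF g0, symmetric])
    also have "cnj g *s (g *s p2) = of_real ((cmod g)\<^sup>2) *s p2"
      unfolding complex_norm_square by (simp add: vector_smult_assoc mult.commute)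
    also have "geo (cnj g *s p1) (of_real ((cmod g)\<^sup>2) *s p2) = geo (cnj g *s p1) p2"
      using nonzero by (intro geo_scale_right) simp
    also have "\<dots> = geo p2 (cnj g *s p1)" by (rule geo_commute)
    finally show ?thesis .
  qed
  have geo1: "geodesic h (vec.span {p1, p2}) (geo p1 (g *s p2))"
  proof (rule geodesic_geo[OF ind])
    show "h p1 (g *s p2) \<in> \<real>" by (simp add: h_simps complex_is_Real_iff)
    show "h p1 p1 \<in> \<real>" by (simp add: hpp)
    have "h (g *s p2) (g *s p2) = g * cnj g * h p2 p2" by (simp add: h_simps)
    then show "h (g *s p2) (g *s p2) \<in> \<real>" by (simp add: hpp complex_is_Real_iff)
  qed (use nonzero p_in_W in \<open>auto intro: vec.span_scale\<close>)
  have geoT: "geodesic h (vec.span {p1, p2}) (geo x (T x))" if "x \<in> W" "indep x (T x)" "h x x \<noteq> 0" for x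
  proof (rule geodesic_geo[OF that(2)])
    show "h x (T x) \<in> \<real>" "h x x \<in> \<real>" "h (T x) (T x) \<in> \<real>"
      unfolding h_T_T[OF that(1,1)]
      using h_T_real[OF that(1)] h_self_real[of x] T_selfadjoint[OF that(1,1)]
      by (metis Reals_of_real Reals_mult)+
  qed (use that T_W in auto)
  have "abs_pv p \<in> geo p w" if "p \<noteq> 0" for p w
    unfolding in_geo by (rule exI[of _ 1], rule exI[of _ 0]) (use that in simp)
  then have mem: "P1 \<in> geo p1 w" "P2 \<in> geo p2 w" for w
    unfolding P using nonzero by blast+
  have a1: "oriented_angle P1 (geo p1 (T p1)) (geo p1 (g *s p2)) = x1"
  proof (rule oriented_angle_geo[OF r(1) iT(1) ind])
    define k where "k = n2 / (2 * sin x2)"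
    have k0: "k * (2 * sin x2) = n2" using sin_pos by (simp add: k_def)
    have "of_real k * cis x1 * (2 * sin x2 * cis (- x1) * (g / n2)) = of_real (k * (2 * sin x2)) * (cis x1 * cis (- x1)) * (g / n2)"
      by (simp add: mult_ac)
    also have "\<dots> = g" unfolding k0 using nonzero by (simp add: cis_mult)
    finally have e: "of_real k * cis x1 * (2 * sin x2 * cis (- x1) * (g / n2)) = g" .
    have "(of_real k * cis x1) *s T p1 = (of_real k * cis x1 * (\<i> * (cis (x2 - x1) - of_real m))) *s p1
        + (of_real k * cis x1 * (2 * sin x2 * cis (- x1) * (g / n2))) *s p2"
      unfolding T_p1 by (simp add: vec_eq_iff algebra_simps)
    then show "g *s p2 = (of_real k * cis x1) *s T p1 + (- of_real k * cis x1 * (\<i> * (cis (x2 - x1) - of_real m))) *s p1"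
      unfolding e by (simp add: vec_eq_iff)
    show "k \<noteq> 0" using nonzero sin_pos by (simp add: k_def)
  qed (use ang[OF par(1)] in auto)
  have a2: "oriented_angle P2 (geo p2 (cnj g *s p1)) (geo p2 (T p2)) = x2"
  proof (rule oriented_angle_geo[OF r(2) ind2 iT(2)])
    show "T p2 = (of_real (2 * sin x1 / n1) * cis x2) *s (cnj g *s p1) + (\<i> * (of_real m - cis (x2 - x1))) *s p2"
      unfolding T_p2 by (simp add: vec_eq_iff algebra_simps)
    show "2 * sin x1 / n1 \<noteq> 0" using nonzero sin_pos by simp
  qed (use ang[OF par(2)] in auto)
  show ?thesis
    unfolding associated_geodesics_def prod.case L Arg2pi_primitive[OF par(1)] Arg2pi_primitive[OF par(2)]
    using geo1 geoT[OF p_in_W(1) iT(1) nonzero(4)] geoT[OF p_in_W(2) iT(2) nonzero(5)] mem a1 a2 G2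
    by auto
qed

text \<open>Both arcs lie in \<open>W\<close> and consist of nonisotropic points by equality of
  signs, whereas \<open>ne\<close> makes every eigenvector in \<open>W\<close> isotropic; so no
  fixed point lies on them.\<close>

lemma elementary_f_bending:
  assumes ne and r: "rep_pv P1 = p1" "rep_pv P2 = p2"
    and q: "quad q1 q2 \<beta>1 \<beta>2" and e: "\<And>x. rf \<beta>2 q2 (rf \<beta>1 q1 x) = R x" and k: "\<beta>1 * \<beta>2 = kap"
    and c: "same_component \<alpha>1 \<beta>1" "same_component \<alpha>2 \<beta>2"
    and s: "n1 * Re (h q1 q1) > 0" "n2 * Re (h q2 q2) > 0"
    and q1: "q1 = l1 *s (of_real a1 *s p1 + of_real b1 *s T p1)"
    and q2: "q2 = l2 *s (of_real a2 *s p2 + of_real b2 *s T p2)"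
  shows "elementary_relation h (P1, P2, \<alpha>1, \<alpha>2) (abs_pv q1, abs_pv q2, \<beta>1, \<beta>2)"
proof -
  have P: "P1 = abs_pv p1" "P2 = abs_pv p2" using r abs_rep_pv[of P1] abs_rep_pv[of P2] by simp_all
  note d = quadD[OF q]
  have m1: "m\<^sup>2 \<ge> 1" using m_ge_1 assms(1) by blast
  have o: "h p1 q1 \<noteq> 0" "h p2 q2 \<noteq> 0"
    using not_orthogonal_T[OF m1 p_in_W(1) s(1)[unfolded n1_def] q1]
      not_orthogonal_T[OF m1 p_in_W(2) s(2)[unfolded n2_def] q2] by auto
  have qW: "q1 \<in> W" "q2 \<in> W"
    unfolding q1 q2 by (intro vec.span_scale vec.span_add T_W p_in_W)+
  have mem: "abs_pv (l *s (of_real a *s p + of_real b *s T p)) \<in> geo p (T p)"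
    if "l *s (of_real a *s p + of_real b *s T p) \<noteq> 0" for l a b p
  proof -
    have "l \<noteq> 0" "of_real a *s p + of_real b *s T p \<noteq> 0" using that by (auto simp only: vector_mul_eq_0)
    then show ?thesis unfolding in_geo using abs_pv_scale by blast
  qed
  have m12: "abs_pv q1 \<in> geo p1 (T p1)" "abs_pv q2 \<in> geo p2 (T p2)"
    using mem[of l1 a1 p1 b1] mem[of l2 a2 p2 b2] d unfolding q1[symmetric] q2[symmetric] by auto
  have sg: "sgn x = sgn y" if "x * y > 0" for x y :: real
    using that by (auto simp: zero_less_mult_iff)
  have sg': "sig h (abs_pv q1) = sig h P1" "sig h (abs_pv q2) = sig h P2"
    unfolding P sig_abs_pv[OF herm d(1)] sig_abs_pv[OF herm d(2)] sig_abs_pv[OF herm nonzero(8)] sig_abs_pv[OF herm nonzero(9)]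
    using sg[OF s(1)] sg[OF s(2)] by (simp_all add: n1_def n2_def)
  have Rp: "product h (P1, P2, \<alpha>1, \<alpha>2) = R"
    unfolding P product_abs[OF nonzero(8,9)] by (simp add: R_def fun_eq_iff)
  have arc: "\<not> fixed_point R x"
    if x: "x \<in> geodesic_arc h P Q" and p: "rep_pv P = p" "p \<in> W" "h p p \<noteq> 0"
      and q: "Q = abs_pv q" "q \<in> W" "h p q \<noteq> 0" "Re (h p p) * Re (h q q) > 0" for x P Q p q
  proof
    assume f: "fixed_point R x"
    have q0: "q \<noteq> 0" using q by auto
    have "\<exists>v. x = abs_pv v \<and> v \<in> W \<and> h v v \<noteq> 0"
    proof (cases "P = Q")
      case True
      then have "x = abs_pv p" using x p abs_rep_pv[of P] by (simp add: geodesic_arc_def)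
      then show ?thesis using p by blast
    next
      case False
      obtain l where l: "l \<noteq> 0" "rep_pv Q = l *s q" using rep_abs_pv[OF q0] q(1) by metis
      have "h (l *s q) (l *s q) = of_real ((cmod l)\<^sup>2) * h q q"
        unfolding complex_norm_square by (simp add: h_simps)
      then have "Re (h (l *s q) (l *s q)) = (cmod l)\<^sup>2 * Re (h q q)" by simp
      then have "Re (h p p) * Re (h (l *s q) (l *s q)) = (cmod l)\<^sup>2 * (Re (h p p) * Re (h q q))"
        by (simp only: mult_ac)
      moreover have "(cmod l)\<^sup>2 > 0" using l(1) by simp
      ultimately have "Re (h p p) * Re (h (l *s q) (l *s q)) > 0" using q(4) by (simp only: mult_pos_pos)
      moreover have "h p (l *s q) \<noteq> 0" using q l by (simp add: h_simps)
      ultimately obtain v where v: "x = abs_pv v" "v \<in> vec.span {p, l *s q}" "h v v \<noteq> 0"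
        using geodesic_arc_nonisotropic[OF p(1) l(2) False _ _ x] by blast
      have "vec.span {p, l *s q} \<subseteq> W"
        using p q by (intro vec.span_minimal) (auto intro: vec.span_scale vec.subspace_span)
      then show ?thesis using v by blast
    qed
    then obtain v where v: "x = abs_pv v" "v \<in> W" "h v v \<noteq> 0" by blast
    then have v0: "v \<noteq> 0" by auto
    obtain l where l: "l \<noteq> 0" "rep_pv x = l *s v" using rep_abs_pv[OF v0] v(1) by metis
    obtain c where "R (l *s v) = c *s (l *s v)" using f l by (auto simp: fixed_point_def)
    moreover have "R (l *s v) = l *s R v" by (simp add: R_def rf_scale)
    ultimately have "inverse l *s (l *s R v) = inverse l *s (c *s (l *s v))" by simp
    then have "R v = c *s v" using l by (simp add: vector_smult_assoc)
    then show False using assms(1) v unfolding ne_def by blast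
  qed
  have arcs: "\<forall>x \<in> geodesic_arc h P1 (abs_pv q1) \<union> geodesic_arc h P2 (abs_pv q2). \<not> fixed_point R x"
    using arc[OF _ r(1) p_in_W(1) nonzero(4) refl qW(1) o(1)] arc[OF _ r(2) p_in_W(2) nonzero(5) refl qW(2) o(2)]
      s unfolding n1_def n2_def by blast
  have o': "\<not> orthogonal_pts h P1 (abs_pv q1)" "\<not> orthogonal_pts h P2 (abs_pv q2)"
    unfolding P using o d nonzero by (simp_all add: orthogonal_abs_pv[OF herm])
  have "f_bending h (P1, P2, \<alpha>1, \<alpha>2) (abs_pv q1, abs_pv q2, \<beta>1, \<beta>2)"
    unfolding f_bending_def prod.case Rp
    using associated[OF assms(1) r] m12 sg' o' c k arcs by (auto simp: kap_def)
  then show ?thesis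
    unfolding P by (intro elementary_relationI[OF quad q]) (simp_all add: e R_def)
qed

end

section \<open>Connecting two quadruples\<close>

text \<open>The half-angle formulas extract one common phase, leaving a real and a purely imaginary
  factor. This is what makes the coordinates of the second point real up to a common factor.\<close>

lemma cis_half_sum:
  "cis y * cis x + 1 - of_real m * (cis y + cis x)
     = cis ((y + x) / 2) * of_real (2 * cos ((y + x) / 2) - 2 * m * cos ((y - x) / 2))"
  "cis y - cis x = cis ((y + x) / 2) * (2 * \<i> * of_real (sin ((y - x) / 2)))"
proof -
  define a b where "a = (y + x) / 2" and "b = (y - x) / 2"
  have yx: "y = a + b" "x = a - b" by (simp_all add: a_def b_def field_simps)
  have c: "cis y = cis a * cis b" "cis x = cis a * cis (- b)" by (simp_all add: yx cis_mult)
  have s: "cis b + cis (- b) = of_real (2 * cos b)" "cis b - cis (- b) = 2 * \<i> * of_real (sin b)"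
    by (simp_all add: complex_eq_iff)
  have one: "(1 :: complex) = cis a * cis (- a)" "cis b * cis (- b) = 1" by (simp_all add: cis_mult)
  have "cis y * cis x + 1 = cis a * (cis a * (cis b * cis (- b))) + cis a * cis (- a)"
    unfolding c one(1)[symmetric] by (simp add: mult_ac)
  also have "\<dots> = cis a * (cis a + cis (- a))" unfolding one(2) by (simp add: algebra_simps)
  also have "cis a + cis (- a) = of_real (2 * cos a)" by (simp add: complex_eq_iff)
  finally have 1: "cis y * cis x + 1 = cis a * of_real (2 * cos a)" .
  have 2: "cis y + cis x = cis a * of_real (2 * cos b)" unfolding c s(1)[symmetric] by (simp add: algebra_simps)
  show "cis y * cis x + 1 - of_real m * (cis y + cis x)
     = cis ((y + x) / 2) * of_real (2 * cos ((y + x) / 2) - 2 * m * cos ((y - x) / 2))"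
    unfolding 1 2 a_def[symmetric] b_def[symmetric] by (simp add: algebra_simps)
  show "cis y - cis x = cis ((y + x) / 2) * (2 * \<i> * of_real (sin ((y - x) / 2)))"
    unfolding a_def[symmetric] b_def[symmetric] s(2)[symmetric] c by (simp add: algebra_simps)
qed

context config
begin

lemma R_add: "R (x + y) = R x + R y" and R_scale: "R (c *s x) = c *s R x"
  by (simp_all add: R_def rf_add rf_scale)

lemma R_W: "x \<in> W \<Longrightarrow> R x \<in> W"
  unfolding R_A by (intro vec.span_scale A_W)

lemma T_R: "T (R x) = R (T x)"
  by (simp add: R_A T_scale) (simp add: T_def A_scale A_diff)

text \<open>\<open>W\<close> is the range of \<open>R - kap\<close>, while \<open>u\<close> depends
  only on \<open>kap\<close> and the angle sum and changes sign when the sum is shifted by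
  \<open>pi\<close>. \<open>A_A\<close> on a common nonzero vector then compares the two values of
  \<open>m\<close>.\<close>

lemma same_data:
  assumes Q: "config h q1 q2 \<beta>1 \<beta>2" and e: "\<And>x. rf \<beta>2 q2 (rf \<beta>1 q1 x) = R x" and k: "\<beta>1 * \<beta>2 = kap"
  shows "config.R h q1 q2 \<beta>1 \<beta>2 = R" "config.kap \<beta>1 \<beta>2 = kap" "vec.span {q1, q2} = W"
    "ang \<beta>1 + ang \<beta>2 = x1 + x2 \<Longrightarrow> config.A h q1 q2 \<beta>1 \<beta>2 = A"
    "ang \<beta>1 + ang \<beta>2 = x1 + x2 \<Longrightarrow> config.m h q1 q2 \<beta>1 \<beta>2 = m"
    "ang \<beta>1 + ang \<beta>2 = x1 + x2 \<Longrightarrow> config.T h q1 q2 \<beta>1 \<beta>2 = T"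
    "ang \<beta>1 + ang \<beta>2 = x1 + x2 + pi \<or> ang \<beta>1 + ang \<beta>2 = x1 + x2 - pi \<Longrightarrow> config.m h q1 q2 \<beta>1 \<beta>2 = - m"
proof -
  interpret Q: config h q1 q2 \<beta>1 \<beta>2 by (rule Q)
  show QR: "Q.R = R" by (rule ext) (simp add: Q.R_def e)
  show Qk: "Q.kap = kap" by (simp add: Q.kap_def k)
  show QW: "vec.span {q1, q2} = W" unfolding Q.W_eq_range W_eq_range QR Qk ..
  have A0: "A p1 \<noteq> 0" using A_isometry[of p1 p1] nonzero by auto
  have mm: "x = y" if "of_real (2 * x) *s A p1 - p1 = of_real (2 * y) *s A p1 - p1" for x y
  proof -
    have "of_real (2 * x) *s A p1 = of_real (2 * y) *s A p1" using that by simp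
    then have "complex_of_real (2 * x) = of_real (2 * y)" using A0 by (simp add: vector_mul_rcancel)
    then show ?thesis by simp
  qed
  have p1Q: "p1 \<in> vec.span {q1, q2}" unfolding QW by (rule p_in_W)
  {
    assume S: "ang \<beta>1 + ang \<beta>2 = x1 + x2"
    have u: "Q.u = u" by (simp add: Q.u_def u_def Qk S)
    show QA: "Q.A = A" by (rule ext) (simp add: Q.A_def A_def QR u)
    have "of_real (2 * Q.m) *s A p1 - p1 = of_real (2 * m) *s A p1 - p1"
      by (rule trans[OF sym[OF Q.A_A[OF p1Q, unfolded QA]] A_A[OF p_in_W(1)]])
    then show Qm: "Q.m = m" by (rule mm)
    show "Q.T = T" by (rule ext) (simp add: Q.T_def T_def QA Qm)
  }
  assume S: "ang \<beta>1 + ang \<beta>2 = x1 + x2 + pi \<or> ang \<beta>1 + ang \<beta>2 = x1 + x2 - pi"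
  have cp: "cis (- (y + pi)) = - cis (- y)" "cis (- (y - pi)) = - cis (- y)" for y
    by (simp_all add: complex_eq_iff cos_add sin_add cos_diff sin_diff)
  have "cis (- (ang \<beta>1 + ang \<beta>2)) = - cis (- (x1 + x2))" using S cp[of "x1 + x2"] by metis
  then have u: "Q.u = - u" by (simp add: Q.u_def u_def Qk)
  have QA: "Q.A x = - A x" for x using kap_u_nz by (simp add: Q.A_def A_def QR u vec_eq_iff)
  have n: "A (- y) = - A y" for y using A_scale[of "-1" y] by (simp add: vector_sneg_minus1[symmetric])
  have "of_real (2 * (- Q.m)) *s A p1 - p1 = of_real (2 * m) *s A p1 - p1"
    using Q.A_A[OF p1Q] A_A[OF p_in_W(1)] unfolding QA n by (simp add: vec_eq_iff)
  from mm[OF this] show "Q.m = - m" by simp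
qed

lemma connect_core:
  assumes ne: ne and r: "rep_pv P1 = p1" "rep_pv P2 = p2"
    and q: "quad q1 q2 \<beta>1 \<beta>2" and e: "\<And>x. rf \<beta>2 q2 (rf \<beta>1 q1 x) = R x" and k: "\<beta>1 * \<beta>2 = kap"
    and S: "ang \<beta>1 + ang \<beta>2 = x1 + x2"
    and c: "same_component \<alpha>1 \<beta>1" "same_component \<alpha>2 \<beta>2"
    and s: "n1 * Re (h q1 q1) > 0" "n2 * Re (h q2 q2) > 0"
  shows "\<exists>Q. elementary_relation h (abs_pv q1, abs_pv q2, \<beta>1, \<beta>2) Q \<and> elementary_relation h (P1, P2, \<alpha>1, \<alpha>2) Q"
proof -
  have cfQ: "config h q1 q2 \<beta>1 \<beta>2" by unfold_locales (rule q)
  have QW: "vec.span {q1, q2} = W" using same_data[OF cfQ e k] by blast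
  have q1W: "q1 \<in> W" unfolding QW[symmetric] by (simp add: vec.span_base)
  define D where "D = m\<^sup>2 - 1"
  have D0: "D \<ge> 0" using m_ge_1[OF ne] by (simp add: D_def)
  obtain a b where ab: "q1 = a *s p1 + b *s T p1" using W_span_T[OF q1W] by blast
  note d = quadD[OF q]
  have TT: "T (T p1) = - (of_real D *s p1)" "T (T p2) = - (of_real D *s p2)"
    unfolding T_T[OF p_in_W(1)] T_T[OF p_in_W(2)] by (simp_all add: D_def vec_eq_iff algebra_simps)
  have Tq1: "T q1 = (- b * of_real D) *s p1 + a *s T p1"
    unfolding ab T_add T_scale TT by (simp add: vec_eq_iff algebra_simps)
  \<comment> \<open>The combination \<open>a *s q1 - b *s T q1\<close> equals
    \<open>(a\<^sup>2 + of_real D * b\<^sup>2) *s p1\<close>. If it vanished, \<open>q1\<close>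
    would be an eigenvector of \<open>T\<close>, hence isotropic.\<close>
  have nz: "a\<^sup>2 + of_real D * b\<^sup>2 \<noteq> 0"
  proof
    assume 0: "a\<^sup>2 + of_real D * b\<^sup>2 = 0"
    have "a *s q1 - b *s T q1 = (a\<^sup>2 + of_real D * b\<^sup>2) *s p1"
      unfolding Tq1 unfolding ab by (simp add: vec_eq_iff algebra_simps power2_eq_square)
    then have eq: "b *s T q1 = a *s q1" using 0 by simp
    have b0: "b \<noteq> 0"
    proof
      assume "b = 0"
      then have "q1 = 0" using 0 ab by simp
      then show False using d by simp
    qed
    have "T q1 = inverse b *s (b *s T q1)" using b0 by (simp add: vector_smult_assoc)
    also have "\<dots> = (inverse b * a) *s q1" unfolding eq by (simp add: vector_smult_assoc)
    finally have "h q1 q1 = 0" using ne_T[OF ne q1W] by blast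
    then show False using d by simp
  qed
  \<comment> \<open>Chosen so that the coefficients of the moved \<open>q1\<close> along
    \<open>p1\<close> and \<open>T p1\<close> have a real ratio, that is, the moved point lies on
    the first associated geodesic.\<close>
  obtain co dd :: real where cd: "co\<^sup>2 - D * dd\<^sup>2 = 1"
    "Im ((of_real co * a + \<i> * of_real dd * of_real D * b) * cnj (of_real co * b - \<i> * of_real dd * a)) = 0"
    by (rule hyperbolic_rotation_solve[OF D0 nz])
  obtain l a1 b1 where l: "l \<noteq> 0" "of_real co * a + \<i> * of_real dd * of_real D * b = l * of_real a1"
    "of_real co * b - \<i> * of_real dd * a = l * of_real b1"
    by (rule real_phase[OF cd(2)])
  obtain c0 where c0: "h c0 c0 \<noteq> 0" "\<And>x. x \<in> W \<longleftrightarrow> h x c0 = 0" "R c0 = kap *s c0" by (rule polar) blast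
  define f where "f x = h x c0 / h c0 c0" for x
  define w where "w x = x - f x *s c0" for x
  \<comment> \<open>\<open>U\<close> preserves the form on \<open>W\<close> because \<open>T\<close>
    is selfadjoint with square \<open>- D\<close> there and
    \<open>co\<^sup>2 - D * dd\<^sup>2 = 1\<close>. Extended by the identity on the polar vector
    \<open>c0\<close>, it gives an isometry \<open>C\<close> commuting with
    \<open>R\<close>.\<close>
  define U where "U v = of_real co *s v - (\<i> * of_real dd) *s T v" for v
  define C where "C x = U (w x) + f x *s c0" for x
  have fadd: "f (x + y) = f x + f y" "f (z *s x) = z * f x" for x y z
    by (simp_all add: f_def h_simps add_divide_distrib)
  have wadd: "w (x + y) = w x + w y" "w (z *s x) = z *s w x" for x y z
    by (simp_all add: w_def fadd vec_eq_iff algebra_simps)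
  have Uadd: "U (x + y) = U x + U y" "U (z *s x) = z *s U x" for x y z
    by (simp_all add: U_def T_add T_scale vec_eq_iff algebra_simps)
  have Cadd: "C (x + y) = C x + C y" for x y
    by (simp add: C_def fadd wadd Uadd vec_eq_iff algebra_simps)
  have Csc: "C (z *s x) = z *s C x" for z x
    by (simp add: C_def fadd wadd Uadd vec_eq_iff algebra_simps)
  have wW: "w x \<in> W" for x unfolding c0(2) using c0(1) by (simp add: w_def f_def h_simps)
  have UW: "U v \<in> W" if "v \<in> W" for v
    unfolding U_def using that by (intro vec.span_diff vec.span_scale T_W)
  have oW: "h v c0 = 0" "h c0 v = 0" if "v \<in> W" for v
    using that c0(2) h_eq_0_commute by blast+
  have hU: "h (U v) (U v') = h v v'" if v: "v \<in> W" "v' \<in> W" for v v'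
  proof -
    have "h (U v) (U v') = of_real (co\<^sup>2) * h v v' + \<i> * of_real (co * dd) * (h v (T v') - h (T v) v')
        + of_real (dd\<^sup>2) * h (T v) (T v')"
      by (simp add: U_def h_simps power2_eq_square algebra_simps)
    also have "\<dots> = of_real (co\<^sup>2 - D * dd\<^sup>2) * h v v'"
      unfolding T_selfadjoint[OF v] h_T_T[OF v] by (simp add: D_def algebra_simps)
    finally show ?thesis unfolding cd(1) by simp
  qed
  have split: "x = w x + f x *s c0" for x by (simp add: w_def)
  have hsum: "h (v + z *s c0) (v' + z' *s c0) = h v v' + z * cnj z' * h c0 c0" if "v \<in> W" "v' \<in> W" for v v' z z'
    using oW[OF that(1)] oW[OF that(2)] by (simp add: h_simps)
  have Ciso: "h (C x) (C y) = h x y" for x y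
  proof -
    have "h (C x) (C y) = h (U (w x)) (U (w y)) + f x * cnj (f y) * h c0 c0"
      unfolding C_def by (rule hsum) (intro UW wW)+
    also have "\<dots> = h (w x + f x *s c0) (w y + f y *s c0)"
      unfolding hU[OF wW wW] hsum[OF wW wW] ..
    finally show ?thesis unfolding split[symmetric] .
  qed
  have fR: "f (R x) = kap * f x" for x
  proof -
    have "cnj kap * h (R x) c0 = h x c0"
      using R_isometry[of x c0] unfolding c0(3) h_scale_right .
    then have "(kap * cnj kap) * h (R x) c0 = kap * h x c0" by (simp add: mult.assoc)
    moreover have "kap * cnj kap = 1" using cmod_kap by (simp add: complex_norm_square[symmetric])
    ultimately show ?thesis by (simp add: f_def)
  qed
  have wR: "w (R x) = R (w x)" for x
  proof -
    have Rx: "R x = R (w x) + (kap * f x) *s c0"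
      by (subst split[of x]) (simp only: R_add R_scale c0(3) vector_smult_assoc mult.commute)
    have "w (R x) = R x - (kap * f x) *s c0" by (simp only: w_def fR)
    also have "\<dots> = R (w x)" unfolding Rx by simp
    finally show ?thesis .
  qed
  have UR: "U (R v) = R (U v)" for v
  proof -
    have Rd: "R (x - y) = R x - R y" for x y using R_add[of "x - y" y] by (simp add: algebra_simps)
    show ?thesis by (simp add: U_def T_R Rd R_scale)
  qed
  have Ccom: "C (rf \<beta>2 q2 (rf \<beta>1 q1 x)) = rf \<beta>2 q2 (rf \<beta>1 q1 (C x))" for x
    unfolding e by (simp add: C_def fR wR UR R_add R_scale c0(3) vector_smult_assoc mult.commute)
  note bend = elementary_bending[of q1 q2 \<beta>1 \<beta>2 C, OF q Cadd Csc Ciso Ccom]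
  have e': "rf \<beta>2 (C q2) (rf \<beta>1 (C q1) x) = R x" for x unfolding bend(3) by (rule e)
  have cfQ': "config h (C q1) (C q2) \<beta>1 \<beta>2" by unfold_locales (rule bend(2))
  interpret Q': config h "C q1" "C q2" \<beta>1 \<beta>2 by (rule cfQ')
  have QA: "Q'.A = A" using same_data(4)[OF cfQ' e' k S] .
  have "f q1 = 0" using oW[OF q1W] by (simp add: f_def)
  then have "C q1 = U q1" by (simp add: C_def w_def)
  also have "\<dots> = (of_real co * a + \<i> * of_real dd * of_real D * b) *s p1 + (of_real co * b - \<i> * of_real dd * a) *s T p1"
    unfolding U_def Tq1 unfolding ab by (simp add: vec_eq_iff algebra_simps)
  finally have Cq1: "C q1 = l *s (of_real a1 *s p1 + of_real b1 *s T p1)"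
    unfolding l by (simp add: vec_eq_iff algebra_simps)
  \<comment> \<open>\<open>cis eta\<close> and \<open>cis xi\<close> are the coefficients of the
    first point in \<open>A_p1\<close> for the moved pair and for the original pair. Since both
    pairs have the same \<open>A\<close>, solving \<open>A_p1\<close> for the second point gives
    \<open>C q2\<close> as a multiple of \<open>(cis eta - A) (C q1)\<close>.\<close>
  define eta xi where "eta = ang \<beta>2 - ang \<beta>1" and "xi = x2 - x1"
  define K where "K = 2 * \<i> * sin (ang \<beta>2) * cis (- ang \<beta>1) * (h (C q1) (C q2) / Q'.n2)"
  have K0: "K \<noteq> 0" using Q'.sin_pos Q'.nonzero by (simp add: K_def)
  have "A (C q1) = cis eta *s C q1 - K *s C q2"
    using Q'.A_p1 unfolding QA eta_def K_def .
  then have Kq: "K *s C q2 = cis eta *s C q1 - A (C q1)" by simp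
  define k1 where "k1 = inverse (2 * \<i> * sin x1 * cis x2 * (cnj g / n1))"
  define v0 where "v0 = (of_real m - cis xi) *s p2 + \<i> *s T p2"
  have p1v: "p1 = k1 *s v0"
    unfolding v0_def k1_def xi_def by (subst p1_from_p2, subst A_T) (simp add: vec_eq_iff algebra_simps)
  define sg dl where "sg = (eta + xi) / 2" and "dl = (eta - xi) / 2"
  define ee ff where "ee = 2 * cos sg - 2 * m * cos dl" and "ff = 2 * sin dl"
  define y where "y = of_real ee *s p2 + of_real ff *s T p2"
  \<comment> \<open>The crux: \<open>cis eta - A\<close> carries \<open>v0\<close>, a multiple of
    \<open>p1\<close>, to a common phase times a real combination of \<open>p2\<close> and
    \<open>T p2\<close>.\<close>
  have v0y: "cis eta *s v0 - A v0 = (- cis sg) *s y"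
  proof -
    have "cis eta *s v0 - A v0 = (cis eta - of_real m) *s v0 + \<i> *s T v0"
      unfolding A_T by (simp add: vec_eq_iff algebra_simps)
    also have "T v0 = (of_real m - cis xi) *s T p2 - (\<i> * of_real D) *s p2"
      unfolding v0_def T_add T_scale TT by (simp add: vec_eq_iff algebra_simps)
    also have "(cis eta - of_real m) *s v0 + \<i> *s ((of_real m - cis xi) *s T p2 - (\<i> * of_real D) *s p2)
        = (- (cis eta * cis xi + 1 - of_real m * (cis eta + cis xi))) *s p2 + (\<i> * (cis eta - cis xi)) *s T p2"
      unfolding v0_def by (simp add: D_def vec_eq_iff algebra_simps power2_eq_square)
    also have "\<dots> = (- cis sg) *s y"
      unfolding cis_half_sum sg_def[symmetric] dl_def[symmetric] y_def ee_def ff_def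
      by (simp add: vec_eq_iff algebra_simps)
    finally show ?thesis .
  qed
  have Ty: "T y = (- of_real (ff * D)) *s p2 + of_real ee *s T p2"
    unfolding y_def T_add T_scale TT by (simp add: vec_eq_iff algebra_simps)
  have AT: "A (T x) = T (A x)" for x by (simp add: T_def A_scale A_diff)
  \<comment> \<open>Up to the factor \<open>l\<close>, \<open>Z\<close> takes \<open>p1\<close> to
    \<open>C q1\<close>. It commutes with \<open>A\<close> and, since \<open>T\<close> has real
    square \<open>- D\<close> on \<open>W\<close>, preserves the real plane of \<open>p2\<close> and
    \<open>T p2\<close>; hence \<open>C q2\<close> lies on the second geodesic.\<close>
  define Z where "Z v = of_real a1 *s v + of_real b1 *s T v" for v
  have ZA: "cis eta *s Z v - A (Z v) = Z (cis eta *s v - A v)" for v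
  proof -
    have Td: "T (x - y) = T x - T y" for x y using T_add[of "x - y" y] by (simp add: algebra_simps)
    show ?thesis by (simp add: Z_def A_add A_scale AT Td T_scale vec_eq_iff algebra_simps)
  qed
  have Zs: "Z (z *s v) = z *s Z v" for z v by (simp add: Z_def T_scale vec_eq_iff algebra_simps)
  have "K *s C q2 = l *s (cis eta *s Z p1 - A (Z p1))"
    unfolding Kq Cq1 Z_def[symmetric] A_scale by (simp add: vec_eq_iff algebra_simps)
  also have "\<dots> = l *s Z (cis eta *s p1 - A p1)" unfolding ZA ..
  also have "cis eta *s p1 - A p1 = k1 *s (cis eta *s v0 - A v0)"
    by (subst (1 2) p1v) (simp add: A_scale vec_eq_iff algebra_simps)
  finally have "K *s C q2 = (l * k1 * (- cis sg)) *s Z y"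
    unfolding v0y Zs by (simp add: vector_smult_assoc mult.assoc)
  then have "inverse K *s (K *s C q2) = inverse K *s ((l * k1 * (- cis sg)) *s Z y)" by simp
  then have "C q2 = (inverse K * (l * k1 * (- cis sg))) *s Z y" using K0 by (simp add: vector_smult_assoc)
  also have "Z y = of_real (a1 * ee - b1 * ff * D) *s p2 + of_real (a1 * ff + b1 * ee) *s T p2"
    unfolding Z_def Ty unfolding y_def by (simp add: vec_eq_iff algebra_simps)
  finally have Cq2: "C q2 = (inverse K * (l * k1 * (- cis sg))) *s
      (of_real (a1 * ee - b1 * ff * D) *s p2 + of_real (a1 * ff + b1 * ee) *s T p2)" .
  have "elementary_relation h (P1, P2, \<alpha>1, \<alpha>2) (abs_pv (C q1), abs_pv (C q2), \<beta>1, \<beta>2)"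
    by (rule elementary_f_bending[OF ne r bend(2) e' k c _ _ Cq1 Cq2]) (use s in \<open>simp_all add: Ciso\<close>)
  then show ?thesis using bend(1) by blast
qed

text \<open>A nonisotropic eigenvector \<open>e\<close>, the vector \<open>f\<close> of
  \<open>W\<close> orthogonal to it and the polar vector \<open>c\<close> form an orthogonal
  eigenbasis. Equal eigenvalues on \<open>W\<close> would make \<open>A\<close> scalar there,
  against \<open>A_p1\<close>, and \<open>cos_sum_ne\<close> separates \<open>kap\<close> from both.
  So the product also arises from centres on the line of \<open>c\<close> and \<open>e\<close>,
  where the parameters multiply to the eigenvalue \<open>l2\<close> of \<open>f\<close>.\<close>

lemma elliptic_third:
  assumes "\<not> ne"
  shows "\<exists>z1 z2 \<gamma>1 \<gamma>2. quad z1 z2 \<gamma>1 \<gamma>2 \<and> \<gamma>1 * \<gamma>2 \<noteq> kap \<and> (\<forall>x. rf \<gamma>2 z2 (rf \<gamma>1 z1 x) = R x)"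
proof -
  obtain e l1 where e: "e \<in> W" "R e = l1 *s e" "h e e \<noteq> 0" using assms unfolding ne_def by blast
  obtain c where c: "h c c \<noteq> 0" "\<And>x. x \<in> W \<longleftrightarrow> h x c = 0" "R c = kap *s c" by (rule polar) blast
  obtain r s where rs: "e = r *s p1 + s *s p2" using e(1) by (auto simp: in_W)
  have g2: "gram e p2 = r * cnj r * gram p1 p2" "gram e p1 = s * cnj s * gram p1 p2"
    unfolding rs by (simp_all add: gram_def h_simps algebra_simps)
  obtain p where p: "p \<in> W" "gram e p \<noteq> 0"
  proof (cases "r = 0")
    case True
    then have "s \<noteq> 0" using rs e by auto
    then show ?thesis using that[of p1] g2 nonzero p_in_W by simp
  next
    case False
    then show ?thesis using that[of p2] g2 nonzero p_in_W by simp
  qed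
  define f where "f = orthocomp e p"
  have f: "h f e = 0" "h e f = 0" "h f f \<noteq> 0"
    using orthocomp[OF e(3), of p] p e by (simp_all add: f_def)
  have fW: "f \<in> W" unfolding f_def orthocomp_def using p e by (intro vec.span_diff vec.span_scale)
  have oc: "h e c = 0" "h f c = 0" "h c e = 0" "h c f = 0"
    using e fW c(2) h_eq_0_commute by blast+
  have unit: "cmod l = 1" if "R x = l *s x" "h x x \<noteq> 0" for l x
  proof -
    have "(l * cnj l) * h x x = h x x" 
      using R_isometry[of x x] unfolding that(1) by (simp add: h_simps mult_ac)
    then have "l * cnj l = 1" using that(2) by (simp only: mult_cancel_right2 simp_thms)
    then have "complex_of_real ((cmod l)\<^sup>2) = 1" by (simp only: complex_norm_square)
    then have "(cmod l)\<^sup>2 = 1" by (simp only: of_real_eq_1_iff)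
    then show ?thesis by (simp add: abs_square_eq_1)
  qed
  have l1: "cmod l1 = 1" using unit e by blast
  then have l10: "l1 \<noteq> 0" by auto
  have "cnj l1 * h (R f) e = 0" using R_isometry[of f e] unfolding e(2) h_scale_right f(1) .
  then have Rfe: "h (R f) e = 0" using l10 by simp
  have Rfc: "h (R f) c = 0" using R_W[OF fW] c(2) by blast
  define l2 where "l2 = h (R f) f / h f f"
  have Rf: "R f = l2 *s f"
    using orthogonal_expansion[of e f c "R f"] e f c oc by (simp add: Rfe Rfc l2_def)
  have l2: "cmod l2 = 1" using unit Rf f by blast
  have root: "(l / u)\<^sup>2 - of_real (2 * m) * (l / u) + 1 = 0" if "R x = l *s x" "x \<in> W" "x \<noteq> 0" for l x
  proof -
    have Ax: "A x = (l / u) *s x" unfolding A_def that(1) by (simp add: vector_smult_assoc divide_inverse mult.commute)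
    have "((l / u)\<^sup>2 - of_real (2 * m) * (l / u) + 1) *s x = 0"
      using A_A[OF that(2)] unfolding Ax A_scale unfolding Ax by (simp add: vec_eq_iff power2_eq_square algebra_simps)
    then show ?thesis using that(3) by (simp only: vector_mul_eq_0) simp
  qed
  have e0: "e \<noteq> 0" "f \<noteq> 0" using e f by auto
  note r1 = root[OF e(2,1) e0(1)] and r2 = root[OF Rf fW e0(2)]
  have l12: "l1 \<noteq> l2"
  proof
    assume eq: "l1 = l2"
    have "h p1 c = 0" using p_in_W c(2) by blast
    then have p1e: "p1 = (h p1 e / h e e) *s e + (h p1 f / h f f) *s f"
      using orthogonal_expansion[of e f c p1] e f c oc by simp
    have "R p1 = l1 *s p1"
      by (subst (1 2) p1e) (simp add: R_add R_scale e(2) Rf eq vec_eq_iff algebra_simps)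
    then have "A p1 = (inverse u * l1) *s p1" by (simp add: A_def vector_smult_assoc)
    then have "(2 * \<i> * sin x2 * cis (- x1) * (g / n2)) *s p2 = (cis (x2 - x1) - inverse u * l1) *s p1"
      unfolding A_p1 by (simp add: vec_eq_iff algebra_simps)
    moreover define kk where "kk = 2 * \<i> * sin x2 * cis (- x1) * (g / n2)"
    moreover have "kk \<noteq> 0" using sin_pos nonzero by (simp add: kk_def)
    ultimately have "p2 = (inverse kk * (cis (x2 - x1) - inverse u * l1)) *s p1"
      by (metis (no_types, lifting) left_inverse vector_smult_assoc vector_smult_lid)
    then show False using gram_scale nonzero by metis
  qed
  have "(l1 / u - l2 / u) * (l1 / u + l2 / u - of_real (2 * m)) = 0"
    using r1 r2 by algebra
  then have sum: "l1 / u + l2 / u = of_real (2 * m)" using l12 kap_u_nz by simp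
  have "(l1 / u) * (l2 / u) = 1" using r1 unfolding sum[symmetric] by algebra
  then have "l1 * l2 = u\<^sup>2" using kap_u_nz by (simp add: power2_eq_square field_simps)
  then have prod: "kap * l1 * l2 = 1" using u_square_kap by (metis mult.assoc mult.commute)
  have nk: "l \<noteq> kap" if "(l / u)\<^sup>2 - of_real (2 * m) * (l / u) + 1 = 0" for l
  proof
    assume "l = kap"
    then have "l / u = cis (x1 + x2)" using kap_u kap_u_nz by simp
    then have "(cis (x1 + x2))\<^sup>2 - of_real (2 * m) * cis (x1 + x2) + 1 = 0" using that by simp
    moreover have "(cis (x1 + x2))\<^sup>2 + 1 = cis (x1 + x2) * of_real (2 * cos (x1 + x2))"
    proof -
      have "of_real (2 * cos y) = cis y + cis (- y)" for y by (simp add: complex_eq_iff)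
      from this[of "x1 + x2"] show ?thesis by (simp only: distrib_left cis_mult power2_eq_square) simp
    qed
    ultimately have "cis (x1 + x2) * of_real (2 * (cos (x1 + x2) - m)) = 0" by (simp add: algebra_simps)
    then show False using cos_sum_ne by simp
  qed
  have "\<exists>z1 z2 \<gamma>1 \<gamma>2. quad z1 z2 \<gamma>1 \<gamma>2 \<and> \<gamma>1 * \<gamma>2 = l2 \<and>
    rf \<gamma>2 z2 (rf \<gamma>1 z1 c) = kap *s c \<and> rf \<gamma>2 z2 (rf \<gamma>1 z1 e) = l1 *s e \<and> rf \<gamma>2 z2 (rf \<gamma>1 z1 f) = l2 *s f"
    by (rule diagonal_product) (use c e f oc cmod_kap l1 l2 l12 nk[OF r1] nk[OF r2] prod in auto)
  then obtain z1 z2 \<gamma>1 \<gamma>2 where z: "quad z1 z2 \<gamma>1 \<gamma>2" "\<gamma>1 * \<gamma>2 = l2"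
    "rf \<gamma>2 z2 (rf \<gamma>1 z1 c) = kap *s c" "rf \<gamma>2 z2 (rf \<gamma>1 z1 e) = l1 *s e" "rf \<gamma>2 z2 (rf \<gamma>1 z1 f) = l2 *s f"
    by blast
  have "rf \<gamma>2 z2 (rf \<gamma>1 z1 x) = R x" for x
  proof -
    have x: "x = (h x e / h e e) *s e + (h x f / h f f) *s f + (h x c / h c c) *s c"
      by (rule orthogonal_expansion) (use e f c oc in auto)
    show ?thesis
      by (subst (1 2) x) (simp only: rf_add rf_scale z(3-5) R_add R_scale e(2) Rf c(3))
  qed
  then show ?thesis using z nk[OF r2] by blast
qed

end

section \<open>Chains of relations between quadruples of equal signs\<close>

lemma symclp_rtranclp_sym: "(symclp r)\<^sup>*\<^sup>* x y \<Longrightarrow> (symclp r)\<^sup>*\<^sup>* y x"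
proof (induction rule: rtranclp_induct)
  case (step y z)
  then have "symclp r z y" by (auto simp: symclp_def)
  then show ?case using step.IH by (rule converse_rtranclp_into_rtranclp)
qed simp

lemma symclp_rtranclpI: "r x y \<Longrightarrow> (symclp r)\<^sup>*\<^sup>* x y" "r x y \<Longrightarrow> (symclp r)\<^sup>*\<^sup>* y x"
  by (simp_all add: r_into_rtranclp symclpI1 symclpI2)

lemma rtranclp_symclp_mono: "r\<^sup>*\<^sup>* x y \<Longrightarrow> (symclp r)\<^sup>*\<^sup>* x y"
  by (rule mono_rtranclp[rule_format]) (auto intro: symclpI1)

context hform
begin

text \<open>Restates \<open>config.ne\<close> through the product and \<open>kap\<close> alone, with
  the line given as a range, so that it passes from one quadruple to any other with the same
  data.\<close>

definition nonelliptic :: "(complex ^ 3 \<Rightarrow> complex ^ 3) \<Rightarrow> complex \<Rightarrow> bool" where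
  "nonelliptic F k \<longleftrightarrow> (\<forall>x c. x \<in> range (\<lambda>y. F y - k *s y) \<longrightarrow> F x = c *s x \<longrightarrow> h x x = 0)"

lemma rf_rep_abs: "p \<noteq> 0 \<Longrightarrow> rf \<alpha> (rep_pv (abs_pv p)) = rf \<alpha> p"
  using refl_iso_rep refl_iso_rf by metis

lemma sgn_rep_abs: "p \<noteq> 0 \<Longrightarrow> sgn (Re (h (rep_pv (abs_pv p)) (rep_pv (abs_pv p)))) = sgn (Re (h p p))"
  using sig_abs_pv[OF herm] by (simp add: sig_def)

text \<open>\<open>connect_core\<close> needs the chosen representatives of the first pair and
  parameters in matching components; the former are substituted, and a change of components by
  \<open>z\<close> on the second pair achieves the latter.\<close>

lemma connect_same_signs:
  assumes P: "quad p1 p2 \<alpha>1 \<alpha>2" and Q: "quad q1 q2 \<beta>1 \<beta>2"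
    and F: "\<And>x. rf \<alpha>2 p2 (rf \<alpha>1 p1 x) = F x" "\<And>x. rf \<beta>2 q2 (rf \<beta>1 q1 x) = F x"
    and k: "\<alpha>1 * \<alpha>2 = k" "\<beta>1 * \<beta>2 = k" and ne: "nonelliptic F k"
    and S: "ang \<alpha>1 + ang \<alpha>2 = ang \<beta>1 + ang \<beta>2"
    and s: "sgn (Re (h p1 p1)) = sgn (Re (h q1 q1))" "sgn (Re (h p2 p2)) = sgn (Re (h q2 q2))"
  shows "(symclp (elementary_relation h))\<^sup>*\<^sup>* (abs_pv p1, abs_pv p2, \<alpha>1, \<alpha>2) (abs_pv q1, abs_pv q2, \<beta>1, \<beta>2)"
proof -
  note dp = quadD[OF P] and dq = quadD[OF Q]
  define v1 v2 where "v1 = rep_pv (abs_pv p1)" and "v2 = rep_pv (abs_pv p2)"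
  have V: "quad v1 v2 \<alpha>1 \<alpha>2"
    using P is_quadruple_iff[OF dp(1,2)] is_quadruple_rep by (simp add: v1_def v2_def)
  interpret V: config h v1 v2 \<alpha>1 \<alpha>2 by unfold_locales (rule V)
  have rv: "rf \<alpha> v1 = rf \<alpha> p1" "rf \<alpha> v2 = rf \<alpha> p2" for \<alpha>
    using rf_rep_abs dp by (simp_all add: v1_def v2_def)
  have VR: "V.R = F" by (rule ext) (simp add: V.R_def rv F)
  have Vk: "V.kap = k" by (simp add: V.kap_def k)
  have Vne: "V.ne" using ne unfolding V.ne_def nonelliptic_def V.W_eq_range VR Vk .
  obtain z where z: "z \<in> Omega" "same_component \<alpha>1 (z * \<beta>1)" "same_component \<alpha>2 (inverse z * \<beta>2)"
    using same_component_of_equal_sum[OF dp(7,8) dq(7,8) _ S] k by metis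
  have z': "inverse z \<in> Omega" "z \<noteq> 0" using z(1) by (auto simp: Omega_iff power_inverse)
  have sgn_pos: "x * y > 0" if "sgn x = sgn y" "x \<noteq> 0" for x y :: real
    using that by (auto simp: sgn_if zero_less_mult_iff split: if_splits)
  have sv: "V.n1 * Re (h q1 q1) > 0" "V.n2 * Re (h q2 q2) > 0"
  proof -
    have "sgn V.n1 = sgn (Re (h q1 q1))" "sgn V.n2 = sgn (Re (h q2 q2))"
      unfolding V.n1_def V.n2_def unfolding v1_def v2_def
      using s sgn_rep_abs[OF dp(1)] sgn_rep_abs[OF dp(2)] by simp_all
    then show "V.n1 * Re (h q1 q1) > 0" "V.n2 * Re (h q2 q2) > 0"
      using V.nonzero(1,2) sgn_pos by blast+
  qed
  have "\<exists>R. elementary_relation h (abs_pv q1, abs_pv q2, z * \<beta>1, inverse z * \<beta>2) R \<and>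
      elementary_relation h (abs_pv p1, abs_pv p2, \<alpha>1, \<alpha>2) R"
  proof (rule V.connect_core[OF Vne v1_def[symmetric] v2_def[symmetric] quad_Omega[OF Q z(1)] _ _ _ z(2,3) sv])
    show "rf (inverse z * \<beta>2) q2 (rf (z * \<beta>1) q1 x) = V.R x" for x
      unfolding product_Omega[OF z(1)] VR by (rule F)
    show "z * \<beta>1 * (inverse z * \<beta>2) = V.kap" using z' by (simp add: Vk k(2)[symmetric])
    show "ang (z * \<beta>1) + ang (inverse z * \<beta>2) = ang \<alpha>1 + ang \<alpha>2"
      using S by (simp add: ang_Omega_mult z z')
  qed
  then have "(symclp (elementary_relation h))\<^sup>*\<^sup>* (abs_pv p1, abs_pv p2, \<alpha>1, \<alpha>2) (abs_pv q1, abs_pv q2, z * \<beta>1, inverse z * \<beta>2)"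
    by (meson rtranclp_trans symclp_rtranclpI)
  moreover have "(symclp (elementary_relation h))\<^sup>*\<^sup>* (abs_pv q1, abs_pv q2, \<beta>1, \<beta>2) (abs_pv q1, abs_pv q2, z * \<beta>1, inverse z * \<beta>2)"
    by (rule rtranclp_symclp_mono[OF elementary_change_components[OF Q z(1)]])
  ultimately show ?thesis by (meson rtranclp_trans symclp_rtranclp_sym)
qed

end

section \<open>Comparing and reversing the signs of the points\<close>

context config
begin

lemma ne_iff: "ne \<longleftrightarrow> nonelliptic R kap"
  unfolding ne_def nonelliptic_def W_eq_range ..

text \<open>With \<open>s\<^sup>2 = m\<^sup>2 - 1\<close>, the vector
  \<open>T p1 + \<i> s p1\<close> is an eigenvector of \<open>T\<close>, hence a nonzero isotropic
  vector of \<open>W\<close>. It is orthogonal to \<open>c\<close>, which therefore cannot be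
  negative.\<close>

lemma polar_positive:
  assumes ne and c: "h c c \<noteq> 0" "\<And>x. x \<in> W \<longleftrightarrow> h x c = 0"
  shows "Re (h c c) > 0"
proof (rule ccontr)
  assume "\<not> ?thesis"
  then have neg: "Re (h c c) < 0" using c(1) Re_h_self_eq_0[of c] by linarith
  define s where "s = sqrt (m\<^sup>2 - 1)"
  have "s * s = m\<^sup>2 - 1" using m_ge_1[OF assms(1)] by (simp add: s_def)
  then have s: "complex_of_real s * of_real s = of_real (m\<^sup>2 - 1)" by (metis of_real_mult)
  define v where "v = T p1 + (\<i> * of_real s) *s p1"
  have vW: "v \<in> W" unfolding v_def by (intro vec.span_add vec.span_scale T_W p_in_W)
  have "(\<i> * of_real s) *s v = (\<i> * of_real s) *s T p1 - (of_real s * of_real s) *s p1"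
    unfolding v_def by (simp add: vec_eq_iff algebra_simps)
  also have "\<dots> = T v" unfolding s v_def T_add T_scale T_T[OF p_in_W(1)] by (simp add: vec_eq_iff algebra_simps)
  finally have "h v v = 0" using ne_T[OF assms(1) vW] by metis
  moreover have "v \<noteq> 0"
  proof
    assume "v = 0"
    then have "(\<i> * of_real s) *s p1 + 1 *s T p1 = 0" by (simp add: v_def add.commute)
    then show False using indepD[OF indep_T[OF assms(1) p_in_W(1) nonzero(4)]] by fastforce
  qed
  moreover have "h v c = 0" using vW c(2) by blast
  ultimately show False using orthogonal_to_negative[OF neg] by fastforce
qed

text \<open>The \<open>W\<close>-component of an eigenvector satisfies the same eigenvalue equation
  and is therefore isotropic, while the polar component is nonnegative. So no fixed point is
  negative.\<close>

lemma not_regular_elliptic: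
  assumes ne
  shows "\<not> regular_elliptic h R"
proof
  assume "regular_elliptic h R"
  then obtain P where P: "fixed_point R P" "sig h P = -1" unfolding regular_elliptic_def by blast
  obtain l where l: "R (rep_pv P) = l *s rep_pv P" using P(1) by (auto simp: fixed_point_def)
  have neg: "Re (h (rep_pv P) (rep_pv P)) < 0" using P(2) by (simp add: sig_def sgn_if split: if_splits)
  obtain c where c: "h c c \<noteq> 0" "\<And>x. x \<in> W \<longleftrightarrow> h x c = 0" "R c = kap *s c" by (rule polar) blast
  obtain y z where yz: "rep_pv P = y + z *s c" "y \<in> W" using W_split[OF c(1,2)] by blast
  have yc: "h y c = 0" "h c y = 0" using yz(2) c(2) h_eq_0_commute by blast+
  have e: "R y + (z * kap) *s c = l *s y + (l * z) *s c"
    using l unfolding yz(1) R_add R_scale c(3) by (simp add: vec_eq_iff algebra_simps)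
  have Ryc: "h (R y) c = 0" using R_W[OF yz(2)] c(2) by blast
  have "h (R y + (z * kap) *s c) c = h (l *s y + (l * z) *s c) c" using e by simp
  then have "z * kap * h c c = l * z * h c c" by (simp add: h_simps yc Ryc)
  then have zl: "z * kap = l * z" using c(1) by (simp only: mult_cancel_right simp_thms)
  have "R y = l *s y" using e unfolding zl by (simp only: add_right_cancel)
  then have yy: "h y y = 0" using assms yz(2) unfolding ne_def by blast
  have "h (rep_pv P) (rep_pv P) = (z * cnj z) * h c c" unfolding yz(1) by (simp add: h_simps yc yy)
  also have "\<dots> = of_real ((cmod z)\<^sup>2) * h c c" by (simp only: complex_norm_square)
  finally have "Re (h (rep_pv P) (rep_pv P)) = (cmod z)\<^sup>2 * Re (h c c)" by simp
  moreover have "(cmod z)\<^sup>2 * Re (h c c) \<ge> 0" using polar_positive[OF assms c(1,2)] by simp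
  ultimately show False using neg by linarith
qed

text \<open>
  On the line of \<open>p\<^sub>1\<close> and \<open>p\<^sub>2\<close> the operator \<open>T\<close> multiplies the form by \<open>1 - m\<^sup>2\<close>, and it commutes with
  the product. For \<open>m\<^sup>2 > 1\<close> it therefore reverses all signs.
\<close>

lemma elementary_simultaneous:
  assumes ne and m: "m\<^sup>2 > 1"
  shows "quad (T p1) (T p2) \<alpha>1 \<alpha>2" "\<And>x. rf \<alpha>2 (T p2) (rf \<alpha>1 (T p1) x) = R x"
    "elementary_relation h (abs_pv p1, abs_pv p2, \<alpha>1, \<alpha>2) (abs_pv (T p1), abs_pv (T p2), \<alpha>1, \<alpha>2)"
    "sgn (Re (h (T p1) (T p1))) = - sgn n1" "sgn (Re (h (T p2) (T p2))) = - sgn n2"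
proof -
  define k where "k = 1 - m\<^sup>2"
  have "k < 0" using m by (simp add: k_def)
  then have k: "k < 0" "complex_of_real k \<noteq> 0" by simp_all
  have hT: "h (T x) (T y) = of_real k * h x y" if "x \<in> W" "y \<in> W" for x y
    using h_T_T[OF that] by (simp add: k_def)
  note h4 = hT[OF p_in_W(1,1)] hT[OF p_in_W(2,2)] hT[OF p_in_W] hT[OF p_in_W(2,1)]
  have gr: "gram (T p1) (T p2) = of_real (k * k) * gram p1 p2"
    unfolding gram_def h4 by (simp add: algebra_simps)
  show q: "quad (T p1) (T p2) \<alpha>1 \<alpha>2"
    unfolding quad_def gr h4 using k quad by (auto simp: quad_def)
  have conj: "rf \<alpha> (T p) (T y) = T (rf \<alpha> p y)" if "p \<in> W" "y \<in> W" for \<alpha> p y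
    using k by (simp add: rf_def hT that T_add T_scale)
  obtain c where c: "h c c \<noteq> 0" "\<And>x. x \<in> W \<longleftrightarrow> h x c = 0" "R c = kap *s c" by (rule polar) blast
  have rW: "rf \<alpha>1 p1 y \<in> W" if "y \<in> W" for y
    unfolding rf_def using that by (intro vec.span_add vec.span_scale p_in_W)
  show e: "rf \<alpha>2 (T p2) (rf \<alpha>1 (T p1) x) = R x" for x
  proof -
    obtain y z where yz: "x = y + z *s c" "y \<in> W" using W_split[OF c(1,2)] by blast
    \<comment> \<open>The square of \<open>T\<close> is the nonzero scalar \<open>k\<close> on
      \<open>W\<close>, so every \<open>y\<close> in \<open>W\<close> is a value of \<open>T\<close>
      there and \<open>conj\<close> applies to it.\<close>
    have "T (inverse (of_real k) *s T y) = (inverse (of_real k) * of_real k) *s y"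
      unfolding T_scale T_T[OF yz(2), folded k_def] by (simp only: vector_smult_assoc)
    then have y: "y = T (inverse (of_real k) *s T y)" using k by simp
    have W': "inverse (of_real k) *s T y \<in> W" using yz(2) by (intro vec.span_scale T_W)
    have "rf \<alpha>2 (T p2) (rf \<alpha>1 (T p1) (T (inverse (of_real k) *s T y))) = T (R (inverse (of_real k) *s T y))"
      unfolding conj[OF p_in_W(1) W'] conj[OF p_in_W(2) rW[OF W']] by (simp add: R_def)
    also have "\<dots> = R (T (inverse (of_real k) *s T y))" by (rule T_R)
    finally have 1: "rf \<alpha>2 (T p2) (rf \<alpha>1 (T p1) y) = R y" unfolding y[symmetric] .
    have "h c (T p1) = 0" "h c (T p2) = 0" using c(2) T_W p_in_W h_eq_0_commute by blast+
    then have 2: "rf \<alpha>2 (T p2) (rf \<alpha>1 (T p1) c) = R c"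
      by (simp add: rf_orthogonal rf_scale vector_smult_assoc c(3) kap_def mult.commute)
    show ?thesis unfolding yz(1) rf_add rf_scale R_add R_scale 1 2 ..
  qed
  have sg: "Re (h (T p1) (T p1)) = k * n1" "Re (h (T p2) (T p2)) = k * n2"
    unfolding h4 by (simp_all add: n1_def n2_def)
  then show s1: "sgn (Re (h (T p1) (T p1))) = - sgn n1" and s2: "sgn (Re (h (T p2) (T p2))) = - sgn n2"
    using k(1) by (simp_all add: sgn_mult)
  note d = quadD[OF q]
  have Rp: "product h (abs_pv p1, abs_pv p2, \<alpha>1, \<alpha>2) = R"
    unfolding product_abs[OF nonzero(8,9)] by (simp add: R_def fun_eq_iff)
  have ta: "tance h (abs_pv p1) (abs_pv p2) = tance h (abs_pv (T p1)) (abs_pv (T p2))"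
    unfolding tance_abs_pv[OF herm nonzero(8,9)] tance_abs_pv[OF herm d(1,2)] h4 using k(2) by simp
  have "simultaneous_sign_change h (abs_pv p1, abs_pv p2, \<alpha>1, \<alpha>2) (abs_pv (T p1), abs_pv (T p2), \<alpha>1, \<alpha>2)"
    unfolding simultaneous_sign_change_def prod.case Rp
    using not_regular_elliptic[OF assms(1)] ta s1 s2
    by (simp add: sig_abs_pv[OF herm] d nonzero n1_def n2_def)
  then show "elementary_relation h (abs_pv p1, abs_pv p2, \<alpha>1, \<alpha>2) (abs_pv (T p1), abs_pv (T p2), \<alpha>1, \<alpha>2)"
    by (intro elementary_relationI quad q) (simp_all add: e R_def)
qed

text \<open>For \<open>m = -1\<close>, \<open>h_T_p1\<close> contains
  \<open>cos x1 + cos x2\<close>, which is twice the product of the cosines of the half sum and the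
  half difference. The latter cosine is positive, so the former carries the sign.\<close>

lemma parabolic_sign:
  assumes ne and m: "m = -1"
  shows "n1 * Re (h (T p1) p1) * cos ((x1 + x2) / 2) > 0"
proof -
  have "cos (x1 + x2) \<noteq> -1" using cos_sum_ne m by simp
  moreover have "cos (x1 + x2) = 2 * (cos ((x1 + x2) / 2))\<^sup>2 - 1"
  proof -
    have "2 * (y / 2) = y" for y :: real by simp
    from this[of "x1 + x2"] show ?thesis using cos_double_cos[of "(x1 + x2) / 2"] by (simp only:)
  qed
  ultimately have c0: "cos ((x1 + x2) / 2) \<noteq> 0" by auto
  have "cos ((x1 - x2) / 2) > 0"
    using ang(1,2)[OF par(1)] ang(1,2)[OF par(2)] by (intro cos_gt_zero_pi) auto
  then have p: "2 * cos ((x1 - x2) / 2) * (n1 * cos ((x1 + x2) / 2))\<^sup>2 > 0" using c0 nonzero by simp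
  have "sin x1 * Re (h (T p1) p1) = n1 * (2 * cos ((x1 + x2) / 2) * cos ((x1 - x2) / 2))"
    using h_T_p1 cos_sum_half[of x1 x2] by (simp add: m add.commute)
  then have eq: "sin x1 * Re (h (T p1) p1) * (n1 * cos ((x1 + x2) / 2)) =
      n1 * (2 * cos ((x1 + x2) / 2) * cos ((x1 - x2) / 2)) * (n1 * cos ((x1 + x2) / 2))" by (simp only:)
  have "sin x1 * (n1 * Re (h (T p1) p1) * cos ((x1 + x2) / 2)) =
      sin x1 * Re (h (T p1) p1) * (n1 * cos ((x1 + x2) / 2))" by (simp only: mult_ac)
  also have "\<dots> = 2 * cos ((x1 - x2) / 2) * (n1 * cos ((x1 + x2) / 2))\<^sup>2"
    unfolding eq by (simp only: power2_eq_square mult_ac)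
  finally have "sin x1 * (n1 * Re (h (T p1) p1) * cos ((x1 + x2) / 2))
      = 2 * cos ((x1 - x2) / 2) * (n1 * cos ((x1 + x2) / 2))\<^sup>2" .
  then have "sin x1 * (n1 * Re (h (T p1) p1) * cos ((x1 + x2) / 2)) > 0" using p by simp
  then show ?thesis using sin_pos(1) by (simp only: zero_less_mult_iff) auto
qed

end

context hform
begin

text \<open>\<open>T\<close> is nilpotent on \<open>W\<close>, so \<open>h (T q1) q1\<close> is a
  nonnegative multiple of \<open>h (T p1) p1\<close>. With the common angle sum,
  \<open>parabolic_sign\<close> for both pairs forces equal signs of \<open>p1\<close> and
  \<open>q1\<close>.\<close>

lemma parabolic_same_sign:
  assumes P: "config h p1 p2 \<alpha>1 \<alpha>2" and Q: "config h q1 q2 \<beta>1 \<beta>2"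
    and e: "\<And>x. rf \<beta>2 q2 (rf \<beta>1 q1 x) = config.R h p1 p2 \<alpha>1 \<alpha>2 x" and k: "\<beta>1 * \<beta>2 = \<alpha>1 * \<alpha>2"
    and S: "ang \<beta>1 + ang \<beta>2 = ang \<alpha>1 + ang \<alpha>2" and ne: "config.ne h p1 p2 \<alpha>1 \<alpha>2"
    and m: "config.m h p1 p2 \<alpha>1 \<alpha>2 = -1"
  shows "Re (h p1 p1) * Re (h q1 q1) > 0"
proof -
  interpret P: config h p1 p2 \<alpha>1 \<alpha>2 by (rule P)
  interpret Q: config h q1 q2 \<beta>1 \<beta>2 by (rule Q)
  note sd = P.same_data[OF Q e, unfolded P.kap_def, OF k]
  have Qne: "Q.ne" using ne unfolding P.ne_iff Q.ne_iff sd(1) sd(2)[unfolded P.kap_def] by (simp add: P.kap_def)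
  have QT: "Q.T = P.T" "Q.m = -1" using sd(5,6)[OF S] m by simp_all
  have q1W: "q1 \<in> P.W" unfolding sd(3)[symmetric] by (rule Q.p_in_W)
  obtain a b where ab: "q1 = a *s p1 + b *s P.T p1" using P.W_span_T[OF q1W] by blast
  have TT: "P.T (P.T p1) = 0" unfolding P.T_T[OF P.p_in_W(1)] m by (simp add: vec_eq_iff)
  have "P.T q1 = a *s P.T p1" unfolding ab P.T_add P.T_scale TT by simp
  moreover have "h (P.T p1) (P.T p1) = 0" unfolding P.h_T_T[OF P.p_in_W(1,1)] m by simp
  ultimately have "h (P.T q1) q1 = (a * cnj a) * h (P.T p1) p1" unfolding ab by (simp add: h_simps)
  also have "\<dots> = of_real ((cmod a)\<^sup>2) * h (P.T p1) p1" by (simp only: complex_norm_square)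
  finally have r: "Re (h (P.T q1) q1) = (cmod a)\<^sup>2 * Re (h (P.T p1) p1)" by simp
  define x y c where "x = Re (h (P.T p1) p1)" and "y = (cmod a)\<^sup>2" and "c = cos ((ang \<alpha>1 + ang \<alpha>2) / 2)"
  have 1: "Re (h p1 p1) * x * c > 0" using P.parabolic_sign[OF ne m] by (simp add: P.n1_def x_def c_def)
  have 2: "Re (h q1 q1) * (y * x) * c > 0"
    using Q.parabolic_sign[OF Qne QT(2)] unfolding QT(1) r S by (simp add: Q.n1_def x_def y_def c_def)
  have y: "y \<ge> 0" by (simp add: y_def)
  have "(Re (h p1 p1) * x * c) * (Re (h q1 q1) * (y * x) * c) > 0" using 1 2 by (rule mult_pos_pos)
  also have "(Re (h p1 p1) * x * c) * (Re (h q1 q1) * (y * x) * c) = (y * (x * c)\<^sup>2) * (Re (h p1 p1) * Re (h q1 q1))"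
    by (simp add: power2_eq_square mult_ac)
  finally have "(y * (x * c)\<^sup>2) * (Re (h p1 p1) * Re (h q1 q1)) > 0" .
  moreover have "y * (x * c)\<^sup>2 \<ge> 0" using y by simp
  ultimately show ?thesis by (auto simp only: zero_less_mult_iff[of "y * (x * c)\<^sup>2"])
qed

lemma elementary_orthogonal:
  assumes "quad p1 p2 \<alpha>1 \<alpha>2" "quad q1 q2 \<beta>1 \<beta>2" "\<alpha>1 * \<alpha>2 \<noteq> \<beta>1 * \<beta>2"
    and "\<And>x. rf \<alpha>2 p2 (rf \<alpha>1 p1 x) = rf \<beta>2 q2 (rf \<beta>1 q1 x)"
  shows "elementary_relation h (abs_pv p1, abs_pv p2, \<alpha>1, \<alpha>2) (abs_pv q1, abs_pv q2, \<beta>1, \<beta>2)"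
  by (rule elementary_relationI[OF assms(1,2,4)], intro disjI2)
    (use assms(3) in \<open>simp add: orthogonal_relation_def\<close>)

lemma equal_products_connected:
  assumes P: "quad p1 p2 \<alpha>1 \<alpha>2" and Q: "quad q1 q2 \<beta>1 \<beta>2"
    and e: "\<And>x. rf \<beta>2 q2 (rf \<beta>1 q1 x) = rf \<alpha>2 p2 (rf \<alpha>1 p1 x)"
  shows "(symclp (elementary_relation h))\<^sup>*\<^sup>* (abs_pv p1, abs_pv p2, \<alpha>1, \<alpha>2) (abs_pv q1, abs_pv q2, \<beta>1, \<beta>2)"
proof (cases "\<alpha>1 * \<alpha>2 = \<beta>1 * \<beta>2")
  case False
  have "elementary_relation h (abs_pv p1, abs_pv p2, \<alpha>1, \<alpha>2) (abs_pv q1, abs_pv q2, \<beta>1, \<beta>2)"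
    by (rule elementary_orthogonal[OF P Q False]) (rule e[symmetric])
  then show ?thesis by (rule symclp_rtranclpI)
next
  case True
  note dp = quadD[OF P] and dq = quadD[OF Q]
  have cP: "config h p1 p2 \<alpha>1 \<alpha>2" by unfold_locales (rule P)
  have cQ: "config h q1 q2 \<beta>1 \<beta>2" by unfold_locales (rule Q)
  interpret P: config h p1 p2 \<alpha>1 \<alpha>2 by (rule cP)
  interpret Q: config h q1 q2 \<beta>1 \<beta>2 by (rule cQ)
  have eR: "rf \<beta>2 q2 (rf \<beta>1 q1 x) = P.R x" for x by (simp add: e P.R_def)
  have k: "\<beta>1 * \<beta>2 = P.kap" using True by (simp add: P.kap_def)
  note sd = P.same_data[OF cQ eR k]
  show ?thesis
  proof (cases P.ne)
    case False
    obtain z1 z2 \<gamma>1 \<gamma>2 where z: "quad z1 z2 \<gamma>1 \<gamma>2" "\<gamma>1 * \<gamma>2 \<noteq> P.kap"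
      "\<And>x. rf \<gamma>2 z2 (rf \<gamma>1 z1 x) = P.R x" using P.elliptic_third[OF False] by blast
    have "elementary_relation h (abs_pv p1, abs_pv p2, \<alpha>1, \<alpha>2) (abs_pv z1, abs_pv z2, \<gamma>1, \<gamma>2)"
    proof (rule elementary_orthogonal[OF P z(1)])
      show "\<alpha>1 * \<alpha>2 \<noteq> \<gamma>1 * \<gamma>2" using z(2) unfolding P.kap_def by (rule not_sym)
      show "rf \<alpha>2 p2 (rf \<alpha>1 p1 x) = rf \<gamma>2 z2 (rf \<gamma>1 z1 x)" for x unfolding z(3) P.R_def ..
    qed
    moreover have "elementary_relation h (abs_pv q1, abs_pv q2, \<beta>1, \<beta>2) (abs_pv z1, abs_pv z2, \<gamma>1, \<gamma>2)"
    proof (rule elementary_orthogonal[OF Q z(1)])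
      show "\<beta>1 * \<beta>2 \<noteq> \<gamma>1 * \<gamma>2" using z(2) unfolding k by (rule not_sym)
      show "rf \<beta>2 q2 (rf \<beta>1 q1 x) = rf \<gamma>2 z2 (rf \<gamma>1 z1 x)" for x unfolding z(3) eR ..
    qed
    ultimately show ?thesis by (meson rtranclp_trans symclp_rtranclpI)
  next
    case ne: True
    have nel: "nonelliptic P.R P.kap" using ne P.ne_iff by simp
    have m1: "P.m\<^sup>2 \<ge> 1" using P.m_ge_1[OF ne] .
    then have "\<bar>1\<bar> \<le> \<bar>P.m\<bar>" by (simp only: abs_le_square_iff one_power2)
    then have m: "P.m \<le> -1 \<or> P.m \<ge> 1" by linarith
    have RP: "product h (abs_pv p1, abs_pv p2, \<alpha>1, \<alpha>2) = P.R"
      unfolding product_abs[OF dp(1,2)] by (simp add: P.R_def fun_eq_iff)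
    have RQ: "product h (abs_pv q1, abs_pv q2, \<beta>1, \<beta>2) = P.R"
      unfolding product_abs[OF dq(1,2)] by (simp add: eR fun_eq_iff)
    have gold: "goldman (trace (matrix P.R)) \<ge> 0" unfolding P.goldman_R using m1 by simp
    show ?thesis
    proof (cases "ang \<beta>1 + ang \<beta>2 = ang \<alpha>1 + ang \<alpha>2")
      case False
      then have "ang \<beta>1 + ang \<beta>2 = ang \<alpha>1 + ang \<alpha>2 + pi \<or> ang \<beta>1 + ang \<beta>2 = ang \<alpha>1 + ang \<alpha>2 - pi"
        using ang_sum_cases[OF dq(7,8) dp(7,8)] True by auto
      then have mQ: "Q.m = - P.m" using sd(7) by blast
      from m show ?thesis
      proof
        assume "P.m \<le> -1"
        then have "P.t > 1" "Q.t < 0" using P.tance_sign Q.tance_sign mQ by auto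
        then have "single_sign_change h (abs_pv p1, abs_pv p2, \<alpha>1, \<alpha>2) (abs_pv q1, abs_pv q2, \<beta>1, \<beta>2)"
          unfolding single_sign_change_def prod.case RP P.tance_eq Q.tance_eq
          using gold True False equal_sum_of_same_component[OF dp(7,8) dq(7,8) True] by auto
        then have "elementary_relation h (abs_pv p1, abs_pv p2, \<alpha>1, \<alpha>2) (abs_pv q1, abs_pv q2, \<beta>1, \<beta>2)"
          by (intro elementary_relationI[OF P Q]) (simp_all add: e)
        then show ?thesis by (rule symclp_rtranclpI)
      next
        assume "P.m \<ge> 1"
        then have "P.t < 0" "Q.t > 1" using P.tance_sign Q.tance_sign mQ by auto
        then have "single_sign_change h (abs_pv q1, abs_pv q2, \<beta>1, \<beta>2) (abs_pv p1, abs_pv p2, \<alpha>1, \<alpha>2)"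
          unfolding single_sign_change_def prod.case RQ P.tance_eq Q.tance_eq
          using gold True False equal_sum_of_same_component[OF dq(7,8) dp(7,8) True[symmetric]] by auto
        then have "elementary_relation h (abs_pv q1, abs_pv q2, \<beta>1, \<beta>2) (abs_pv p1, abs_pv p2, \<alpha>1, \<alpha>2)"
          by (intro elementary_relationI[OF Q P]) (simp_all add: e)
        then show ?thesis by (rule symclp_rtranclpI)
      qed
    next
      case S: True
      have mQ: "Q.m = P.m" using sd(5)[OF S] .
      have sg_eq: "sgn x = sgn y" if "x * y > 0" for x y :: real
        using that by (auto simp: zero_less_mult_iff)
      have sg_ne: "- sgn x = sgn y" if "x * y < 0" for x y :: real
        using that by (auto simp: mult_less_0_iff)
      \<comment> \<open>Since \<open>m\<close> determines whether the two signs within a pair agree,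
        comparing the first points of the two pairs decides the comparison of the second
        points.\<close>
      have nn: "P.n1 * P.n2 > 0 \<and> Q.n1 * Q.n2 > 0" if "P.m \<le> -1"
        using that mQ P.tance_sign(1) Q.tance_sign(1) P.sign_product(1) Q.sign_product(1) by auto
      have nn': "P.n1 * P.n2 < 0 \<and> Q.n1 * Q.n2 < 0" if "P.m \<ge> 1"
        using that mQ P.tance_sign(2) Q.tance_sign(2) P.sign_product(2) Q.sign_product(2) by auto
      show ?thesis
      proof (cases "P.n1 * Q.n1 > 0")
        case pos: True
        have "P.n2 * Q.n2 > 0" using m nn nn' pos by (auto simp: zero_less_mult_iff mult_less_0_iff)
        then show ?thesis
          using pos connect_same_signs[OF P Q _ eR _ k nel S[symmetric]] sg_eq
          by (simp add: P.R_def P.kap_def P.n1_def P.n2_def Q.n1_def Q.n2_def)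
      next
        case False
        then have neg: "P.n1 * Q.n1 < 0" using P.nonzero(1) Q.nonzero(1) by (simp add: not_less order_less_le)
        from m show ?thesis
        proof
          assume mm: "P.m \<ge> 1"
          \<comment> \<open>The signs within each pair are opposite, so interchanging the roles of
            \<open>p1\<close> and \<open>p2\<close> repairs the mismatch.\<close>
          note co = elementary_change_orientation[OF P]
          have s: "P.n2 * Q.n1 > 0" "P.n1 * Q.n2 > 0"
            using nn'[OF mm] neg by (auto simp: zero_less_mult_iff mult_less_0_iff)
          have "(symclp (elementary_relation h))\<^sup>*\<^sup>* (abs_pv p2, abs_pv (rf \<alpha>2 p2 p1), \<alpha>2, \<alpha>1) (abs_pv q1, abs_pv q2, \<beta>1, \<beta>2)"
          proof (rule connect_same_signs[OF co(1) Q _ eR _ k nel])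
            show "rf \<alpha>1 (rf \<alpha>2 p2 p1) (rf \<alpha>2 p2 x) = P.R x" for x unfolding co(2) P.R_def ..
            show "\<alpha>2 * \<alpha>1 = P.kap" by (simp add: P.kap_def mult.commute)
            show "ang \<alpha>2 + ang \<alpha>1 = ang \<beta>1 + ang \<beta>2" using S by simp
            show "sgn (Re (h p2 p2)) = sgn (Re (h q1 q1))" using sg_eq[OF s(1)] by (simp add: P.n2_def Q.n1_def)
            show "sgn (Re (h (rf \<alpha>2 p2 p1) (rf \<alpha>2 p2 p1))) = sgn (Re (h q2 q2))"
              using sg_eq[OF s(2)] by (simp add: co(4) P.n1_def Q.n2_def)
          qed
          moreover have "(symclp (elementary_relation h))\<^sup>*\<^sup>* (abs_pv p1, abs_pv p2, \<alpha>1, \<alpha>2)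
              (abs_pv p2, abs_pv (rf \<alpha>2 p2 p1), \<alpha>2, \<alpha>1)"
            using co(3) by (rule symclp_rtranclpI)
          ultimately show ?thesis by (rule rtranclp_trans[rotated])
        next
          assume mm: "P.m \<le> -1"
          show ?thesis
          proof (cases "P.m = -1")
            case True
            have "Re (h p1 p1) * Re (h q1 q1) > 0"
              using parabolic_same_sign[OF cP cQ eR _ S ne True] k by (simp add: P.kap_def)
            then show ?thesis using neg by (simp add: P.n1_def Q.n1_def)
          next
            case False
            then have "P.m < -1" using mm by simp
            then have "P.m\<^sup>2 > 1" using abs_square_le_1[of P.m] by linarith
            note ss = P.elementary_simultaneous[OF ne this]
            have s: "P.n2 * Q.n2 < 0"
              using nn[OF mm] neg by (auto simp: zero_less_mult_iff mult_less_0_iff)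
            have "(symclp (elementary_relation h))\<^sup>*\<^sup>* (abs_pv (P.T p1), abs_pv (P.T p2), \<alpha>1, \<alpha>2) (abs_pv q1, abs_pv q2, \<beta>1, \<beta>2)"
            proof (rule connect_same_signs[OF ss(1) Q ss(2) eR _ k nel S[symmetric]])
              show "\<alpha>1 * \<alpha>2 = P.kap" by (simp add: P.kap_def)
              show "sgn (Re (h (P.T p1) (P.T p1))) = sgn (Re (h q1 q1))" unfolding ss(4) using sg_ne[OF neg] by (simp add: Q.n1_def)
              show "sgn (Re (h (P.T p2) (P.T p2))) = sgn (Re (h q2 q2))" unfolding ss(5) using sg_ne[OF s] by (simp add: Q.n2_def)
            qed
            moreover have "(symclp (elementary_relation h))\<^sup>*\<^sup>* (abs_pv p1, abs_pv p2, \<alpha>1, \<alpha>2)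
                (abs_pv (P.T p1), abs_pv (P.T p2), \<alpha>1, \<alpha>2)"
              using ss(3) by (rule symclp_rtranclpI)
            ultimately show ?thesis by (rule rtranclp_trans[rotated])
          qed
        qed
      qed
    qed
  qed
qed

end

theorem theorem6p23:
  fixes h :: "complex ^ 3 \<Rightarrow> complex ^ 3 \<Rightarrow> complex"
    and p1 p2 q1 q2 :: pv
    and \<alpha>1 \<alpha>2 \<beta>1 \<beta>2 \<delta> :: complex
  assumes "hermitian_form h" and "has_signature h UNIV [1, 1, -1]"
    and "p1 \<noteq> p2" and "sig h p1 \<noteq> 0" and "sig h p2 \<noteq> 0" and "\<not> orthogonal_pts h p1 p2"
    and "q1 \<noteq> q2" and "sig h q1 \<noteq> 0" and "sig h q2 \<noteq> 0" and "\<not> orthogonal_pts h q1 q2"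
    and "parameter \<alpha>1" and "parameter \<alpha>2" and "parameter \<beta>1" and "parameter \<beta>2"
    and "\<delta> \<in> Omega"
    and "\<not> euclidean_line h (line_through p1 p2)" and "\<not> euclidean_line h (line_through q1 q2)"
    and "refl_iso h \<alpha>2 p2 \<circ> refl_iso h \<alpha>1 p1
           = (\<lambda>x. \<delta> *s (refl_iso h \<beta>2 q2 \<circ> refl_iso h \<beta>1 q1) x)"
  shows "(symclp (elementary_relation h))\<^sup>*\<^sup>* (p1, p2, \<alpha>1, \<alpha>2) (q1, q2, \<beta>1, \<delta> * \<beta>2)"
proof -
  interpret hform h by unfold_locales (use assms in auto)
  have P: "quad (rep_pv p1) (rep_pv p2) \<alpha>1 \<alpha>2" and Q: "quad (rep_pv q1) (rep_pv q2) \<beta>1 (\<delta> * \<beta>2)"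
    unfolding is_quadruple_rep[symmetric] is_quadruple_def admissible_pair_def prod.case
    using assms parameter_Omega_mult by auto
  \<comment> \<open>A cube root of unity satisfies \<open>inverse (z\<^sup>2) = z\<close>, so the
    scalar \<open>\<delta>\<close> can be absorbed into the parameter.\<close>
  have "rf (\<delta> * \<beta>2) (rep_pv q2) (rf \<beta>1 (rep_pv q1) x) = rf \<alpha>2 (rep_pv p2) (rf \<alpha>1 (rep_pv p1) x)" for x
    using fun_cong[OF assms(18), of x] by (simp add: refl_iso_rep rf_Omega[OF assms(15)])
  from equal_products_connected[OF P Q this] show ?thesis by (simp add: abs_rep_pv)
qed

end
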